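(* Let $\beta\in W^{1,1}(0,T)$ with $\beta\not\equiv 0$ in $[0,T]$. For $f\in L^2(\Omega)$ denote by $u[f]$ the solution of $$ \begin{cases} {}^c\partial_t^{\alpha_0}u-\Delta u+\tilde g' * u=f(x)\beta(t), & (x,t)\in\Omega\times(0,T),\\ u(x,0)=0, & x\in\Omega,\\ u(x,t)=0, & (x,t)\in\partial\Omega\times(0,T). \end{cases} $$ Then there is a constant $C>0$, independent of $f_1,f_2$, such that for all $f_1,f_2\in L^2(\Omega)$ $$\|f_1-f_2\|_{\mathcal B}\le C\,\|u[f_1]-u[f_2]\|_{L^1(\Omega_0\times(0,T))}.$$
   Context: $\Omega\subset\mathbb R^d$, $1\le d\le 3$, is a simply-connected bounded domain with piecewise smooth boundary with convex corners, $0<T<\infty$, $\Omega_T=\Omega\times(0,T)$, and $\Omega_0\subset\Omega$ is a (nonempty, open) subdomain with characteristic function $\chi_{\Omega_0}$. The exponent $\alpha$ satisfies: (H1) $0<\alpha(t)<1$ on $[0,T]$, $\alpha$ is three times differentiable, and $|\alpha'(t)|+|\alpha''(t)|+|\alpha'''(t)|\le L$ for some $L>0$; (H2) for some $\theta\in(0,\frac{\pi}{2})$, $\alpha:(0,T)\to(0,1)$ can be analytically extended to the sector $\{z\in\mathbb C: |\arg z|<\theta\}$, with $|\alpha(z)|\le\alpha(0)<1$ there. Set $\alpha_0=\alpha(0)$. $$\tilde g(t)=\int_0^t\frac{t^{-\alpha(r)}}{\Gamma(1-\alpha(r))}\bigl(-\alpha'(r)\ln t+\gamma(1-\alpha(r))\alpha'(r)\bigr)\,dr,\qquad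 \gamma(r)=\frac{\Gamma'(r)}{\Gamma(r)}.$$ ${}^c\partial_t^{\alpha_0}u(t)=\frac{1}{\Gamma(1-\alpha_0)}\int_0^t (t-s)^{-\alpha_0}\partial_s u(s)\,ds$, $(h*u)(t)=\int_0^t h(t-s)u(s)\,ds$, $(h\star\phi)(t)=\int_t^T h(\tau-t)\phi(\tau)\,d\tau$. For $0<\mu<1$, $J_{T-}^{\mu}z(t)=\frac1{\Gamma(\mu)}\int_t^T (s-t)^{\mu-1}z(s)\,ds$ and $D_{T-}^{\mu}z=-\frac{d}{dt}J_{T-}^{1-\mu}z$. For $\omega\in W^{1,1}(0,T;L^2(\Omega_0))$, $\phi[\omega]$ denotes the solution of the adjoint problem $$ \begin{cases} D_{T-}^{\alpha_0}\phi-\Delta\phi+\tilde g'\star\phi=\chi_{\Omega_0}\omega(x,t), & (x,t)\in\Omega_T,\\ \phi(x,t)=0, & (x,t)\in\partial\Omega\times[0,T],\\ J_{T-}^{1-\alpha_0}\phi(x,T)=0, & x\in\Omega. \end{cases} $$ Solutions of both problems are taken in $W^{1,p}(0,T;L^2(\Omega))\cap L^p(0,T;H^2(\Omega)\cap H_0^1(\Omega))$ for some $p$ with $1<p<\frac1{1-\alpha_0}$, the equations holding almost everywhere. Let $\mathcal W=\{\omega\in W^{1,\infty}(0,T;L^\infty(\Omega_0)):\omega\ne0\}$ and, for $f\in L^2(\Omega)$, $\omega\in\mathcal W$, $$\mathcal B(f,\omega)=\int_{\Omega_T}\beta(t)f(x)\phi[\omega](x,t)\,dx\,dt,\qquad \|f\|_{\mathcal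 B}=\frac1{\|\beta\|_{L^\infty(0,T)}}\sup_{\omega\in\mathcal W}\frac{|\mathcal B(f,\omega)|}{\|\omega\|_{L^\infty(\Omega_0\times(0,T))}}.$$ *)

theory Defs
  imports "HOL-Probability.Essential_Supremum"
begin

section \<open>Lebesgue spaces\<close>

text \<open>
  Elements of Lebesgue and Sobolev spaces are represented by Borel measurable functions; every
  almost-everywhere class has such a representative, and nothing below depends on its choice.
\<close>

abbreviation leb :: "'a::euclidean_space set \<Rightarrow> 'a measure" where
  "leb S \<equiv> restrict_space lborel S"

definition Lnorm :: "ennreal \<Rightarrow> 'b measure \<Rightarrow> ('b \<Rightarrow> real) \<Rightarrow> ennreal" where
  "Lnorm p M f =
    (if p = \<infinity> then esssup M (\<lambda>x. ennreal \<bar>f x\<bar>)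
     else let I = (\<integral>\<^sup>+ x. ennreal (\<bar>f x\<bar> powr enn2real p) \<partial>M)
          in if I = \<infinity> then \<infinity> else ennreal (enn2real I powr (1 / enn2real p)))"

definition Lspace :: "ennreal \<Rightarrow> 'b measure \<Rightarrow> ('b \<Rightarrow> real) set" where
  "Lspace p M = {f \<in> borel_measurable M. Lnorm p M f < \<infinity>}"


section \<open>Weak derivatives and Sobolev spaces\<close>

definition dpartial :: "'a::euclidean_space \<Rightarrow> ('a \<Rightarrow> real) \<Rightarrow> 'a \<Rightarrow> real" where
  "dpartial i f x = frechet_derivative f (at x) i"

text \<open>Smooth means \<open>C\<^sup>\<infinity>\<close>: all iterated partial derivatives exist and are differentiable.\<close>

definition smooth_on :: "'a::euclidean_space set \<Rightarrow> ('a \<Rightarrow> real) \<Rightarrow> bool" where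
  "smooth_on S f \<longleftrightarrow>
    (\<forall>is\<in>lists Basis. \<forall>x\<in>S. foldr dpartial is f differentiable (at x))"

definition test_functions :: "'a::euclidean_space set \<Rightarrow> ('a \<Rightarrow> real) set" where
  "test_functions S =
    {\<eta>. smooth_on UNIV \<eta> \<and> (\<exists>K. compact K \<and> K \<subseteq> S \<and> (\<forall>x. x \<notin> K \<longrightarrow> \<eta> x = 0))}"

definition loc_integrable :: "'a::euclidean_space set \<Rightarrow> ('a \<Rightarrow> real) \<Rightarrow> bool" where
  "loc_integrable S f \<longleftrightarrow>
    f \<in> borel_measurable (leb S) \<and> (\<forall>K. compact K \<and> K \<subseteq> S \<longrightarrow> set_integrable lborel K f)"

definition weak_partial ::
  "'a::euclidean_space set \<Rightarrow> 'a \<Rightarrow> ('a \<Rightarrow> real) \<Rightarrow> ('a \<Rightarrow> real) \<Rightarrow> bool" where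
  "weak_partial S i f g \<longleftrightarrow> loc_integrable S f \<and> loc_integrable S g \<and>
    (\<forall>\<eta>\<in>test_functions S. (LINT x|leb S. f x * dpartial i \<eta> x) = - (LINT x|leb S. g x * \<eta> x))"

text \<open>A representative of the weak partial derivative, meaningful when one exists.\<close>

definition wd :: "'a::euclidean_space set \<Rightarrow> 'a \<Rightarrow> ('a \<Rightarrow> real) \<Rightarrow> 'a \<Rightarrow> real" where
  "wd S i f = (SOME g. weak_partial S i f g)"

primrec Hspace :: "nat \<Rightarrow> 'a::euclidean_space set \<Rightarrow> ('a \<Rightarrow> real) set" where
  "Hspace 0 S = Lspace 2 (leb S)"
| "Hspace (Suc k) S =
    {f \<in> Lspace 2 (leb S). \<forall>i\<in>Basis. \<exists>g\<in>Hspace k S. weak_partial S i f g}"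

primrec Hnorm_sq :: "nat \<Rightarrow> 'a::euclidean_space set \<Rightarrow> ('a \<Rightarrow> real) \<Rightarrow> ennreal" where
  "Hnorm_sq 0 S f = (Lnorm 2 (leb S) f)\<^sup>2"
| "Hnorm_sq (Suc k) S f = (Lnorm 2 (leb S) f)\<^sup>2 + (\<Sum>i\<in>Basis. Hnorm_sq k S (wd S i f))"

definition Hnorm :: "nat \<Rightarrow> 'a::euclidean_space set \<Rightarrow> ('a \<Rightarrow> real) \<Rightarrow> ennreal" where
  "Hnorm k S f =
    (if Hnorm_sq k S f = \<infinity> then \<infinity> else ennreal (sqrt (enn2real (Hnorm_sq k S f))))"

definition H10 :: "'a::euclidean_space set \<Rightarrow> ('a \<Rightarrow> real) set" where
  "H10 S = {f \<in> Hspace 1 S. \<exists>\<eta>::nat \<Rightarrow> 'a \<Rightarrow> real.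
      (\<forall>n. \<eta> n \<in> test_functions S) \<and> (\<lambda>n. Hnorm 1 S (\<lambda>x. \<eta> n x - f x)) \<longlonglongrightarrow> 0}"

definition laplacian :: "'a::euclidean_space set \<Rightarrow> ('a \<Rightarrow> real) \<Rightarrow> 'a \<Rightarrow> real" where
  "laplacian S f x = (\<Sum>i\<in>Basis. wd S i (wd S i f) x)"

definition W1_scalar :: "ennreal \<Rightarrow> real \<Rightarrow> (real \<Rightarrow> real) set" where
  "W1_scalar p T = {b \<in> Lspace p (leb {0<..<T}).
      \<exists>b'\<in>Lspace p (leb {0<..<T}). weak_partial {0<..<T} 1 b b'}"


section \<open>Bochner spaces on \<open>(0,T)\<close>\<close>

text \<open>
  A curve with values in a space of functions on \<open>S\<close> is written \<open>u t x\<close>. The space \<open>X\<close> is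
  given by its carrier and its norm \<open>N\<close>. Strong measurability is approximability by simple
  functions in \<open>X\<close>. In addition \<open>u\<close> is taken to be a jointly measurable representative,
  which exists for every strongly measurable curve in the spaces used here; this makes
  Bochner integrals over time agree with integrals over \<open>t\<close> for almost every \<open>x\<close>.
\<close>

definition simple_curve :: "('a \<Rightarrow> real) set \<Rightarrow> (real \<Rightarrow> 'a \<Rightarrow> real) \<Rightarrow> bool" where
  "simple_curve X s \<longleftrightarrow> (\<exists>(m::nat) A h. (\<forall>k<m. A k \<in> sets borel \<and> h k \<in> X) \<and>
      s = (\<lambda>t x. \<Sum>k<m. indicator (A k) t * h k x))"

definition strongly_measurable ::
  "real \<Rightarrow> ('a \<Rightarrow> real) set \<Rightarrow> (('a \<Rightarrow> real) \<Rightarrow> ennreal) \<Rightarrow> (real \<Rightarrow> 'a \<Rightarrow> real) \<Rightarrow> bool" where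
  "strongly_measurable T X N u \<longleftrightarrow> (\<exists>s::nat \<Rightarrow> real \<Rightarrow> 'a \<Rightarrow> real. (\<forall>n. simple_curve X (s n)) \<and>
      (AE t in leb {0<..<T}. (\<lambda>n. N (\<lambda>x. s n t x - u t x)) \<longlonglongrightarrow> 0))"

definition bochner ::
  "ennreal \<Rightarrow> real \<Rightarrow> 'a::euclidean_space set \<Rightarrow> ('a \<Rightarrow> real) set \<Rightarrow> (('a \<Rightarrow> real) \<Rightarrow> ennreal)
    \<Rightarrow> (real \<Rightarrow> 'a \<Rightarrow> real) set" where
  "bochner p T S X N = {u.
      (\<lambda>(x, t). u t x) \<in> borel_measurable (leb (S \<times> {0<..<T})) \<and>
      (AE t in leb {0<..<T}. u t \<in> X) \<and>
      strongly_measurable T X N u \<and>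
      Lnorm p (leb {0<..<T}) (\<lambda>t. enn2real (N (u t))) < \<infinity>}"

abbreviation bochner_L ::
  "ennreal \<Rightarrow> real \<Rightarrow> ennreal \<Rightarrow> 'a::euclidean_space set \<Rightarrow> (real \<Rightarrow> 'a \<Rightarrow> real) set" where
  "bochner_L p T q S \<equiv> bochner p T S (Lspace q (leb S)) (Lnorm q (leb S))"

text \<open>The weak time derivative; both sides are Bochner integrals over \<open>(0,T)\<close>.\<close>

definition time_deriv ::
  "real \<Rightarrow> 'a::euclidean_space set \<Rightarrow> (real \<Rightarrow> 'a \<Rightarrow> real) \<Rightarrow> (real \<Rightarrow> 'a \<Rightarrow> real) \<Rightarrow> bool" where
  "time_deriv T S u v \<longleftrightarrow> (\<forall>\<psi>\<in>test_functions {0<..<T}.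
      AE x in leb S. (LINT t|leb {0<..<T}. deriv \<psi> t * u t x)
                   = - (LINT t|leb {0<..<T}. \<psi> t * v t x))"

definition W1_bochner_L ::
  "ennreal \<Rightarrow> real \<Rightarrow> ennreal \<Rightarrow> 'a::euclidean_space set \<Rightarrow> (real \<Rightarrow> 'a \<Rightarrow> real) set" where
  "W1_bochner_L p T q S =
    {u \<in> bochner_L p T q S. \<exists>v\<in>bochner_L p T q S. time_deriv T S u v}"

text \<open>
  The value at \<open>t0\<close> of a curve in \<open>L\<^sup>2(S)\<close>: the value of its representative \<open>v\<close> in
  \<open>C([0,T];L\<^sup>2(S))\<close>.
\<close>

definition has_time_trace ::
  "real \<Rightarrow> 'a::euclidean_space set \<Rightarrow> (real \<Rightarrow> 'a \<Rightarrow> real) \<Rightarrow> real \<Rightarrow> ('a \<Rightarrow> real) \<Rightarrow> bool" where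
  "has_time_trace T S u t0 h \<longleftrightarrow> (\<exists>v.
      (\<forall>t\<in>{0..T}. v t \<in> Lspace 2 (leb S)) \<and>
      (\<forall>t\<in>{0..T}. ((\<lambda>s. Lnorm 2 (leb S) (\<lambda>x. v s x - v t x)) \<longlongrightarrow> 0) (at t within {0..T})) \<and>
      (AE t in leb {0<..<T}. AE x in leb S. u t x = v t x) \<and>
      (AE x in leb S. v t0 x = h x))"


section \<open>The domain\<close>

definition tangent_cone :: "'a::euclidean_space set \<Rightarrow> 'a \<Rightarrow> 'a set" where
  "tangent_cone S a = {v. \<exists>(x::nat \<Rightarrow> 'a) (r::nat \<Rightarrow> real). (\<forall>n. x n \<in> S \<and> r n > 0) \<and>
      x \<longlonglongrightarrow> a \<and> r \<longlonglongrightarrow> 0 \<and> (\<lambda>n. (x n - a) /\<^sub>R r n) \<longlonglongrightarrow> v}"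

text \<open>
  The boundary consists of finitely many connected compact pieces of smooth regular
  hypersurfaces \<open>\<psi> = 0\<close>. At every boundary point the domain has a tangent cone which is convex
  (a half space at regular points, a smaller convex cone at corners) and is neither
  degenerate, as at an outward cusp, nor the whole space, as at a slit.
\<close>

definition piecewise_smooth_convex_corners :: "'a::euclidean_space set \<Rightarrow> bool" where
  "piecewise_smooth_convex_corners S \<longleftrightarrow>
    (\<exists>P. finite P \<and> frontier S = \<Union>P \<and>
      (\<forall>K\<in>P. compact K \<and> connected K \<and>
        (\<exists>U \<psi>. open U \<and> smooth_on U \<psi> \<and> K \<subseteq> {x\<in>U. \<psi> x = 0} \<and>
          (\<forall>x\<in>U. \<exists>v. frechet_derivative \<psi> (at x) v \<noteq> 0)))) \<and>
    (\<forall>a\<in>frontier S. convex (tangent_cone S a) \<and> interior (tangent_cone S a) \<noteq> {} \<and>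
      tangent_cone S a \<noteq> UNIV)"


section \<open>The variable exponent\<close>

text \<open>The derivative on \<open>[0,T]\<close>, one-sided at the end points.\<close>

definition deriv_I :: "real \<Rightarrow> (real \<Rightarrow> real) \<Rightarrow> real \<Rightarrow> real" where
  "deriv_I T a t = vector_derivative a (at t within {0..T})"

definition hyp_H1 :: "real \<Rightarrow> (real \<Rightarrow> real) \<Rightarrow> bool" where
  "hyp_H1 T \<alpha> \<longleftrightarrow> (\<forall>t\<in>{0..T}. 0 < \<alpha> t \<and> \<alpha> t < 1) \<and>
    (\<forall>k<3. (deriv_I T ^^ k) \<alpha> differentiable_on {0..T}) \<and>
    (\<exists>L>0. \<forall>t\<in>{0..T}.
      \<bar>deriv_I T \<alpha> t\<bar> + \<bar>(deriv_I T ^^ 2) \<alpha> t\<bar> + \<bar>(deriv_I T ^^ 3) \<alpha> t\<bar> \<le> L)"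

definition hyp_H2 :: "real \<Rightarrow> (real \<Rightarrow> real) \<Rightarrow> bool" where
  "hyp_H2 T \<alpha> \<longleftrightarrow> (\<exists>\<theta> F. 0 < \<theta> \<and> \<theta> < pi / 2 \<and>
    F holomorphic_on {z. z \<noteq> 0 \<and> \<bar>Arg z\<bar> < \<theta>} \<and>
    (\<forall>t\<in>{0<..<T}. F (complex_of_real t) = complex_of_real (\<alpha> t)) \<and>
    (\<forall>z. z \<noteq> 0 \<and> \<bar>Arg z\<bar> < \<theta> \<longrightarrow> cmod (F z) \<le> \<alpha> 0) \<and> \<alpha> 0 < 1)"

text \<open>\<open>Digamma\<close> is \<open>\<Gamma>'/\<Gamma>\<close>.\<close>

definition g_tilde :: "real \<Rightarrow> (real \<Rightarrow> real) \<Rightarrow> real \<Rightarrow> real" where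
  "g_tilde T \<alpha> t = (LINT r|leb {0<..<t}.
      t powr (- \<alpha> r) / Gamma (1 - \<alpha> r) *
        (- deriv_I T \<alpha> r * ln t + Digamma (1 - \<alpha> r) * deriv_I T \<alpha> r))"


section \<open>Fractional operators\<close>

text \<open>The Caputo derivative of a curve, as a function of its time derivative \<open>u'\<close>.\<close>

definition caputo :: "real \<Rightarrow> (real \<Rightarrow> 'a \<Rightarrow> real) \<Rightarrow> real \<Rightarrow> 'a \<Rightarrow> real" where
  "caputo \<mu> u' t x = 1 / Gamma (1 - \<mu>) * (LINT s|leb {0<..<t}. (t - s) powr (- \<mu>) * u' s x)"

definition conv :: "(real \<Rightarrow> real) \<Rightarrow> (real \<Rightarrow> 'a \<Rightarrow> real) \<Rightarrow> real \<Rightarrow> 'a \<Rightarrow> real" where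
  "conv h u t x = (LINT s|leb {0<..<t}. h (t - s) * u s x)"

definition adj_conv :: "real \<Rightarrow> (real \<Rightarrow> real) \<Rightarrow> (real \<Rightarrow> 'a \<Rightarrow> real) \<Rightarrow> real \<Rightarrow> 'a \<Rightarrow> real" where
  "adj_conv T h \<phi> t x = (LINT \<tau>|leb {t<..<T}. h (\<tau> - t) * \<phi> \<tau> x)"

definition J_right :: "real \<Rightarrow> real \<Rightarrow> (real \<Rightarrow> 'a \<Rightarrow> real) \<Rightarrow> real \<Rightarrow> 'a \<Rightarrow> real" where
  "J_right T \<mu> z t x = 1 / Gamma \<mu> * (LINT s|leb {t<..<T}. (s - t) powr (\<mu> - 1) * z s x)"

text \<open>\<open>d\<close> is the backward Riemann-Liouville derivative \<open>- d/dt J\<^sup>1\<^sup>-\<^sup>\<mu> z\<close>.\<close>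

definition has_D_right ::
  "real \<Rightarrow> 'a::euclidean_space set \<Rightarrow> real \<Rightarrow> (real \<Rightarrow> 'a \<Rightarrow> real) \<Rightarrow> (real \<Rightarrow> 'a \<Rightarrow> real) \<Rightarrow> bool" where
  "has_D_right T S \<mu> z d \<longleftrightarrow> time_deriv T S (J_right T (1 - \<mu>) z) (\<lambda>t x. - d t x)"


section \<open>The direct and the adjoint problem\<close>

text \<open>
  \<open>W\<^sup>1\<^sup>,\<^sup>p(0,T;L\<^sup>2(S)) \<inter> L\<^sup>p(0,T;H\<^sup>2(S) \<inter> H\<^sub>0\<^sup>1(S))\<close>; the Dirichlet condition
  is the membership in \<open>H\<^sub>0\<^sup>1\<close>.
\<close>

definition solution_space ::
  "real \<Rightarrow> real \<Rightarrow> 'a::euclidean_space set \<Rightarrow> (real \<Rightarrow> 'a \<Rightarrow> real) set" where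
  "solution_space p T S =
    W1_bochner_L (ennreal p) T 2 S \<inter> bochner (ennreal p) T S (Hspace 2 S \<inter> H10 S) (Hnorm 2 S)"

text \<open>A jointly measurable representative of \<open>t \<mapsto> \<Delta>u(t)\<close>.\<close>

definition has_laplacian ::
  "real \<Rightarrow> 'a::euclidean_space set \<Rightarrow> (real \<Rightarrow> 'a \<Rightarrow> real) \<Rightarrow> (real \<Rightarrow> 'a \<Rightarrow> real) \<Rightarrow> bool" where
  "has_laplacian T S u w \<longleftrightarrow>
    (\<lambda>(x, t). w t x) \<in> borel_measurable (leb (S \<times> {0<..<T})) \<and>
    (AE t in leb {0<..<T}. AE x in leb S. w t x = laplacian S (u t) x)"

definition direct_solution ::
  "real \<Rightarrow> 'a::euclidean_space set \<Rightarrow> (real \<Rightarrow> real) \<Rightarrow> (real \<Rightarrow> real) \<Rightarrow> ('a \<Rightarrow> real)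
    \<Rightarrow> (real \<Rightarrow> 'a \<Rightarrow> real) \<Rightarrow> bool" where
  "direct_solution T S \<alpha> \<beta> f u \<longleftrightarrow>
    (\<exists>p u' w. 1 < p \<and> p < 1 / (1 - \<alpha> 0) \<and>
      u \<in> solution_space p T S \<and>
      u' \<in> bochner_L (ennreal p) T 2 S \<and> time_deriv T S u u' \<and>
      has_laplacian T S u w \<and>
      (AE (x, t) in leb (S \<times> {0<..<T}).
        caputo (\<alpha> 0) u' t x - w t x + conv (deriv (g_tilde T \<alpha>)) u t x = f x * \<beta> t) \<and>
      has_time_trace T S u 0 (\<lambda>x. 0))"

definition adjoint_solution ::
  "real \<Rightarrow> 'a::euclidean_space set \<Rightarrow> 'a set \<Rightarrow> (real \<Rightarrow> real) \<Rightarrow> (real \<Rightarrow> 'a \<Rightarrow> real)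
    \<Rightarrow> (real \<Rightarrow> 'a \<Rightarrow> real) \<Rightarrow> bool" where
  "adjoint_solution T S S0 \<alpha> \<omega> \<phi> \<longleftrightarrow>
    (\<exists>p d w. 1 < p \<and> p < 1 / (1 - \<alpha> 0) \<and>
      \<phi> \<in> solution_space p T S \<and>
      d \<in> bochner_L 1 T 2 S \<and> has_D_right T S (\<alpha> 0) \<phi> d \<and>
      has_laplacian T S \<phi> w \<and>
      (AE (x, t) in leb (S \<times> {0<..<T}).
        d t x - w t x + adj_conv T (deriv (g_tilde T \<alpha>)) \<phi> t x = indicator S0 x * \<omega> t x) \<and>
      has_time_trace T S (J_right T (1 - \<alpha> 0) \<phi>) T (\<lambda>x. 0))"


section \<open>The weighted norm\<close>

definition weights :: "real \<Rightarrow> 'a::euclidean_space set \<Rightarrow> (real \<Rightarrow> 'a \<Rightarrow> real) set" where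
  "weights T S0 = {\<omega> \<in> W1_bochner_L \<infinity> T \<infinity> S0.
      \<not> (AE (x, t) in leb (S0 \<times> {0<..<T}). \<omega> t x = 0)}"

text \<open>\<open>\<B>(f,\<omega>)\<close>, as a function of the adjoint solution \<open>\<phi> = \<phi>[\<omega>]\<close>.\<close>

definition B_form ::
  "real \<Rightarrow> 'a::euclidean_space set \<Rightarrow> (real \<Rightarrow> real) \<Rightarrow> ('a \<Rightarrow> real) \<Rightarrow> (real \<Rightarrow> 'a \<Rightarrow> real) \<Rightarrow> real" where
  "B_form T S \<beta> f \<phi> = (LINT (x, t)|leb (S \<times> {0<..<T}). \<beta> t * f x * \<phi> t x)"

text \<open>
  The supremum runs over the weights \<open>\<omega>\<close> paired with their adjoint solution \<open>\<phi>[\<omega>]\<close>.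
  The adjoint problem has exactly one solution up to null sets, on which \<open>B_form\<close> does not depend.
\<close>

definition B_norm ::
  "real \<Rightarrow> 'a::euclidean_space set \<Rightarrow> 'a set \<Rightarrow> (real \<Rightarrow> real) \<Rightarrow> (real \<Rightarrow> real) \<Rightarrow> ('a \<Rightarrow> real)
    \<Rightarrow> ennreal" where
  "B_norm T S S0 \<alpha> \<beta> f =
    (1 / Lnorm \<infinity> (leb {0<..<T}) \<beta>) *
    (SUP (\<omega>, \<phi>) \<in> {(\<omega>, \<phi>). \<omega> \<in> weights T S0 \<and> adjoint_solution T S S0 \<alpha> \<omega> \<phi>}.
      ennreal \<bar>B_form T S \<beta> f \<phi>\<bar> / Lnorm \<infinity> (leb (S0 \<times> {0<..<T})) (\<lambda>(x, t). \<omega> t x))"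

end

(*
The constant is C = 1 / ||beta||_oo. Testing the direct problem for f with the adjoint solution phi
of the weight omega gives the identity

  int_{Omega_T} beta f phi = int_{Omega_0 x (0,T)} omega u[f],

so that B(f1 - f2, omega) is at most ||omega||_oo times the L^1 norm of u[f1] - u[f2].

For the identity, the convolutions are moved across by Fubini, and Delta by Green's formula for
functions in H^2 and H^1_0 at almost every time. The Caputo term becomes the integral of u' against
J phi, where J is the backward fractional integral; since J phi vanishes at T it is the integral of
D phi from t to T, and since u vanishes at 0 another application of Fubini gives the integral of
u D phi. Everything is integrable because u and phi, being W^{1,1} in time with values in L^2, are
dominated by functions of x alone in L^2, and because the derivative of g_tilde is O(t^{-nu}) with
nu < 1: by the fundamental theorem of calculus, g_tilde(t) is the difference between r = t and r = 0
of t^{-alpha(r)} / Gamma(1 - alpha(r)).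
*)

theory Submission
  imports Defs
begin

text \<open>When \<open>\<alpha> 0\<close> is small, the exponents of both solutions are forced
  close to 1, and \<open>d\<close> is only integrable in time, so Hoelder's inequality in time
  cannot pair a derivative of one solution with the other solution. The pairing is done in mixed
  spaces with x outside: L^2 in x of L^1 in time against L^2 in x of L^\<infinity> in time. Hence
  identities in time are proved for almost every fixed x and integrated over x last. Time
  derivatives and traces are given weakly: the null set in \<open>time_deriv\<close> depends on the
  test function, and a trace is the value of another representative of the curve. Both difficulties
  are settled by writing a curve as c(x) plus the primitive of its derivative and finding c from the
  trace. After that no boundary terms occur. Up to constants, all operators in time are
  \<open>volterra\<close> with an integrable kernel, and transposition is reflection of the kernel.
  Integrability of the terms with the Laplacian is not estimated but read off the equations, whose
  other terms are integrable after multiplication.\<close>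

section \<open>Product measures and time integrals of L^2-valued curves\<close>

text \<open>The definitions integrate over a product set as one restricted measure, while Fubini
  needs a product measure. The measurable sets coincide because the identity is measurable from the
  product into the Borel sets, and agreement on rectangles then suffices by
  sigma-finiteness.\<close>

lemma leb_Times:
  fixes S :: "'a::euclidean_space set" and I :: "'b::euclidean_space set"
  assumes S: "S \<in> sets borel" and I: "I \<in> sets borel"
  shows "leb (S \<times> I) = leb S \<Otimes>\<^sub>M leb I"
proof (rule pair_measure_eqI[symmetric])
  have SI: "S \<times> I \<in> sets (borel :: ('a \<times> 'b) measure)"
    using S I by (metis borel_prod pair_measureI)
  have box: "A \<times> B \<in> sets (borel :: ('a \<times> 'b) measure)"
    if "A \<in> sets borel" "B \<in> sets borel" for A B
    using that by (metis borel_prod pair_measureI)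
  show "sigma_finite_measure (leb S)" "sigma_finite_measure (leb I)"
    using S I by (auto intro!: sigma_finite_measure_restrict_space sigma_finite_lborel)
  show "sets (leb S \<Otimes>\<^sub>M leb I) = sets (leb (S \<times> I))"
  proof (intro set_eqI iffI)
    fix X assume "X \<in> sets (leb S \<Otimes>\<^sub>M leb I)"
    moreover have "sets (leb S \<Otimes>\<^sub>M leb I) \<subseteq> sets (leb (S \<times> I))"
    proof -
      have "A \<times> B \<in> sets (leb (S \<times> I))" if "A \<in> sets (leb S)" "B \<in> sets (leb I)" for A B
        using that S I SI box[of A B] by (auto simp: sets_restrict_space_iff)
      then have "sigma_sets (S \<times> I) {A \<times> B |A B. A \<in> sets (leb S) \<and> B \<in> sets (leb I)}
          \<subseteq> sets (leb (S \<times> I))"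
        using sets.sigma_sets_subset[of "{A \<times> B |A B. A \<in> sets (leb S) \<and> B \<in> sets (leb I)}" "leb (S \<times> I)"] SI
        by auto
      then show ?thesis using S I by (simp add: sets_pair_measure)
    qed
    ultimately show "X \<in> sets (leb (S \<times> I))" by auto
  next
    fix X assume X: "X \<in> sets (leb (S \<times> I))"
    have [measurable]: "(\<lambda>z. z) \<in> leb S \<Otimes>\<^sub>M leb I \<rightarrow>\<^sub>M (borel :: ('a \<times> 'b) measure)"
    proof -
      have "(\<lambda>z. (fst z, snd z)) \<in> leb S \<Otimes>\<^sub>M leb I \<rightarrow>\<^sub>M (borel \<Otimes>\<^sub>M borel :: ('a \<times> 'b) measure)"
        by (intro measurable_Pair measurable_compose[OF measurable_fst] measurable_compose[OF measurable_snd] measurable_restrict_space1) auto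
      then show ?thesis by (simp add: borel_prod)
    qed
    from X SI have "X \<in> sets borel" "X \<subseteq> S \<times> I" by (auto simp: sets_restrict_space_iff)
    then have "(\<lambda>z. z) -` X \<inter> space (leb S \<Otimes>\<^sub>M leb I) \<in> sets (leb S \<Otimes>\<^sub>M leb I)"
      by (intro measurable_sets) auto
    moreover have "(\<lambda>z. z) -` X \<inter> space (leb S \<Otimes>\<^sub>M leb I) = X"
      using \<open>X \<subseteq> S \<times> I\<close> S I by (auto simp: space_pair_measure)
    ultimately show "X \<in> sets (leb S \<Otimes>\<^sub>M leb I)" by simp
  qed
  fix A B assume A: "A \<in> sets (leb S)" and B: "B \<in> sets (leb I)"
  have "A \<in> sets borel" "B \<in> sets borel" "A \<subseteq> S" "B \<subseteq> I" using A B S I by (auto simp: sets_restrict_space_iff)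
  then show "emeasure (leb S) A * emeasure (leb I) B = emeasure (leb (S \<times> I)) (A \<times> B)"
    using S I SI
    by (simp add: emeasure_restrict_space Sigma_mono lborel_prod[symmetric] lborel.emeasure_pair_measure_Times
       del: lborel_prod)
qed

lemma finite_leb: "S \<in> sets borel \<Longrightarrow> bounded S \<Longrightarrow> finite_measure (leb S)"
  using emeasure_bounded_finite[of S]
  by (intro finite_measureI) (simp add: emeasure_restrict_space top.not_eq_extremum)

lemma ennreal_le_of_power2_le: "(a::ennreal)\<^sup>2 \<le> b\<^sup>2 \<Longrightarrow> a \<le> b"
proof (rule ccontr)
  assume le: "a\<^sup>2 \<le> b\<^sup>2" and "\<not> a \<le> b"
  then have "b < a" by simp
  then obtain r where r: "b = ennreal r" "0 \<le> r" by (cases b) auto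
  show False
  proof (cases a)
    case (real s)
    then show False using le r \<open>b < a\<close>
      by (auto simp: ennreal_power ennreal_less_iff power_mono_iff)
  next
    case top
    then show False using le r by (auto simp: ennreal_power top_power_ennreal top_unique)
  qed
qed

text \<open>The square of the inner integral is a double integral over s and t. With the integral
  over x moved inside, Cauchy-Schwarz bounds the contribution of (s, t) by \<open>n s * n t\<close>,
  and the double integral splits into a square. The majorant \<open>n\<close> is arbitrary so that a
  visibly measurable one can be supplied.\<close>

lemma minkowski_L2:
  fixes u :: "'t \<Rightarrow> 'x \<Rightarrow> real" and n :: "'t \<Rightarrow> ennreal"
  assumes M: "sigma_finite_measure M" and N: "sigma_finite_measure N"
    and u: "(\<lambda>(x, t). u t x) \<in> borel_measurable (M \<Otimes>\<^sub>M N)"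
    and n[measurable]: "n \<in> borel_measurable N"
    and un: "AE t in N. (\<integral>\<^sup>+x. (ennreal \<bar>u t x\<bar>)\<^sup>2 \<partial>M) \<le> (n t)\<^sup>2"
  shows "(\<integral>\<^sup>+x. (\<integral>\<^sup>+t. ennreal \<bar>u t x\<bar> \<partial>N)\<^sup>2 \<partial>M) \<le> (\<integral>\<^sup>+t. n t \<partial>N)\<^sup>2"
proof -
  interpret M: sigma_finite_measure M by fact
  interpret N: sigma_finite_measure N by fact
  interpret MN: pair_sigma_finite M N ..
  interpret NN: pair_sigma_finite N N ..
  have u'[measurable]: "(\<lambda>z. u (snd z) (fst z)) \<in> borel_measurable (M \<Otimes>\<^sub>M N)"
    using u by (simp add: case_prod_beta)
  have ux[measurable]: "u t \<in> borel_measurable M" if "t \<in> space N" for t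
    using measurable_compose[OF measurable_Pair2'[OF that] u] by simp
  have m1[measurable]: "(\<lambda>(x,t). ennreal \<bar>u t x\<bar>) \<in> borel_measurable (M \<Otimes>\<^sub>M N)"
    by (simp add: case_prod_beta)
  have ut[measurable]: "(\<lambda>t. ennreal \<bar>u t x\<bar>) \<in> borel_measurable N" if "x \<in> space M" for x
    using measurable_compose[OF measurable_Pair1'[OF that] m1] by simp
  have m2[measurable]: "(\<lambda>(x,s). ennreal \<bar>u s x\<bar> * (\<integral>\<^sup>+t. ennreal \<bar>u t x\<bar> \<partial>N)) \<in> borel_measurable (M \<Otimes>\<^sub>M N)"
    by (simp add: case_prod_beta)
  have m3: "(\<lambda>((x,s),t). ennreal \<bar>u s x\<bar> * ennreal \<bar>u t x\<bar>) \<in> borel_measurable ((M \<Otimes>\<^sub>M N) \<Otimes>\<^sub>M N)"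
  proof -
    have "(\<lambda>z. (\<lambda>(x,t). ennreal \<bar>u t x\<bar>) (fst z) * (\<lambda>(x,t). ennreal \<bar>u t x\<bar>) (fst (fst z), snd z))
       \<in> borel_measurable ((M \<Otimes>\<^sub>M N) \<Otimes>\<^sub>M N)"
      by measurable
    also have "(\<lambda>z. (\<lambda>(x,t). ennreal \<bar>u t x\<bar>) (fst z) * (\<lambda>(x,t). ennreal \<bar>u t x\<bar>) (fst (fst z), snd z))
      = (\<lambda>((x,s),t). ennreal \<bar>u s x\<bar> * ennreal \<bar>u t x\<bar>)" by auto
    finally show ?thesis .
  qed
  have "(\<integral>\<^sup>+x. (\<integral>\<^sup>+t. ennreal \<bar>u t x\<bar> \<partial>N)\<^sup>2 \<partial>M)
     = (\<integral>\<^sup>+x. (\<integral>\<^sup>+s. ennreal \<bar>u s x\<bar> * (\<integral>\<^sup>+t. ennreal \<bar>u t x\<bar> \<partial>N) \<partial>N) \<partial>M)"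
    by (intro nn_integral_cong) (simp add: nn_integral_multc[OF ut] power2_eq_square)
  also have "\<dots> = (\<integral>\<^sup>+s. (\<integral>\<^sup>+x. ennreal \<bar>u s x\<bar> * (\<integral>\<^sup>+t. ennreal \<bar>u t x\<bar> \<partial>N) \<partial>M) \<partial>N)"
    using MN.Fubini'[OF m2] by simp
  also have "\<dots> = (\<integral>\<^sup>+s. (\<integral>\<^sup>+x. (\<integral>\<^sup>+t. ennreal \<bar>u s x\<bar> * ennreal \<bar>u t x\<bar> \<partial>N) \<partial>M) \<partial>N)"
    by (intro nn_integral_cong) (simp add: nn_integral_cmult[OF ut])
  also have "\<dots> = (\<integral>\<^sup>+s. (\<integral>\<^sup>+t. (\<integral>\<^sup>+x. ennreal \<bar>u s x\<bar> * ennreal \<bar>u t x\<bar> \<partial>M) \<partial>N) \<partial>N)"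
  proof (intro nn_integral_cong)
    fix s assume s: "s \<in> space N"
    have "(\<lambda>z. ((fst z, s), snd z)) \<in> M \<Otimes>\<^sub>M N \<rightarrow>\<^sub>M (M \<Otimes>\<^sub>M N) \<Otimes>\<^sub>M N"
      using s by measurable
    from measurable_compose[OF this m3]
    have "(\<lambda>(x,t). ennreal \<bar>u s x\<bar> * ennreal \<bar>u t x\<bar>) \<in> borel_measurable (M \<Otimes>\<^sub>M N)"
      by (simp add: case_prod_beta)
    from MN.Fubini'[OF this]
    show "(\<integral>\<^sup>+x. (\<integral>\<^sup>+t. ennreal \<bar>u s x\<bar> * ennreal \<bar>u t x\<bar> \<partial>N) \<partial>M)
      = (\<integral>\<^sup>+t. (\<integral>\<^sup>+x. ennreal \<bar>u s x\<bar> * ennreal \<bar>u t x\<bar> \<partial>M) \<partial>N)" by simp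
  qed
  also have "\<dots> \<le> (\<integral>\<^sup>+s. (\<integral>\<^sup>+t. n s * n t \<partial>N) \<partial>N)"
  proof (intro nn_integral_mono_AE)
    show "AE s in N. (\<integral>\<^sup>+t. (\<integral>\<^sup>+x. ennreal \<bar>u s x\<bar> * ennreal \<bar>u t x\<bar> \<partial>M) \<partial>N) \<le> (\<integral>\<^sup>+t. n s * n t \<partial>N)"
      using un AE_space
    proof eventually_elim
      case (elim s)
      show ?case
      proof (intro nn_integral_mono_AE)
        show "AE t in N. (\<integral>\<^sup>+x. ennreal \<bar>u s x\<bar> * ennreal \<bar>u t x\<bar> \<partial>M) \<le> n s * n t"
          using un AE_space
        proof eventually_elim
          case el: (elim t)
          have "(\<integral>\<^sup>+x. ennreal \<bar>u s x\<bar> * ennreal \<bar>u t x\<bar> \<partial>M)\<^sup>2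
            \<le> (\<integral>\<^sup>+x. (ennreal \<bar>u s x\<bar>)\<^sup>2 \<partial>M) * (\<integral>\<^sup>+x. (ennreal \<bar>u t x\<bar>)\<^sup>2 \<partial>M)"
            using el elim by (intro Cauchy_Schwarz_nn_integral) auto
          also have "\<dots> \<le> (n s)\<^sup>2 * (n t)\<^sup>2" using el elim by (intro mult_mono) auto
          also have "\<dots> = (n s * n t)\<^sup>2" by (simp only: power_mult_distrib)
          finally show ?case by (rule ennreal_le_of_power2_le)
        qed
      qed
    qed
  qed
  also have "\<dots> = (\<integral>\<^sup>+t. n t \<partial>N)\<^sup>2"
    by (simp only: nn_integral_cmult[OF n] nn_integral_multc[OF n] power2_eq_square)
  finally show ?thesis .
qed

lemma Lspace_2_iff:
  "f \<in> Lspace 2 M \<longleftrightarrow> f \<in> borel_measurable M \<and> (\<integral>\<^sup>+x. (ennreal \<bar>f x\<bar>)\<^sup>2 \<partial>M) < \<infinity>"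
  by (auto simp: Lspace_def Lnorm_def Let_def ennreal_power top.not_eq_extremum)

lemma Lnorm_2_power2:
  "(Lnorm 2 M f)\<^sup>2 = (\<integral>\<^sup>+x. (ennreal \<bar>f x\<bar>)\<^sup>2 \<partial>M)"
proof (cases "(\<integral>\<^sup>+x. (ennreal \<bar>f x\<bar>)\<^sup>2 \<partial>M)")
  case (real r)
  then show ?thesis
    by (auto simp: Lnorm_def Let_def ennreal_power powr_half_sqrt)
next
  case top
  then show ?thesis by (simp add: Lnorm_def Let_def ennreal_power top_power_ennreal)
qed

text \<open>
  A consequence of \<open>u \<in> L\<^sup>1(0,T;L\<^sup>2)\<close>, by Minkowski's integral inequality. It yields majorants in
  \<open>L\<^sup>2\<close> that do not depend on \<open>t\<close>, so that identities in time can be proved for fixed \<open>x\<close>.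
\<close>

definition L2_of_L1 :: "'x measure \<Rightarrow> 't measure \<Rightarrow> ('t \<Rightarrow> 'x \<Rightarrow> real) \<Rightarrow> bool" where
  "L2_of_L1 M N u \<longleftrightarrow> (\<lambda>(x, t). u t x) \<in> borel_measurable (M \<Otimes>\<^sub>M N) \<and>
     (\<integral>\<^sup>+x. (\<integral>\<^sup>+t. ennreal \<bar>u t x\<bar> \<partial>N)\<^sup>2 \<partial>M) < \<infinity>"

text \<open>The interval has finite measure, so \<open>n t \<le> 1 + n t powr r\<close> lowers the
  exponent in time to 1; Minkowski's inequality then exchanges the two norms.\<close>

lemma bochner_imp_L2_of_L1:
  fixes S :: "'a::euclidean_space set"
  assumes S: "S \<in> sets borel" and r: "1 \<le> r" and u: "u \<in> bochner_L (ennreal r) T 2 S"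
  shows "L2_of_L1 (leb S) (leb {0<..<T}) u"
proof -
  let ?M = "leb S" and ?N = "leb {0<..<T}"
  interpret M: sigma_finite_measure ?M
    using S by (intro sigma_finite_measure_restrict_space sigma_finite_lborel) auto
  interpret N: finite_measure ?N
    by (rule finite_leb) auto
  interpret MN: pair_sigma_finite ?M ?N ..
  have um: "(\<lambda>(x, t). u t x) \<in> borel_measurable (?M \<Otimes>\<^sub>M ?N)"
    using u leb_Times[OF S, of "{0<..<T}"] by (simp add: bochner_def)
  then have [measurable]: "(\<lambda>z. u (snd z) (fst z)) \<in> borel_measurable (?M \<Otimes>\<^sub>M ?N)"
    by (simp add: case_prod_beta)
  \<comment> \<open>The L^2 norm of \<open>u t\<close>, written as an integral so that Tonelli gives
    measurability in t. It agrees with the norm used in \<open>bochner\<close> at almost every time,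
    namely where \<open>u t\<close> lies in L^2.\<close>
  define n where "n t = sqrt (enn2real (\<integral>\<^sup>+x. (ennreal \<bar>u t x\<bar>)\<^sup>2 \<partial>?M))" for t
  have "(\<lambda>(t,x). (ennreal \<bar>u t x\<bar>)\<^sup>2) \<in> borel_measurable (?N \<Otimes>\<^sub>M ?M)"
  proof -
    have "(\<lambda>z. u (snd (snd z, fst z)) (fst (snd z, fst z))) \<in> borel_measurable (?N \<Otimes>\<^sub>M ?M)"
      by (rule measurable_compose[where f="\<lambda>z. (snd z, fst z)" and g="\<lambda>z. u (snd z) (fst z)" and N="?M \<Otimes>\<^sub>M ?N"]) auto
    then have [measurable]: "(\<lambda>z. u (fst z) (snd z)) \<in> borel_measurable (?N \<Otimes>\<^sub>M ?M)" by simp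
    show ?thesis unfolding case_prod_beta by measurable
  qed
  then have "(\<lambda>t. \<integral>\<^sup>+x. (ennreal \<bar>u t x\<bar>)\<^sup>2 \<partial>?M) \<in> borel_measurable ?N"
    by (rule M.borel_measurable_nn_integral)
  then have nm[measurable]: "n \<in> borel_measurable ?N" unfolding n_def by measurable
  have n0: "0 \<le> n t" for t by (simp add: n_def)
  have ne: "n t = enn2real (Lnorm 2 ?M (u t)) \<and> (ennreal (n t))\<^sup>2 = (\<integral>\<^sup>+x. (ennreal \<bar>u t x\<bar>)\<^sup>2 \<partial>?M)"
    if "u t \<in> Lspace 2 ?M" for t
  proof -
    from that have "(\<integral>\<^sup>+x. (ennreal \<bar>u t x\<bar>)\<^sup>2 \<partial>?M) < \<infinity>" by (simp add: Lspace_2_iff)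
    then obtain q where q: "(\<integral>\<^sup>+x. (ennreal \<bar>u t x\<bar>)\<^sup>2 \<partial>?M) = ennreal q" "0 \<le> q"
      by (cases "\<integral>\<^sup>+x. (ennreal \<bar>u t x\<bar>)\<^sup>2 \<partial>?M") auto
    then have q2: "(\<integral>\<^sup>+x. ennreal (\<bar>u t x\<bar> powr 2) \<partial>?M) = ennreal q"
      by (simp add: ennreal_power)
    show ?thesis using q q2 by (simp add: n_def Lnorm_def Let_def ennreal_power powr_half_sqrt)
  qed
  have uL: "AE t in ?N. u t \<in> Lspace 2 ?M" using u by (simp add: bochner_def)
  have "(\<integral>\<^sup>+t. ennreal (n t) \<partial>?N) < \<infinity>"
  proof -
    have "Lnorm (ennreal r) ?N (\<lambda>t. enn2real (Lnorm 2 ?M (u t))) < \<infinity>"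
      using u by (simp add: bochner_def)
    then have "(\<integral>\<^sup>+t. ennreal (\<bar>enn2real (Lnorm 2 ?M (u t))\<bar> powr r) \<partial>?N) < \<infinity>"
      using r by (auto simp: Lnorm_def Let_def top.not_eq_extremum split: if_splits)
    also have "(\<integral>\<^sup>+t. ennreal (\<bar>enn2real (Lnorm 2 ?M (u t))\<bar> powr r) \<partial>?N) = (\<integral>\<^sup>+t. ennreal (n t powr r) \<partial>?N)"
      using uL by (intro nn_integral_cong_AE, eventually_elim) (simp add: ne[THEN conjunct1, symmetric] n0)
    finally have fin: "(\<integral>\<^sup>+t. ennreal (n t powr r) \<partial>?N) < \<infinity>" .
    have "(\<integral>\<^sup>+t. ennreal (n t) \<partial>?N) \<le> (\<integral>\<^sup>+t. 1 + ennreal (n t powr r) \<partial>?N)"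
    proof (intro nn_integral_mono)
      fix t
      have "n t \<le> 1 + n t powr r"
      proof (cases "n t \<le> 1")
        case False
        then have "n t powr 1 \<le> n t powr r" using r by (intro powr_mono) auto
        then show ?thesis using False by simp
      qed (simp add: add_increasing2)
      then have "ennreal (n t) \<le> ennreal (1 + n t powr r)" by (rule ennreal_leI)
      then show "ennreal (n t) \<le> 1 + ennreal (n t powr r)" using ennreal_plus[of 1 "n t powr r"] by simp
    qed
    also have "\<dots> = emeasure ?N (space ?N) + (\<integral>\<^sup>+t. ennreal (n t powr r) \<partial>?N)"
      by (subst nn_integral_add) auto
    also have "\<dots> < \<infinity>" using fin by (simp add: less_top[symmetric])
    finally show ?thesis .
  qed
  moreover have "(\<integral>\<^sup>+x. (\<integral>\<^sup>+t. ennreal \<bar>u t x\<bar> \<partial>?N)\<^sup>2 \<partial>?M) \<le> (\<integral>\<^sup>+t. ennreal (n t) \<partial>?N)\<^sup>2"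
  proof (rule minkowski_L2[OF M.sigma_finite_measure_axioms N.sigma_finite_measure_axioms um])
    show "AE t in ?N. (\<integral>\<^sup>+x. (ennreal \<bar>u t x\<bar>)\<^sup>2 \<partial>?M) \<le> (ennreal (n t))\<^sup>2"
      using uL by eventually_elim (metis ne order_refl)
  qed auto
  ultimately have "(\<integral>\<^sup>+x. (\<integral>\<^sup>+t. ennreal \<bar>u t x\<bar> \<partial>?N)\<^sup>2 \<partial>?M) < \<infinity>"
    by (simp add: power2_eq_square[of "\<integral>\<^sup>+t. ennreal (n t) \<partial>?N"] ennreal_mult_less_top le_less_trans)
  then show ?thesis using um by (simp add: L2_of_L1_def)
qed

lemma differentiable_dpartial_1:
  fixes f :: "real \<Rightarrow> real"
  assumes "(f has_real_derivative D) (at x)"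
  shows "dpartial 1 f x = D"
proof -
  from assms have "(f has_derivative (\<lambda>h. D * h)) (at x)" by (simp add: has_field_derivative_def)
  then have "(\<lambda>h. D * h) = frechet_derivative f (at x)" by (rule frechet_derivative_at)
  then show ?thesis unfolding dpartial_def by (metis mult_1_right)
qed

section \<open>Smooth bump functions and the fundamental lemma\<close>

text \<open>
  Rational functions times \<open>exp (- c / ((s - a) (b - s)))\<close>, extended by \<open>0\<close>, form a class closed
  under differentiation.
\<close>

definition bump :: "real poly \<Rightarrow> nat \<Rightarrow> real \<Rightarrow> real \<Rightarrow> real \<Rightarrow> real \<Rightarrow> real" where
  "bump q k c a b s =
    (if a < s \<and> s < b then poly q s / ((s - a) * (b - s)) ^ k * exp (- c / ((s - a) * (b - s))) else 0)"

text \<open>With w = (s - a)(b - s), the derivative of q / w^k exp(-c/w) is (q' w^2 - k q w' w + c q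
  w') / w^(k+2) exp(-c/w); this is its numerator.\<close>

definition bump_pderiv :: "real poly \<Rightarrow> nat \<Rightarrow> real \<Rightarrow> real \<Rightarrow> real \<Rightarrow> real poly" where
  "bump_pderiv q k c a b = (let w = [:-a, 1:] * [:b, -1:] in
     pderiv q * w\<^sup>2 - smult (real k) (q * pderiv w * w) + smult c (q * pderiv w))"

text \<open>Keep only the term of index k + 2 in the series of exp(c/w). The two powers beyond k
  give the quadratic decay that makes a bump differentiable, with derivative 0, at the end
  points.\<close>

lemma pow_exp_le:
  fixes w c :: real assumes "w > 0" "c > 0"
  shows "exp (- c / w) / w ^ k \<le> fact (k + 2) / c ^ (k + 2) * w\<^sup>2"
proof -
  have "(c / w) ^ (k + 2) /\<^sub>R fact (k + 2) \<le> exp (c / w)"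
  proof -
    have s: "(\<lambda>n. (c / w) ^ n /\<^sub>R fact n) sums exp (c / w)" by (rule exp_converges)
    have "sum (\<lambda>n. (c / w) ^ n /\<^sub>R fact n) {k+2} \<le> suminf (\<lambda>n. (c / w) ^ n /\<^sub>R fact n)"
      using assms s by (intro sum_le_suminf) (auto simp: sums_iff)
    then show ?thesis using s by (simp add: sums_iff)
  qed
  moreover have "X \<le> F * E" if "X /\<^sub>R F \<le> E" "F > 0" for X F E :: real using that by (simp add: field_simps)
  ultimately have "(c / w) ^ (k + 2) \<le> fact (k + 2) * exp (c / w)" by (metis fact_gt_zero)
  then have "c ^ (k + 2) \<le> fact (k + 2) * exp (c / w) * w ^ (k + 2)"
    using assms by (simp add: power_divide field_simps del: fact_Suc power_Suc)
  then have "c ^ (k + 2) * exp (- c / w) \<le> fact (k + 2) * w ^ (k + 2) * (exp (c / w) * exp (- c / w))"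
    using mult_right_mono[of _ _ "exp (- c / w)"] by (simp add: mult_ac del: fact_Suc power_Suc)
  also have "exp (c / w) * exp (- c / w) = 1" by (simp add: exp_minus)
  finally have "c ^ (k + 2) * exp (- c / w) \<le> fact (k + 2) * w ^ k * w\<^sup>2" by (simp add: power_add mult_ac power2_eq_square)
  then show ?thesis using assms by (simp add: field_simps del: fact_Suc power_Suc)
qed

lemma bump_deriv:
  assumes c: "c > 0"
  shows "(bump q k c a b has_real_derivative bump (bump_pderiv q k c a b) (k + 2) c a b s) (at s)"
proof (cases "a < s \<and> s < b")
  case True
  define W where "W s = (s - a) * (b - s)" for s
  have W: "W s > 0" using True by (simp add: W_def)
  have W': "(W has_real_derivative (b - s) - (s - a)) (at s)"
    unfolding W_def by (auto intro!: derivative_eq_intros)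
  have pW: "poly ([:-a, 1:] * [:b, -1:]) s = W s" "poly (pderiv ([:-a, 1:] * [:b, -1:])) s = (b - s) - (s - a)"
    by (auto simp: W_def algebra_simps pderiv_pCons)
  have "((\<lambda>s. poly q s / W s ^ k * exp (- c / W s)) has_real_derivative
     (poly (pderiv q) s * W s ^ k - poly q s * (real k * W s ^ (k - 1) * ((b - s) - (s - a)))) / (W s ^ k)\<^sup>2 * exp (- c / W s)
      + poly q s / W s ^ k * (exp (- c / W s) * (c * ((b - s) - (s - a)) / (W s)\<^sup>2))) (at s)"
    using W by (auto intro!: derivative_eq_intros W' simp: power2_eq_square field_simps)
  also have "(poly (pderiv q) s * W s ^ k - poly q s * (real k * W s ^ (k - 1) * ((b - s) - (s - a)))) / (W s ^ k)\<^sup>2 * exp (- c / W s)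
      + poly q s / W s ^ k * (exp (- c / W s) * (c * ((b - s) - (s - a)) / (W s)\<^sup>2))
    = poly (bump_pderiv q k c a b) s / W s ^ (k + 2) * exp (- c / W s)"
  proof -
    define v where "v = (b - s) - (s - a)"
    have "poly (bump_pderiv q k c a b) s
       = poly (pderiv q) s * (W s)\<^sup>2 - real k * (poly q s * v * W s) + c * (poly q s * v)"
      unfolding bump_pderiv_def Let_def poly_add poly_diff poly_smult poly_mult[of "_ * _"] poly_mult[of _ "_\<^sup>2"] poly_power
        poly_mult[of q] pW v_def by simp
    \<comment> \<open>The case k = 0 is separate because the exponent k - 1 is then cut off at
      0.\<close>
    moreover have "(real k * W s ^ (k - 1)) / (W s ^ k)\<^sup>2 = real k * W s / W s ^ (k + 2)"
      using W by (cases k) (auto simp: field_simps power2_eq_square)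
    moreover have "W s ^ k / (W s ^ k)\<^sup>2 = (W s)\<^sup>2 / W s ^ (k + 2)"
      using W by (auto simp: field_simps power2_eq_square)
    moreover have "c / (W s ^ k * (W s)\<^sup>2) = c / W s ^ (k + 2)"
      by (simp add: power_add power2_eq_square)
    ultimately show ?thesis
    proof -
      assume a: "poly (bump_pderiv q k c a b) s
          = poly (pderiv q) s * (W s)\<^sup>2 - real k * (poly q s * v * W s) + c * (poly q s * v)"
        and r1: "(real k * W s ^ (k - 1)) / (W s ^ k)\<^sup>2 = real k * W s / W s ^ (k + 2)"
        and r2: "W s ^ k / (W s ^ k)\<^sup>2 = (W s)\<^sup>2 / W s ^ (k + 2)"
      have "(poly (pderiv q) s * W s ^ k - poly q s * (real k * W s ^ (k - 1) * v)) / (W s ^ k)\<^sup>2 * exp (- c / W s)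
         + poly q s / W s ^ k * (exp (- c / W s) * (c * v / (W s)\<^sup>2))
        = (poly (pderiv q) s * (W s ^ k / (W s ^ k)\<^sup>2) - poly q s * v * ((real k * W s ^ (k - 1)) / (W s ^ k)\<^sup>2)
            + poly q s * v * (c / W s ^ (k + 2))) * exp (- c / W s)"
        by (simp add: diff_divide_distrib algebra_simps power_add power2_eq_square)
      also have "\<dots> = poly (bump_pderiv q k c a b) s / W s ^ (k + 2) * exp (- c / W s)"
        unfolding r1 r2 a by (simp add: diff_divide_distrib add_divide_distrib algebra_simps del: power_Suc)
      finally show ?thesis by (simp only: v_def)
    qed
  qed
  finally have d: "((\<lambda>s. poly q s / W s ^ k * exp (- c / W s)) has_real_derivative
      poly (bump_pderiv q k c a b) s / W s ^ (k + 2) * exp (- c / W s)) (at s)" .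
  have "bump (bump_pderiv q k c a b) (k + 2) c a b s = poly (bump_pderiv q k c a b) s / W s ^ (k + 2) * exp (- c / W s)"
    using True by (simp add: bump_def W_def)
  with d have d': "((\<lambda>s. poly q s / W s ^ k * exp (- c / W s)) has_real_derivative
      bump (bump_pderiv q k c a b) (k + 2) c a b s) (at s)" by (simp only:)
  show ?thesis
    by (rule has_field_derivative_transform_within_open[OF d', where S="{a<..<b}"])
       (use True in \<open>simp_all add: bump_def W_def\<close>)
next
  case False
  have "compact (poly q ` {a..b})" by (intro compact_continuous_image continuous_intros) auto
  then obtain B where B: "\<And>t. t \<in> {a..b} \<Longrightarrow> \<bar>poly q t\<bar> \<le> B"
    using compact_imp_bounded[of "poly q ` {a..b}"] unfolding bounded_iff by (metis imageI real_norm_def)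
  \<comment> \<open>For s outside (a, b), end points included, the value w at any t inside is at
    most (b - a) |t - s|. By \<open>pow_exp_le\<close> the function is then at most K (t - s)^2, so
    its difference quotient at s tends to 0.\<close>
  define K where "K = \<bar>B\<bar> * (fact (k + 2) / c ^ (k + 2)) * (b - a)\<^sup>2"
  have bd: "\<bar>bump q k c a b t\<bar> \<le> K * (t - s)\<^sup>2" for t
  proof (cases "a < t \<and> t < b")
    case t: True
    define w where "w = (t - a) * (b - t)"
    have w: "0 < w" using t by (simp add: w_def)
    have "w \<le> (b - a) * \<bar>t - s\<bar>"
    proof (cases "s \<le> a")
      case True
      then have "(b - t) * (t - a) \<le> (b - a) * \<bar>t - s\<bar>" using t by (intro mult_mono) auto
      then show ?thesis by (simp add: w_def mult_ac)
    next
      case F: False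
      then have "(t - a) * (b - t) \<le> (b - a) * \<bar>t - s\<bar>" using t False by (intro mult_mono) auto
      then show ?thesis by (simp add: w_def mult_ac)
    qed
    then have "w\<^sup>2 \<le> ((b - a) * \<bar>t - s\<bar>)\<^sup>2" using w by (intro power_mono) auto
    then have w2: "w\<^sup>2 \<le> (b - a)\<^sup>2 * (t - s)\<^sup>2" by (simp add: power_mult_distrib)
    have "\<bar>bump q k c a b t\<bar> = \<bar>poly q t\<bar> * (exp (- c / w) / w ^ k)"
      using t w by (simp add: bump_def w_def[symmetric] abs_mult)
    also have "\<dots> \<le> \<bar>B\<bar> * (fact (k + 2) / c ^ (k + 2) * w\<^sup>2)"
      using t B[of t] w c by (intro mult_mono pow_exp_le) auto
    also have "\<dots> \<le> \<bar>B\<bar> * (fact (k + 2) / c ^ (k + 2) * ((b - a)\<^sup>2 * (t - s)\<^sup>2))"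
      using w2 c by (intro mult_left_mono) auto
    finally show ?thesis by (simp add: K_def mult_ac)
  qed (use c in \<open>auto simp: bump_def K_def\<close>)
  have b0: "bump q' k' c a b s = 0" for q' k' using False by (auto simp: bump_def)
  have "((\<lambda>t. (bump q k c a b t - bump q k c a b s) / (t - s)) \<longlongrightarrow> 0) (at s)"
  proof (rule Lim_null_comparison)
    show "\<forall>\<^sub>F t in at s. norm ((bump q k c a b t - bump q k c a b s) / (t - s)) \<le> K * \<bar>t - s\<bar>"
      unfolding eventually_at_filter
    proof (intro always_eventually allI impI)
      fix t assume "t \<noteq> s"
      then show "norm ((bump q k c a b t - bump q k c a b s) / (t - s)) \<le> K * \<bar>t - s\<bar>"
        using bd[of t] by (simp add: b0 divide_simps power2_eq_square mult.assoc abs_mult_self_eq)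
    qed
    show "((\<lambda>t. K * \<bar>t - s\<bar>) \<longlongrightarrow> 0) (at s)" by (auto intro!: tendsto_eq_intros)
  qed
  then show ?thesis by (simp add: has_field_derivative_iff b0)
qed

lemma prod_coords_derivative:
  fixes g :: "'a::euclidean_space \<Rightarrow> real \<Rightarrow> real"
  assumes g: "\<And>j s. j \<in> Basis \<Longrightarrow> (g j has_real_derivative g' j s) (at s)"
  shows "(\<lambda>x. \<Prod>j\<in>Basis. g j (x \<bullet> j)) differentiable (at x)"
    and "i \<in> Basis \<Longrightarrow> dpartial i (\<lambda>x. \<Prod>j\<in>Basis. g j (x \<bullet> j)) x = (\<Prod>j\<in>Basis. (if j = i then g' else g) j (x \<bullet> j))"
proof -
  have "((\<lambda>x. g j (x \<bullet> j)) has_derivative (\<lambda>h. g' j (x \<bullet> j) * (h \<bullet> j))) (at x)" if "j \<in> Basis" for j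
  proof -
    have "((\<lambda>x. x \<bullet> j) has_derivative (\<lambda>h. h \<bullet> j)) (at x)" by (auto intro!: derivative_eq_intros)
    from has_derivative_compose[OF this g[OF that, unfolded has_field_derivative_def]]
    show ?thesis by (simp add: mult.commute)
  qed
  then have d: "((\<lambda>x. \<Prod>j\<in>Basis. g j (x \<bullet> j)) has_derivative
     (\<lambda>h. \<Sum>i\<in>Basis. g' i (x \<bullet> i) * (h \<bullet> i) * (\<Prod>j\<in>Basis - {i}. g j (x \<bullet> j)))) (at x)"
    by (intro has_derivative_prod) auto
  then show "(\<lambda>x. \<Prod>j\<in>Basis. g j (x \<bullet> j)) differentiable (at x)" by (auto simp: differentiable_def)
  assume i: "i \<in> Basis"
  have "dpartial i (\<lambda>x. \<Prod>j\<in>Basis. g j (x \<bullet> j)) x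
     = (\<Sum>l\<in>Basis. g' l (x \<bullet> l) * (i \<bullet> l) * (\<Prod>j\<in>Basis - {l}. g j (x \<bullet> j)))"
    unfolding dpartial_def frechet_derivative_at[OF d, symmetric] ..
  also have "\<dots> = (\<Sum>l\<in>Basis. if l = i then g' i (x \<bullet> i) * (\<Prod>j\<in>Basis - {i}. g j (x \<bullet> j)) else 0)"
    using i by (intro sum.cong) (auto simp: inner_Basis)
  also have "\<dots> = g' i (x \<bullet> i) * (\<Prod>j\<in>Basis - {i}. g j (x \<bullet> j))" using i by simp
  also have "(\<Prod>j\<in>Basis - {i}. g j (x \<bullet> j)) = (\<Prod>j\<in>Basis - {i}. (if j = i then g' else g) j (x \<bullet> j))"
    by (intro prod.cong) auto
  also have "g' i (x \<bullet> i) * \<dots> = (\<Prod>j\<in>Basis. (if j = i then g' else g) j (x \<bullet> j))"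
    using i by (subst prod.remove[of Basis i]) auto
  finally show "dpartial i (\<lambda>x. \<Prod>j\<in>Basis. g j (x \<bullet> j)) x = (\<Prod>j\<in>Basis. (if j = i then g' else g) j (x \<bullet> j))" .
qed

text \<open>As c = 1 / (n + 1) tends to 0, the exponential tends to 1 inside the box: a smooth
  approximation of the indicator of the open box with values in [0, 1], made for dominated
  convergence.\<close>

definition box_bump :: "'a::euclidean_space \<Rightarrow> 'a \<Rightarrow> nat \<Rightarrow> 'a \<Rightarrow> real" where
  "box_bump a b n x = (\<Prod>j\<in>Basis. bump 1 0 (1 / Suc n) (a \<bullet> j) (b \<bullet> j) (x \<bullet> j))"

lemma smooth_box_bump: "smooth_on UNIV (box_bump a b n)"
proof -
  \<comment> \<open>A partial derivative changes the factor of one coordinate only, so every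
    iterated one is again a product of bumps, with polynomial and exponent depending on the
    coordinate.\<close>
  have ex: "\<exists>q k. foldr dpartial is (box_bump a b n)
      = (\<lambda>x. \<Prod>j\<in>Basis. bump (q j) (k j) (1 / Suc n) (a \<bullet> j) (b \<bullet> j) (x \<bullet> j))"
    if "is \<in> lists Basis" for "is"
    using that
  proof (induction "is")
    case Nil
    show ?case by (rule exI[of _ "\<lambda>_. 1"], rule exI[of _ "\<lambda>_. 0"]) (simp add: box_bump_def[abs_def])
  next
    case (Cons i "is")
    then obtain q k where qk: "foldr dpartial is (box_bump a b n)
      = (\<lambda>x. \<Prod>j\<in>Basis. bump (q j) (k j) (1 / Suc n) (a \<bullet> j) (b \<bullet> j) (x \<bullet> j))" by auto
    let ?q = "\<lambda>j. if j = i then bump_pderiv (q j) (k j) (1 / Suc n) (a \<bullet> j) (b \<bullet> j) else q j"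
    let ?k = "\<lambda>j. if j = i then k j + 2 else k j"
    have "foldr dpartial (i # is) (box_bump a b n) x
       = (\<Prod>j\<in>Basis. bump (?q j) (?k j) (1 / Suc n) (a \<bullet> j) (b \<bullet> j) (x \<bullet> j))" for x
      unfolding foldr.simps o_apply qk
      using Cons.hyps
      by (subst prod_coords_derivative(2)[where g'="\<lambda>j. bump (bump_pderiv (q j) (k j) (1 / Suc n) (a \<bullet> j) (b \<bullet> j)) (k j + 2) (1 / Suc n) (a \<bullet> j) (b \<bullet> j)"])
         (auto intro!: bump_deriv[unfolded add_2_eq_Suc'] prod.cong simp del: of_nat_Suc)
    then show ?case by (intro exI[of _ ?q] exI[of _ ?k] ext)
  qed
  show ?thesis unfolding smooth_on_def
  proof (intro ballI)
    fix "is" :: "'a list" and x :: 'a assume "is \<in> lists Basis"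
    from ex[OF this] obtain q k where qk: "foldr dpartial is (box_bump a b n)
      = (\<lambda>x. \<Prod>j\<in>Basis. bump (q j) (k j) (1 / Suc n) (a \<bullet> j) (b \<bullet> j) (x \<bullet> j))" by auto
    show "foldr dpartial is (box_bump a b n) differentiable at x"
      unfolding qk by (rule prod_coords_derivative(1)) (rule bump_deriv, simp)
  qed
qed

lemma box_bump_outside: "x \<notin> box a b \<Longrightarrow> box_bump a b n x = 0"
  by (auto simp: box_bump_def bump_def mem_box)

lemma box_bump_test_functions: "cbox a b \<subseteq> S \<Longrightarrow> box_bump a b n \<in> test_functions S"
  using smooth_box_bump[of a b n] box_bump_outside[of _ a b n] box_subset_cbox[of a b]
  by (auto simp: test_functions_def intro!: exI[of _ "cbox a b"])

lemma box_bump_bounds: "0 \<le> box_bump a b n x" "box_bump a b n x \<le> 1"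
proof -
  have "0 \<le> bump 1 0 (1 / Suc n) a b s \<and> bump 1 0 (1 / Suc n) a b s \<le> 1" for a b s :: real
    by (auto simp: bump_def intro!: divide_nonneg_pos mult_pos_pos simp del: of_nat_Suc)
  then show "0 \<le> box_bump a b n x" "box_bump a b n x \<le> 1"
    unfolding box_bump_def by (auto intro!: prod_nonneg prod_le_1)
qed

lemma box_bump_limit: "(\<lambda>n. box_bump a b n x) \<longlonglongrightarrow> indicator (box a b) x"
proof (cases "x \<in> box a b")
  case True
  have "(\<lambda>n. \<Prod>j\<in>Basis. bump 1 0 (1 / Suc n) (a \<bullet> j) (b \<bullet> j) (x \<bullet> j)) \<longlonglongrightarrow> (\<Prod>j\<in>(Basis::'a set). 1)"
  proof (intro tendsto_prod)
    fix j :: 'a assume j: "j \<in> Basis"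
    define w where "w = (x \<bullet> j - a \<bullet> j) * (b \<bullet> j - x \<bullet> j)"
    have "(\<lambda>n. exp (- (1 / real (Suc n)) / w)) \<longlonglongrightarrow> exp (- 0 / w)"
      unfolding divide_inverse[of _ w]
      by (intro tendsto_exp tendsto_mult tendsto_minus tendsto_const LIMSEQ_Suc[OF lim_1_over_n])
    then show "(\<lambda>n. bump 1 0 (1 / Suc n) (a \<bullet> j) (b \<bullet> j) (x \<bullet> j)) \<longlonglongrightarrow> 1"
      using True j by (simp add: bump_def mem_box w_def)
  qed
  then show ?thesis using True by (simp add: box_bump_def)
qed (simp add: box_bump_outside)

section \<open>Functions whose integrals over boxes vanish\<close>

text \<open>Open boxes generate the Borel sets and are stable under intersection, so the vanishing
  passes to all Borel sets by a Dynkin argument. Its complement step needs the integral over the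
  whole space, which is the limit over growing boxes.\<close>

lemma AE_zero_if_box_integrals_zero:
  fixes g :: "'a::euclidean_space \<Rightarrow> real"
  assumes g: "integrable lborel g" and z: "\<And>a b. set_lebesgue_integral lborel (box a b) g = 0"
  shows "AE x in lborel. g x = 0"
proof (rule sigma_finite_measure.density_zero[OF sigma_finite_lborel g])
  have si: "set_integrable lborel A g" if "A \<in> sets borel" for A
    unfolding set_integrable_def using g that by (intro integrable_mult_indicator) simp_all
  have all: "integral\<^sup>L lborel g = 0"
  proof -
    have "(\<lambda>n. set_lebesgue_integral lborel (box (- real n *\<^sub>R One) (real n *\<^sub>R One)) g) \<longlonglongrightarrow> integral\<^sup>L lborel g"
      unfolding set_lebesgue_integral_def
    proof (rule integral_dominated_convergence[where w="\<lambda>x. \<bar>g x\<bar>"])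
      show "AE x in lborel. (\<lambda>n. indicat_real (box (- real n *\<^sub>R One) (real n *\<^sub>R One)) x *\<^sub>R g x) \<longlonglongrightarrow> g x"
      proof (intro AE_I2)
        fix x :: 'a
        from UN_box_eq_UNIV obtain m where m: "x \<in> box (- (real m *\<^sub>R One)) (real m *\<^sub>R One)" by blast
        have "\<forall>\<^sub>F n in sequentially. indicat_real (box (- real n *\<^sub>R One) (real n *\<^sub>R One)) x *\<^sub>R g x = g x"
          using eventually_ge_at_top[of m]
        proof eventually_elim
          case (elim n)
          then have "x \<in> box (- real n *\<^sub>R One) (real n *\<^sub>R One)"
            using m by (force simp: mem_box)
          then show ?case by simp
        qed
        then show "(\<lambda>n. indicat_real (box (- real n *\<^sub>R One) (real n *\<^sub>R One)) x *\<^sub>R g x) \<longlonglongrightarrow> g x"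
          by (rule tendsto_eventually)
      qed
    qed (use g in \<open>auto simp: indicator_def\<close>)
    then show ?thesis by (simp add: z LIMSEQ_const_iff)
  qed
  fix A assume "A \<in> sets (lborel :: 'a measure)"
  then have "A \<in> sigma_sets UNIV (range (\<lambda>(a, b). box a b :: 'a set))" by (simp add: borel_eq_box)
  moreover have "range (\<lambda>(a, b). box a b :: 'a set) \<subseteq> Pow UNIV" by simp
  moreover have "Int_stable (range (\<lambda>(a, b). box a b :: 'a set))"
    by (auto simp: Int_stable_def box_Int_box)
  ultimately have "Int_stable (range (\<lambda>(a, b). box a b :: 'a set))" "range (\<lambda>(a, b). box a b :: 'a set) \<subseteq> Pow UNIV"
    "A \<in> sigma_sets UNIV (range (\<lambda>(a, b). box a b :: 'a set))" by auto
  then show "set_lebesgue_integral lborel A g = 0"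
  proof (induction rule: sigma_sets_induct_disjoint)
    case (compl A)
    then have A: "A \<in> sets borel" by (simp add: borel_eq_box)
    have "set_lebesgue_integral lborel UNIV g = set_lebesgue_integral lborel A g + set_lebesgue_integral lborel (UNIV - A) g"
      using A si by (subst set_integral_Un[symmetric]) auto
    then show ?case using compl all by (simp add: set_lebesgue_integral_def)
  next
    case (union A)
    then have A: "A i \<in> sets borel" for i by (auto simp: borel_eq_box)
    have "set_lebesgue_integral lborel (\<Union>i. A i) g = (\<Sum>i. set_lebesgue_integral lborel (A i) g)"
      using union A by (intro lebesgue_integral_countable_add si) (auto simp: disjoint_family_on_def)
    then show ?case using union by simp
  qed (use z in \<open>auto simp: set_lebesgue_integral_def\<close>)
qed

text \<open>An open set is a countable union of closed boxes, and on each of them the previous lemma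
  applies to \<open>g\<close> cut off to the box: a closed and an open box meet in an open box up to
  the null boundary, and its closed hull may be taken inside \<open>S\<close>.\<close>

lemma AE_zero_if_inner_box_integrals_zero:
  fixes g :: "'a::euclidean_space \<Rightarrow> real"
  assumes S: "open S" and g: "loc_integrable S g"
    and z: "\<And>a b. cbox a b \<subseteq> S \<Longrightarrow> set_lebesgue_integral lborel (box a b) g = 0"
  shows "AE x in leb S. g x = 0"
proof -
  obtain D where D: "countable D" "D \<subseteq> Pow S" "\<And>X. X \<in> D \<Longrightarrow> \<exists>a b. X = cbox a b" "\<Union>D = S"
    using open_countable_Union_open_cbox[OF S] by metis
  have "AE x in lborel. x \<in> X \<longrightarrow> g x = 0" if X: "X \<in> D" for X
  proof -
    from D(3)[OF X] obtain a b where ab: "X = cbox a b" by auto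
    have sub: "cbox a b \<subseteq> S" using ab X D(2) by auto
    have gi: "integrable lborel (\<lambda>x. indicator (cbox a b) x *\<^sub>R g x)"
      using g sub by (auto simp: loc_integrable_def set_integrable_def)
    have "AE x in lborel. indicator (cbox a b) x *\<^sub>R g x = 0"
    proof (rule AE_zero_if_box_integrals_zero[OF gi])
      fix c d
      obtain a' b' where ab': "box a b \<inter> box c d = box a' b'" "cbox a b \<inter> cbox c d = cbox a' b'"
        using box_Int_box[of a b c d] Int_interval[of a b c d] by metis
      have "set_lebesgue_integral lborel (box c d) (\<lambda>x. indicator (cbox a b) x *\<^sub>R g x)
        = set_lebesgue_integral lborel (box a' b') g"
        unfolding set_lebesgue_integral_def
      proof (rule integral_cong_AE)
        show "AE x in lborel. indicat_real (box c d) x *\<^sub>R indicat_real (cbox a b) x *\<^sub>R g x = indicat_real (box a' b') x *\<^sub>R g x"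
        proof (rule AE_mp[OF AE_not_in[of "cbox a b - box a b"]])
          show "cbox a b - box a b \<in> null_sets lborel" by (rule null_sets_cbox_Diff_box)
          show "AE x in lborel. x \<notin> cbox a b - box a b \<longrightarrow> indicat_real (box c d) x *\<^sub>R indicat_real (cbox a b) x *\<^sub>R g x = indicat_real (box a' b') x *\<^sub>R g x"
            unfolding ab'(1)[symmetric] using box_subset_cbox[of a b] by (auto simp: indicator_def)
        qed
        show "(\<lambda>x. indicat_real (box c d) x *\<^sub>R indicat_real (cbox a b) x *\<^sub>R g x) \<in> borel_measurable lborel"
          by (intro borel_measurable_scaleR[OF _ borel_measurable_integrable[OF gi]]) simp
        have "(\<lambda>x. indicat_real (box a' b') x *\<^sub>R indicat_real (cbox a b) x *\<^sub>R g x) \<in> borel_measurable lborel"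
          by (intro borel_measurable_scaleR[OF _ borel_measurable_integrable[OF gi]]) simp
        also have "(\<lambda>x. indicat_real (box a' b') x *\<^sub>R indicat_real (cbox a b) x *\<^sub>R g x) = (\<lambda>x. indicat_real (box a' b') x *\<^sub>R g x)"
          using ab' box_subset_cbox[of a b] by (auto simp: indicator_def fun_eq_iff)
        finally show "(\<lambda>x. indicat_real (box a' b') x *\<^sub>R g x) \<in> borel_measurable lborel" .
      qed
      also have "\<dots> = 0" using ab' sub by (intro z) auto
      finally show "set_lebesgue_integral lborel (box c d) (\<lambda>x. indicator (cbox a b) x *\<^sub>R g x) = 0" .
    qed
    then show ?thesis unfolding ab by eventually_elim auto
  qed
  then have "AE x in lborel. \<forall>X\<in>D. x \<in> X \<longrightarrow> g x = 0" unfolding AE_ball_countable[OF D(1)] by blast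
  then have "AE x in lborel. x \<in> S \<longrightarrow> g x = 0" by eventually_elim (use D(4) in auto)
  then show ?thesis using S by (simp add: AE_restrict_space_iff)
qed

text \<open>\<open>g\<close> is measurable only relative to \<open>S\<close> and integrable only on
  compact subsets. An integral against a function supported in \<open>K\<close> is therefore carried
  to \<open>lborel\<close> through the indicator of \<open>K\<close>.\<close>

lemma loc_integrable_mult_bounded:
  fixes g :: "'a::euclidean_space \<Rightarrow> real"
  assumes S: "open S" and g: "loc_integrable S g" and K: "compact K" "K \<subseteq> S"
    and h: "h \<in> borel_measurable borel" "\<And>x. x \<notin> K \<Longrightarrow> h x = 0" "\<And>x. \<bar>h x\<bar> \<le> B"
  shows "integrable (leb S) (\<lambda>x. g x * h x)" "integrable lborel (\<lambda>x. indicator K x * (g x * h x))"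
    "(LINT x|leb S. g x * h x) = (LINT x|lborel. indicator K x * (g x * h x))"
proof -
  have gK: "integrable lborel (\<lambda>x. indicator K x *\<^sub>R g x)"
    using g K by (auto simp: loc_integrable_def set_integrable_def)
  have "integrable lborel (\<lambda>x. (indicator K x *\<^sub>R g x) * h x)"
  proof (rule Bochner_Integration.integrable_bound[where f="\<lambda>x. B * (indicator K x *\<^sub>R g x)"])
    show "AE x in lborel. norm ((indicator K x *\<^sub>R g x) * h x) \<le> norm (B * (indicator K x *\<^sub>R g x))"
    proof (intro AE_I2)
      fix x
      have "\<bar>h x\<bar> \<le> \<bar>B\<bar>" using h(3)[of x] by linarith
      then have "\<bar>g x\<bar> * \<bar>h x\<bar> \<le> \<bar>B\<bar> * \<bar>g x\<bar>" by (metis abs_ge_zero mult.commute mult_left_mono)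
      then show "norm ((indicator K x *\<^sub>R g x) * h x) \<le> norm (B * (indicator K x *\<^sub>R g x))"
        by (auto simp: indicator_def abs_mult)
    qed
  qed (use gK h in auto)
  then show i: "integrable lborel (\<lambda>x. indicator K x * (g x * h x))" by (simp add: mult.assoc)
  have eq: "indicator S x *\<^sub>R (g x * h x) = indicator K x * (g x * h x)" for x
    using h(2)[of x] K by (auto simp: indicator_def)
  show "integrable (leb S) (\<lambda>x. g x * h x)"
    using i S by (subst integrable_restrict_space) (simp_all only: eq, simp)
  show "(LINT x|leb S. g x * h x) = (LINT x|lborel. indicator K x * (g x * h x))"
    using S by (subst integral_restrict_space) (simp_all only: eq, simp)
qed

lemma box_bump_measurable: "box_bump a b n \<in> borel_measurable borel"
proof -
  have "box_bump a b n differentiable (at x)" for x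
    using smooth_box_bump[of a b n] unfolding smooth_on_def by (metis UNIV_I foldr.simps(1) id_apply lists.Nil)
  then have "continuous_on UNIV (box_bump a b n)"
    by (simp add: continuous_at_imp_continuous_on differentiable_imp_continuous_within)
  then show ?thesis by (rule borel_measurable_continuous_onI)
qed

lemma box_integral_limit:
  fixes g :: "'a::euclidean_space \<Rightarrow> real"
  assumes S: "open S" and g: "loc_integrable S g" and ab: "cbox a b \<subseteq> S"
  shows "(\<lambda>n. LINT x|leb S. g x * box_bump a b n x) \<longlonglongrightarrow> set_lebesgue_integral lborel (box a b) g"
proof -
  have gK: "integrable lborel (\<lambda>x. indicator (cbox a b) x *\<^sub>R g x)"
    using g ab by (auto simp: loc_integrable_def set_integrable_def)
  have eq: "(LINT x|leb S. g x * box_bump a b n x) = (LINT x|lborel. indicator (cbox a b) x * (g x * box_bump a b n x))" for n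
  proof (rule loc_integrable_mult_bounded(3)[OF S g compact_cbox ab, where B=1])
    show "\<bar>box_bump a b n x\<bar> \<le> 1" for x using box_bump_bounds[of a b n x] by simp
  qed (use box_bump_outside[of _ a b n] box_subset_cbox[of a b] box_bump_measurable in auto)
  have fs: "indicator (box a b) x *\<^sub>R g x = indicator (box a b) x *\<^sub>R (indicator (cbox a b) x *\<^sub>R g x)" for x
    using box_subset_cbox[of a b] by (auto simp: indicator_def)
  have "(\<lambda>n. LINT x|lborel. indicator (cbox a b) x * (g x * box_bump a b n x)) \<longlonglongrightarrow> (LINT x|lborel. indicator (box a b) x *\<^sub>R g x)"
  proof (rule integral_dominated_convergence[where w="\<lambda>x. \<bar>indicator (cbox a b) x *\<^sub>R g x\<bar>"])
    show "(\<lambda>x. indicator (box a b) x *\<^sub>R g x) \<in> borel_measurable lborel"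
      unfolding fs by (rule borel_measurable_scaleR[OF _ borel_measurable_integrable[OF gK]]) simp
    show "(\<lambda>x. indicator (cbox a b) x * (g x * box_bump a b n x)) \<in> borel_measurable lborel" for n
    proof -
      have "(\<lambda>x. (indicator (cbox a b) x *\<^sub>R g x) * box_bump a b n x) \<in> borel_measurable lborel"
        using box_bump_measurable[of a b n] by (intro borel_measurable_times[OF borel_measurable_integrable[OF gK]]) simp
      then show ?thesis by (simp add: mult.assoc)
    qed
    show "AE x in lborel. (\<lambda>n. indicator (cbox a b) x * (g x * box_bump a b n x)) \<longlonglongrightarrow> indicator (box a b) x *\<^sub>R g x"
    proof (intro AE_I2)
      fix x
      have "(\<lambda>n. indicator (cbox a b) x * (g x * box_bump a b n x)) \<longlonglongrightarrow> indicator (cbox a b) x * (g x * indicator (box a b) x)"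
        by (intro tendsto_mult tendsto_const box_bump_limit)
      also have "indicator (cbox a b) x * (g x * indicator (box a b) x) = indicator (box a b) x *\<^sub>R g x"
        using box_subset_cbox[of a b] by (auto simp: indicator_def)
      finally show "(\<lambda>n. indicator (cbox a b) x * (g x * box_bump a b n x)) \<longlonglongrightarrow> indicator (box a b) x *\<^sub>R g x" .
    qed
    show "AE x in lborel. norm (indicator (cbox a b) x * (g x * box_bump a b n x)) \<le> \<bar>indicator (cbox a b) x *\<^sub>R g x\<bar>" for n
    proof (intro AE_I2)
      fix x
      have "\<bar>g x\<bar> * \<bar>box_bump a b n x\<bar> \<le> \<bar>g x\<bar>" using box_bump_bounds[of a b n x] by (intro mult_left_le) auto
      then show "norm (indicator (cbox a b) x * (g x * box_bump a b n x)) \<le> \<bar>indicator (cbox a b) x *\<^sub>R g x\<bar>"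
        by (auto simp: indicator_def abs_mult)
    qed
  qed (use gK in auto)
  then show ?thesis by (simp add: eq set_lebesgue_integral_def)
qed

text \<open>Bumps on a box inside \<open>S\<close> converge to its indicator, so testing against
  them recovers the integrals of \<open>g\<close> over boxes.\<close>

lemma fundamental_lemma:
  fixes g :: "'a::euclidean_space \<Rightarrow> real"
  assumes S: "open S" and g: "loc_integrable S g"
    and z: "\<And>\<eta>. \<eta> \<in> test_functions S \<Longrightarrow> (LINT x|leb S. g x * \<eta> x) = 0"
  shows "AE x in leb S. g x = 0"
proof (rule AE_zero_if_inner_box_integrals_zero[OF S g])
  fix a b :: 'a assume ab: "cbox a b \<subseteq> S"
  show "set_lebesgue_integral lborel (box a b) g = 0"
    using box_integral_limit[OF S g ab] z[OF box_bump_test_functions[OF ab]]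
    by (simp add: LIMSEQ_const_iff)
qed

section \<open>Weak derivatives and Green's identity\<close>

lemma dpartial_zero_outside:
  assumes "compact K" "\<And>x. x \<notin> K \<Longrightarrow> f x = 0" "x \<notin> K"
  shows "dpartial i f x = 0"
proof -
  have "open (- K)" using assms(1) by (simp add: compact_imp_closed open_Compl)
  then have "(f has_derivative (\<lambda>_. 0)) (at x)"
  proof (rule has_derivative_transform_within_open[OF has_derivative_const])
    show "x \<in> - K" using assms(3) by simp
    show "0 = f y" if "y \<in> - K" for y using assms(2)[of y] that by simp
  qed
  from frechet_derivative_at[OF this] show ?thesis by (simp add: dpartial_def fun_eq_iff)
qed

lemma dpartial_has_derivative:
  assumes "(f has_derivative f') (at x)" shows "dpartial i f x = f' i"
  using frechet_derivative_at[OF assms] by (simp add: dpartial_def)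

lemma test_function_differentiable: "\<eta> \<in> test_functions S \<Longrightarrow> \<eta> differentiable (at x)"
  unfolding test_functions_def smooth_on_def by (metis (mono_tags, lifting) UNIV_I foldr.simps(1) id_apply lists.Nil mem_Collect_eq)

lemma test_function_continuous: "\<eta> \<in> test_functions S \<Longrightarrow> continuous_on UNIV \<eta>"
  by (simp add: continuous_at_imp_continuous_on differentiable_imp_continuous_within test_function_differentiable)

lemma test_function_measurable: "\<eta> \<in> test_functions S \<Longrightarrow> \<eta> \<in> borel_measurable borel"
  by (intro borel_measurable_continuous_onI test_function_continuous)

lemma test_function_bounded:
  assumes "\<eta> \<in> test_functions S"
  obtains B where "B \<ge> 0" "\<And>x. \<bar>\<eta> x\<bar> \<le> B"
proof -
  obtain K where K: "compact K" "\<And>x. x \<notin> K \<Longrightarrow> \<eta> x = 0" using assms unfolding test_functions_def by blast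
  have "compact (\<eta> ` K)"
    using K test_function_continuous[OF assms] by (intro compact_continuous_image) (auto intro: continuous_on_subset)
  then obtain B where "\<And>x. x \<in> K \<Longrightarrow> \<bar>\<eta> x\<bar> \<le> B"
    using compact_imp_bounded[of "\<eta> ` K"] unfolding bounded_iff by (metis imageI real_norm_def)
  then have "\<bar>\<eta> x\<bar> \<le> max B 0" for x using K(2)[of x] by (cases "x \<in> K") (auto simp: max.coboundedI1)
  then show ?thesis by (intro that[of "max B 0"]) auto
qed

lemma dpartial_test_function:
  assumes "\<eta> \<in> test_functions S" "i \<in> Basis" shows "dpartial i \<eta> \<in> test_functions S"
proof -
  obtain K where K: "compact K" "K \<subseteq> S" "\<And>x. x \<notin> K \<Longrightarrow> \<eta> x = 0" and sm: "smooth_on UNIV \<eta>"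
    using assms unfolding test_functions_def by blast
  have "smooth_on UNIV (dpartial i \<eta>)"
    unfolding smooth_on_def
  proof (intro ballI)
    fix "is" :: "'a list" and x assume "is \<in> lists Basis"
    then have "is @ [i] \<in> lists Basis" using assms by auto
    then have "foldr dpartial (is @ [i]) \<eta> differentiable at x" using sm unfolding smooth_on_def by blast
    then show "foldr dpartial is (dpartial i \<eta>) differentiable at x" by simp
  qed
  then show ?thesis unfolding test_functions_def
    by (intro CollectI conjI exI[of _ K] allI impI K(1,2) dpartial_zero_outside[OF K(1,3)])
qed

lemma test_function_loc_integrable:
  assumes "open S" "\<eta> \<in> test_functions S" shows "loc_integrable S \<eta>"
  unfolding loc_integrable_def
proof (intro conjI allI impI)
  show "\<eta> \<in> borel_measurable (leb S)"
    using test_function_measurable[OF assms(2)] by (intro measurable_restrict_space1) simp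
  fix K assume "compact K \<and> K \<subseteq> S"
  then show "set_integrable lborel K \<eta>"
    using test_function_continuous[OF assms(2)]
    unfolding set_integrable_def by (intro borel_integrable_compact) (auto intro: continuous_on_subset)
qed

section \<open>Integration by parts and uniqueness of weak derivatives\<close>

text \<open>Translation invariance gives every difference quotient of \<open>h\<close> in direction
  \<open>i\<close> the integral 0. The quotients converge to the derivative and are bounded by
  \<open>B\<close> through the mean value theorem, so dominated convergence replaces integration
  along lines.\<close>

lemma integral_dpartial_zero:
  fixes h :: "'a::euclidean_space \<Rightarrow> real"
  assumes i: "i \<in> Basis" and d: "\<And>x. h differentiable (at x)" and K: "compact K" "\<And>x. x \<notin> K \<Longrightarrow> h x = 0"
    and dm: "dpartial i h \<in> borel_measurable borel" and B: "\<And>x. \<bar>dpartial i h x\<bar> \<le> B"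
  shows "(LINT x|lborel. dpartial i h x) = 0"
proof -
  have hc: "continuous_on UNIV h"
    using d by (simp add: continuous_at_imp_continuous_on differentiable_imp_continuous_within)
  then have hm[measurable]: "h \<in> borel_measurable borel" by (rule borel_measurable_continuous_onI)
  have hder: "((\<lambda>s. h (x + s *\<^sub>R i)) has_real_derivative dpartial i h (x + s *\<^sub>R i)) (at s)" for x s
  proof -
    obtain D where D: "(h has_derivative D) (at (x + s *\<^sub>R i))" using d differentiable_def by blast
    have "((\<lambda>s. h (x + s *\<^sub>R i)) has_derivative (\<lambda>t. D (t *\<^sub>R i))) (at s)"
      by (rule has_derivative_compose[where g=h and f="\<lambda>s. x + s *\<^sub>R i", OF _ D]) (auto intro!: derivative_eq_intros)
    moreover have "D (t *\<^sub>R i) = D i * t" for t using has_derivative_linear[OF D] by (simp add: linear_cmul)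
    ultimately show ?thesis using dpartial_has_derivative[OF D, of i] by (simp add: has_field_derivative_def)
  qed
  define q where "q n x = (h (x + (1 / Suc n) *\<^sub>R i) - h x) * Suc n" for n x
  obtain R where R: "\<And>x. x \<in> K \<Longrightarrow> norm x \<le> R" using compact_imp_bounded[OF K(1)] unfolding bounded_iff by blast
  have hint: "integrable lborel h"
  proof -
    have "set_integrable lborel K h" unfolding set_integrable_def using K hc by (intro borel_integrable_compact) (auto intro: continuous_on_subset)
    moreover have "(\<lambda>x. indicator K x *\<^sub>R h x) = h" using K(2) by (auto simp: indicator_def fun_eq_iff)
    ultimately show ?thesis by (simp add: set_integrable_def)
  qed
  have tr: "integrable lborel (\<lambda>x. h (x + v)) \<and> (LINT x|lborel. h (x + v)) = (LINT x|lborel. h x)" for v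
  proof -
    have e: "lborel = distr lborel borel (\<lambda>x. x + v)" using lborel_distr_plus[of v] unfolding add.commute[of v] by (rule sym)
    have "(LINT x|lborel. h x) = (LINT x|distr lborel borel (\<lambda>x. x + v). h x)" using e by simp
    also have "\<dots> = (LINT x|lborel. h (x + v))" by (rule integral_distr) auto
    finally have 1: "(LINT x|lborel. h (x + v)) = (LINT x|lborel. h x)" by simp
    have "integrable (distr lborel borel (\<lambda>x. x + v)) h" using e hint by simp
    then have "integrable lborel (\<lambda>x. h (x + v))" by (rule integrable_distr[rotated]) auto
    with 1 show ?thesis by simp
  qed
  have q0: "(LINT x|lborel. q n x) = 0" for n
    unfolding q_def using tr hint by simp
  have lim: "(\<lambda>n. LINT x|lborel. q n x) \<longlonglongrightarrow> (LINT x|lborel. dpartial i h x)"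
  \<comment> \<open>The shifts have length at most 1, so all quotients vanish outside the ball of
    radius \<open>R + 1\<close>.\<close>
  proof (rule integral_dominated_convergence[where w="\<lambda>x. indicator (cball 0 (R + 1)) x * \<bar>B\<bar>"])
    show "dpartial i h \<in> borel_measurable lborel" using dm by simp
    show "q n \<in> borel_measurable lborel" for n unfolding q_def by measurable
    show "integrable lborel (\<lambda>x. indicator (cball 0 (R + 1)) x * \<bar>B\<bar>)"
      by (intro integrable_mult_left integrable_real_indicator emeasure_bounded_finite bounded_cball) simp
    show "AE x in lborel. (\<lambda>n. q n x) \<longlonglongrightarrow> dpartial i h x"
    proof (intro AE_I2)
      fix x
      have "((\<lambda>s. (h (x + s *\<^sub>R i) - h x) / s) \<longlongrightarrow> dpartial i h x) (at 0)"
        using hder[of x 0] by (simp add: DERIV_def)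
      moreover have "filterlim (\<lambda>n. 1 / real (Suc n)) (at 0) sequentially"
        using LIMSEQ_Suc[OF lim_1_over_n] by (auto simp: filterlim_at)
      ultimately have "(\<lambda>n. (h (x + (1 / real (Suc n)) *\<^sub>R i) - h x) / (1 / real (Suc n))) \<longlonglongrightarrow> dpartial i h x"
        by (rule filterlim_compose)
      then show "(\<lambda>n. q n x) \<longlonglongrightarrow> dpartial i h x" by (simp add: q_def)
    qed
    show "AE x in lborel. norm (q n x) \<le> indicator (cball 0 (R + 1)) x * \<bar>B\<bar>" for n
    proof (intro AE_I2)
      fix x
      show "norm (q n x) \<le> indicator (cball 0 (R + 1)) x * \<bar>B\<bar>"
      proof (cases "x \<in> cball 0 (R + 1)")
        case True
        have "(0::real) < 1 / Suc n" by simp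
        from MVT2[OF this, of "\<lambda>s. h (x + s *\<^sub>R i)" "\<lambda>s. dpartial i h (x + s *\<^sub>R i)"] hder
        obtain z where "h (x + (1 / Suc n) *\<^sub>R i) - h x = (1 / Suc n) * dpartial i h (x + z *\<^sub>R i)" by auto
        then have "q n x = dpartial i h (x + z *\<^sub>R i)" by (simp add: q_def del: of_nat_Suc)
        then show ?thesis using True B[of "x + z *\<^sub>R i"] by simp
      next
        case False
        have "norm ((1 / Suc n) *\<^sub>R i) \<le> 1" using i by (simp add: divide_simps)
        then have "norm x \<le> norm (x + (1 / Suc n) *\<^sub>R i) + 1"
          using norm_triangle_ineq4[of "x + (1 / Suc n) *\<^sub>R i" "(1 / Suc n) *\<^sub>R i"]
          unfolding add_diff_cancel_right' by linarith
        then have "x + (1 / Suc n) *\<^sub>R i \<notin> K" "x \<notin> K" using False R[of x] R[of "x + (1 / Suc n) *\<^sub>R i"] by auto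
        then show ?thesis by (simp add: q_def K(2) del: of_nat_Suc)
      qed
    qed
  qed
  then show ?thesis by (simp add: q0 LIMSEQ_const_iff)
qed

text \<open>The product of the two functions has compact support, so the integral of its derivative
  vanishes; the product rule splits that integral.\<close>

lemma test_function_by_parts:
  fixes \<eta> \<zeta> :: "'a::euclidean_space \<Rightarrow> real"
  assumes S: "open S" and \<eta>: "\<eta> \<in> test_functions S" and \<zeta>: "\<zeta> \<in> test_functions S" and i: "i \<in> Basis"
  shows "(LINT x|leb S. \<eta> x * dpartial i \<zeta> x) = - (LINT x|leb S. dpartial i \<eta> x * \<zeta> x)"
proof -
  note d\<eta> = dpartial_test_function[OF \<eta> i] and d\<zeta> = dpartial_test_function[OF \<zeta> i]
  obtain K where K: "compact K" "K \<subseteq> S" "\<And>x. x \<notin> K \<Longrightarrow> \<zeta> x = 0" using \<zeta> unfolding test_functions_def by blast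
  note K' = dpartial_zero_outside[OF K(1,3)]
  obtain B1 where B1: "B1 \<ge> 0" "\<And>x. \<bar>\<eta> x\<bar> \<le> B1" by (rule test_function_bounded[OF \<eta>]) blast
  obtain B2 where B2: "B2 \<ge> 0" "\<And>x. \<bar>\<zeta> x\<bar> \<le> B2" by (rule test_function_bounded[OF \<zeta>]) blast
  obtain B3 where B3: "B3 \<ge> 0" "\<And>x. \<bar>dpartial i \<eta> x\<bar> \<le> B3" by (rule test_function_bounded[OF d\<eta>]) blast
  obtain B4 where B4: "B4 \<ge> 0" "\<And>x. \<bar>dpartial i \<zeta> x\<bar> \<le> B4" by (rule test_function_bounded[OF d\<zeta>]) blast
  have der: "dpartial i (\<lambda>x. \<eta> x * \<zeta> x) x = \<eta> x * dpartial i \<zeta> x + dpartial i \<eta> x * \<zeta> x" for x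
  proof -
    obtain D1 where D1: "(\<eta> has_derivative D1) (at x)" using test_function_differentiable[OF \<eta>] differentiable_def by blast
    obtain D2 where D2: "(\<zeta> has_derivative D2) (at x)" using test_function_differentiable[OF \<zeta>] differentiable_def by blast
    show ?thesis using dpartial_has_derivative[OF has_derivative_mult[OF D1 D2], of i]
      dpartial_has_derivative[OF D1, of i] dpartial_has_derivative[OF D2, of i] by simp
  qed
  have "(LINT x|lborel. dpartial i (\<lambda>x. \<eta> x * \<zeta> x) x) = 0"
  proof (rule integral_dpartial_zero[OF i _ K(1)])
    show "(\<lambda>x. \<eta> x * \<zeta> x) differentiable (at x)" for x
      using test_function_differentiable[OF \<eta>] test_function_differentiable[OF \<zeta>] by (rule differentiable_mult)
    show "\<And>x. x \<notin> K \<Longrightarrow> \<eta> x * \<zeta> x = 0" using K by simp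
    show "dpartial i (\<lambda>x. \<eta> x * \<zeta> x) \<in> borel_measurable borel"
      using test_function_measurable[OF \<eta>] test_function_measurable[OF \<zeta>] test_function_measurable[OF d\<eta>] test_function_measurable[OF d\<zeta>]
      unfolding der[abs_def] by measurable
    show "\<bar>dpartial i (\<lambda>x. \<eta> x * \<zeta> x) x\<bar> \<le> B1 * B4 + B3 * B2" for x
    proof -
      have "\<bar>\<eta> x * dpartial i \<zeta> x\<bar> \<le> B1 * B4" unfolding abs_mult using B1 B4 by (intro mult_mono) auto
      moreover have "\<bar>dpartial i \<eta> x * \<zeta> x\<bar> \<le> B3 * B2" unfolding abs_mult using B3 B2 by (intro mult_mono) auto
      ultimately show ?thesis unfolding der by linarith
    qed
  qed
  moreover have z: "\<eta> x * dpartial i \<zeta> x + dpartial i \<eta> x * \<zeta> x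
      = indicator K x * (\<eta> x * dpartial i \<zeta> x) + indicator K x * (dpartial i \<eta> x * \<zeta> x)" for x
    using K(3)[of x] K'[where x=x and i=i] by (cases "x \<in> K") auto
  have l1: "integrable lborel (\<lambda>x. indicator K x * (\<eta> x * dpartial i \<zeta> x))"
    "(LINT x|leb S. \<eta> x * dpartial i \<zeta> x) = (LINT x|lborel. indicator K x * (\<eta> x * dpartial i \<zeta> x))"
    by (rule loc_integrable_mult_bounded[OF S test_function_loc_integrable[OF S \<eta>] K(1,2) test_function_measurable[OF d\<zeta>] _ B4(2)],
        rule K', assumption, assumption)+
  have l2: "integrable lborel (\<lambda>x. indicator K x * (dpartial i \<eta> x * \<zeta> x))"
    "(LINT x|leb S. dpartial i \<eta> x * \<zeta> x) = (LINT x|lborel. indicator K x * (dpartial i \<eta> x * \<zeta> x))"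
    by (rule loc_integrable_mult_bounded[OF S test_function_loc_integrable[OF S d\<eta>] K(1,2) test_function_measurable[OF \<zeta>] _ B2(2)],
        rule K(3), assumption)+
  have "(LINT x|lborel. dpartial i (\<lambda>x. \<eta> x * \<zeta> x) x) = (LINT x|leb S. \<eta> x * dpartial i \<zeta> x) + (LINT x|leb S. dpartial i \<eta> x * \<zeta> x)"
  proof -
    have "(LINT x|lborel. dpartial i (\<lambda>x. \<eta> x * \<zeta> x) x)
      = (LINT x|lborel. indicator K x * (\<eta> x * dpartial i \<zeta> x) + indicator K x * (dpartial i \<eta> x * \<zeta> x))"
      unfolding der z ..
    also have "\<dots> = (LINT x|lborel. indicator K x * (\<eta> x * dpartial i \<zeta> x)) + (LINT x|lborel. indicator K x * (dpartial i \<eta> x * \<zeta> x))"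
      by (rule Bochner_Integration.integral_add[OF l1(1) l2(1)])
    finally show ?thesis unfolding l1(2) l2(2) .
  qed
  ultimately show ?thesis by simp
qed

lemma test_function_weak_partial:
  "open S \<Longrightarrow> \<eta> \<in> test_functions S \<Longrightarrow> i \<in> Basis \<Longrightarrow> weak_partial S i \<eta> (dpartial i \<eta>)"
  unfolding weak_partial_def using test_function_by_parts
  by (auto intro!: test_function_loc_integrable dpartial_test_function)

lemma loc_integrable_diff:
  "loc_integrable S f \<Longrightarrow> loc_integrable S g \<Longrightarrow> loc_integrable S (\<lambda>x. f x - g x)"
  unfolding loc_integrable_def by (auto intro!: set_integral_diff)

lemma loc_integrable_test_integrable:
  fixes g :: "'a::euclidean_space \<Rightarrow> real"
  assumes "open S" "loc_integrable S g" "\<eta> \<in> test_functions S"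
  shows "integrable (leb S) (\<lambda>x. g x * \<eta> x)"
proof -
  obtain K where K: "compact K" "K \<subseteq> S" "\<And>x. x \<notin> K \<Longrightarrow> \<eta> x = 0" using assms unfolding test_functions_def by blast
  obtain B where B: "B \<ge> 0" "\<And>x. \<bar>\<eta> x\<bar> \<le> B" by (rule test_function_bounded[OF assms(3)]) blast
  show ?thesis by (rule loc_integrable_mult_bounded(1)[OF assms(1,2) K(1,2) test_function_measurable[OF assms(3)] K(3) B(2)])
qed

text \<open>Makes the choice in \<open>wd\<close> harmless: any two weak derivatives differ by a
  function orthogonal to all test functions.\<close>

lemma weak_partial_unique:
  fixes f :: "'a::euclidean_space \<Rightarrow> real"
  assumes S: "open S" and g: "weak_partial S i f g" and h: "weak_partial S i f h"
  shows "AE x in leb S. g x = h x"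
proof -
  have "AE x in leb S. g x - h x = 0"
  proof (rule fundamental_lemma[OF S])
    show "loc_integrable S (\<lambda>x. g x - h x)" using g h by (auto simp: weak_partial_def intro: loc_integrable_diff)
    fix \<eta> assume \<eta>: "\<eta> \<in> test_functions S"
    have "integrable (leb S) (\<lambda>x. g x * \<eta> x)" "integrable (leb S) (\<lambda>x. h x * \<eta> x)"
      using g h \<eta> S by (auto simp: weak_partial_def intro: loc_integrable_test_integrable)
    then have "(LINT x|leb S. (g x - h x) * \<eta> x) = (LINT x|leb S. g x * \<eta> x) - (LINT x|leb S. h x * \<eta> x)"
      by (simp add: left_diff_distrib)
    also have "\<dots> = 0" using g h \<eta> by (auto simp: weak_partial_def)
    finally show "(LINT x|leb S. (g x - h x) * \<eta> x) = 0" .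
  qed
  then show ?thesis by simp
qed

lemma weak_partial_diff:
  fixes f :: "'a::euclidean_space \<Rightarrow> real"
  assumes S: "open S" and i: "i \<in> Basis" and f: "weak_partial S i f f'" and g: "weak_partial S i g g'"
  shows "weak_partial S i (\<lambda>x. f x - g x) (\<lambda>x. f' x - g' x)"
  unfolding weak_partial_def
proof (intro conjI ballI)
  have l: "loc_integrable S f" "loc_integrable S g" "loc_integrable S f'" "loc_integrable S g'"
    using f g by (auto simp: weak_partial_def)
  then show "loc_integrable S (\<lambda>x. f x - g x)" "loc_integrable S (\<lambda>x. f' x - g' x)"
    by (auto intro: loc_integrable_diff)
  fix \<eta> assume \<eta>: "\<eta> \<in> test_functions S"
  note d = dpartial_test_function[OF \<eta> i]
  have "(LINT x|leb S. f x * dpartial i \<eta> x) = - (LINT x|leb S. f' x * \<eta> x)"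
       "(LINT x|leb S. g x * dpartial i \<eta> x) = - (LINT x|leb S. g' x * \<eta> x)"
    using f g \<eta> by (auto simp: weak_partial_def)
  then show "(LINT x|leb S. (f x - g x) * dpartial i \<eta> x) = - (LINT x|leb S. (f' x - g' x) * \<eta> x)"
    using loc_integrable_test_integrable[OF S l(1) d] loc_integrable_test_integrable[OF S l(2) d]
      loc_integrable_test_integrable[OF S l(3) \<eta>] loc_integrable_test_integrable[OF S l(4) \<eta>]
    by (simp add: left_diff_distrib)
qed

lemma loc_integrable_cong_AE:
  fixes f g :: "'a::euclidean_space \<Rightarrow> real"
  assumes S: "open S" and f: "loc_integrable S f" and g: "g \<in> borel_measurable (leb S)" and e: "AE x in leb S. f x = g x"
  shows "loc_integrable S g"
  unfolding loc_integrable_def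
proof (intro conjI allI impI g)
  fix K assume K: "compact K \<and> K \<subseteq> S"
  have Sm: "S \<in> sets lborel" using S by simp
  have fK: "integrable lborel (\<lambda>x. indicator K x *\<^sub>R f x)"
    using f K unfolding loc_integrable_def set_integrable_def by blast
  have "(\<lambda>x. indicator K x * (g x * indicator S x)) \<in> borel_measurable lborel"
  proof (rule borel_measurable_times)
    show "(\<lambda>x. g x * indicat_real S x) \<in> borel_measurable lborel"
      using g Sm by (simp add: borel_measurable_restrict_space_iff mult.commute)
    show "indicat_real K \<in> borel_measurable lborel" using K by (simp add: compact_imp_closed)
  qed
  also have "(\<lambda>x. indicator K x * (g x * indicator S x)) = (\<lambda>x. indicator K x *\<^sub>R g x)"
    using K by (auto simp: indicator_def fun_eq_iff)
  finally have gm: "(\<lambda>x. indicator K x *\<^sub>R g x) \<in> borel_measurable lborel" .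
  have "AE x in lborel. x \<in> S \<longrightarrow> f x = g x" using e Sm by (simp add: AE_restrict_space_iff)
  then have "AE x in lborel. indicat_real K x *\<^sub>R f x = indicat_real K x *\<^sub>R g x"
    by eventually_elim (use K in \<open>auto simp: indicator_def\<close>)
  then show "set_integrable lborel K g"
    unfolding set_integrable_def by (rule integrable_cong_AE_imp[OF fK gm])
qed

text \<open>Second derivatives are taken of \<open>wd S i f\<close>, which equals the derivative
  provided by a Sobolev space only almost everywhere; this carries weak derivatives from one to the
  other.\<close>

lemma weak_partial_cong_AE:
  fixes f f' :: "'a::euclidean_space \<Rightarrow> real"
  assumes S: "open S" and w: "weak_partial S i f h" and g: "g \<in> borel_measurable (leb S)"
    and e: "AE x in leb S. f x = g x" and i: "i \<in> Basis"
  shows "weak_partial S i g h"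
  unfolding weak_partial_def
proof (intro conjI ballI)
  have f: "loc_integrable S f" and h: "loc_integrable S h" using w by (auto simp: weak_partial_def)
  show "loc_integrable S g" by (rule loc_integrable_cong_AE[OF S f g e])
  show "loc_integrable S h" by (rule h)
  fix \<eta> assume \<eta>: "\<eta> \<in> test_functions S"
  have m: "dpartial i \<eta> \<in> borel_measurable (leb S)"
    using test_function_measurable[OF dpartial_test_function[OF \<eta> i]] by (intro measurable_restrict_space1) simp
  have fm: "f \<in> borel_measurable (leb S)" using f by (simp add: loc_integrable_def)
  have "(LINT x|leb S. g x * dpartial i \<eta> x) = (LINT x|leb S. f x * dpartial i \<eta> x)"
  proof (intro integral_cong_AE borel_measurable_times fm g m)
    show "AE x in leb S. g x * dpartial i \<eta> x = f x * dpartial i \<eta> x" using e by eventually_elim simp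
  qed
  then show "(LINT x|leb S. g x * dpartial i \<eta> x) = - (LINT x|leb S. h x * \<eta> x)"
    using w \<eta> by (simp add: weak_partial_def)
qed

lemma wd_weak_partial: "weak_partial S i f g \<Longrightarrow> weak_partial S i f (wd S i f)"
  unfolding wd_def by (rule someI[where P="weak_partial S i f"])

lemma wd_eq_AE: "open S \<Longrightarrow> weak_partial S i f g \<Longrightarrow> AE x in leb S. wd S i f x = g x"
  using weak_partial_unique wd_weak_partial by blast

section \<open>Square integrable functions: pairings and limits\<close>

lemma Lspace_2_cong_AE:
  assumes "f \<in> Lspace 2 M" "g \<in> borel_measurable M" "AE x in M. g x = f x"
  shows "g \<in> Lspace 2 M"
proof -
  have "(\<integral>\<^sup>+x. (ennreal \<bar>g x\<bar>)\<^sup>2 \<partial>M) = (\<integral>\<^sup>+x. (ennreal \<bar>f x\<bar>)\<^sup>2 \<partial>M)"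
  proof (intro nn_integral_cong_AE)
    show "AE x in M. (ennreal \<bar>g x\<bar>)\<^sup>2 = (ennreal \<bar>f x\<bar>)\<^sup>2" using assms(3) by eventually_elim simp
  qed
  then show ?thesis using assms by (simp add: Lspace_2_iff)
qed

lemma Lnorm_2_cong_AE: "AE x in M. g x = f x \<Longrightarrow> Lnorm 2 M g = Lnorm 2 M f"
proof -
  assume e: "AE x in M. g x = f x"
  have "(\<integral>\<^sup>+x. ennreal (\<bar>g x\<bar> powr enn2real 2) \<partial>M) = (\<integral>\<^sup>+x. ennreal (\<bar>f x\<bar> powr enn2real 2) \<partial>M)"
  proof (intro nn_integral_cong_AE)
    show "AE x in M. ennreal (\<bar>g x\<bar> powr enn2real 2) = ennreal (\<bar>f x\<bar> powr enn2real 2)" using e by eventually_elim simp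
  qed
  then show ?thesis by (simp add: Lnorm_def)
qed

lemma Lspace_2_mult:
  assumes f: "f \<in> Lspace 2 M" and g: "g \<in> Lspace 2 M"
  shows "integrable M (\<lambda>x. f x * g x)" and "ennreal \<bar>LINT x|M. f x * g x\<bar> \<le> Lnorm 2 M f * Lnorm 2 M g"
    and "(\<integral>\<^sup>+x. ennreal \<bar>f x\<bar> * ennreal \<bar>g x\<bar> \<partial>M) < \<infinity>"
    and "(\<integral>\<^sup>+x. ennreal \<bar>f x\<bar> * ennreal \<bar>g x\<bar> \<partial>M) \<le> Lnorm 2 M f * Lnorm 2 M g"
proof -
  have [measurable]: "f \<in> borel_measurable M" "g \<in> borel_measurable M"
    using f g by (auto simp: Lspace_2_iff)
  have "(\<integral>\<^sup>+x. ennreal \<bar>f x\<bar> * ennreal \<bar>g x\<bar> \<partial>M)\<^sup>2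
     \<le> (\<integral>\<^sup>+x. (ennreal \<bar>f x\<bar>)\<^sup>2 \<partial>M) * (\<integral>\<^sup>+x. (ennreal \<bar>g x\<bar>)\<^sup>2 \<partial>M)"
    by (rule Cauchy_Schwarz_nn_integral) auto
  also have "\<dots> = (Lnorm 2 M f * Lnorm 2 M g)\<^sup>2" by (simp only: power_mult_distrib Lnorm_2_power2)
  finally show le: "(\<integral>\<^sup>+x. ennreal \<bar>f x\<bar> * ennreal \<bar>g x\<bar> \<partial>M) \<le> Lnorm 2 M f * Lnorm 2 M g"
    by (rule ennreal_le_of_power2_le)
  have "Lnorm 2 M f < \<infinity>" "Lnorm 2 M g < \<infinity>" using f g by (auto simp: Lspace_def)
  then have "Lnorm 2 M f * Lnorm 2 M g < \<infinity>" by (simp add: ennreal_mult_less_top)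
  with le show fin: "(\<integral>\<^sup>+x. ennreal \<bar>f x\<bar> * ennreal \<bar>g x\<bar> \<partial>M) < \<infinity>" by (rule le_less_trans)
  then show i: "integrable M (\<lambda>x. f x * g x)"
    by (intro integrableI_bounded) (auto simp: abs_mult ennreal_mult)
  have "ennreal \<bar>LINT x|M. f x * g x\<bar> \<le> (\<integral>\<^sup>+x. norm (f x * g x) \<partial>M)"
    using integral_norm_bound_ennreal[OF i] by simp
  also have "\<dots> = (\<integral>\<^sup>+x. ennreal \<bar>f x\<bar> * ennreal \<bar>g x\<bar> \<partial>M)" by (simp add: abs_mult ennreal_mult)
  finally show "ennreal \<bar>LINT x|M. f x * g x\<bar> \<le> Lnorm 2 M f * Lnorm 2 M g" using le by (rule order_trans)
qed

lemma Lspace_2_pairing_limit: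
  assumes f: "\<And>n. f n \<in> Lspace 2 M" and h: "h \<in> Lspace 2 M" and g: "g \<in> Lspace 2 M"
    and d: "\<And>n. (\<lambda>x. f n x - h x) \<in> Lspace 2 M"
    and lim: "(\<lambda>n. Lnorm 2 M (\<lambda>x. f n x - h x)) \<longlonglongrightarrow> 0"
  shows "(\<lambda>n. LINT x|M. f n x * g x) \<longlonglongrightarrow> (LINT x|M. h x * g x)"
proof -
  have "(\<lambda>n. ennreal \<bar>(LINT x|M. f n x * g x) - (LINT x|M. h x * g x)\<bar>) \<longlonglongrightarrow> 0"
  proof (rule tendsto_sandwich[OF _ _ tendsto_const])
    have "(\<lambda>n. Lnorm 2 M g * Lnorm 2 M (\<lambda>x. f n x - h x)) \<longlonglongrightarrow> Lnorm 2 M g * 0"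
      using g by (intro ennreal_tendsto_cmult lim) (auto simp: Lspace_def)
    then show "(\<lambda>n. Lnorm 2 M (\<lambda>x. f n x - h x) * Lnorm 2 M g) \<longlonglongrightarrow> 0" by (simp add: mult.commute)
    have "ennreal \<bar>(LINT x|M. f n x * g x) - (LINT x|M. h x * g x)\<bar> \<le> Lnorm 2 M (\<lambda>x. f n x - h x) * Lnorm 2 M g" for n
      using Lspace_2_mult(2)[OF d[of n] g] Lspace_2_mult(1)[OF f[of n] g] Lspace_2_mult(1)[OF h g]
      by (simp add: left_diff_distrib)
    then show "\<forall>\<^sub>F n in sequentially. ennreal \<bar>(LINT x|M. f n x * g x) - (LINT x|M. h x * g x)\<bar> \<le> Lnorm 2 M (\<lambda>x. f n x - h x) * Lnorm 2 M g"
      by simp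
  qed simp
  then have "(\<lambda>n. \<bar>(LINT x|M. f n x * g x) - (LINT x|M. h x * g x)\<bar>) \<longlonglongrightarrow> 0"
    using tendsto_enn2real[of "\<lambda>n. ennreal \<bar>(LINT x|M. f n x * g x) - (LINT x|M. h x * g x)\<bar>" 0 sequentially] by simp
  then show ?thesis using LIM_zero_cancel tendsto_rabs_zero_iff by blast
qed

lemma Lspace_2_bounded:
  assumes "finite_measure M" "f \<in> borel_measurable M" "\<And>x. \<bar>f x\<bar> \<le> B"
  shows "f \<in> Lspace 2 M"
proof -
  have "(\<integral>\<^sup>+x. (ennreal \<bar>f x\<bar>)\<^sup>2 \<partial>M) \<le> (\<integral>\<^sup>+x. ennreal (B\<^sup>2) \<partial>M)"
  proof (intro nn_integral_mono)
    fix x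
    have "\<bar>f x\<bar>\<^sup>2 \<le> B\<^sup>2" by (rule power_mono[OF assms(3)]) simp
    then show "(ennreal \<bar>f x\<bar>)\<^sup>2 \<le> ennreal (B\<^sup>2)" by (simp add: ennreal_power)
  qed
  also have "\<dots> < \<infinity>" using finite_measure.emeasure_finite[OF assms(1)] by (simp add: ennreal_mult_eq_top_iff less_top[symmetric])
  finally show ?thesis using assms by (simp add: Lspace_2_iff)
qed

lemma Lspace_2_diff:
  assumes f: "f \<in> Lspace 2 M" and g: "g \<in> Lspace 2 M"
  shows "(\<lambda>x. f x - g x) \<in> Lspace 2 M"
proof -
  have [measurable]: "f \<in> borel_measurable M" "g \<in> borel_measurable M"
    using f g by (auto simp: Lspace_2_iff)
  have "(\<integral>\<^sup>+x. (ennreal \<bar>f x - g x\<bar>)\<^sup>2 \<partial>M) \<le> (\<integral>\<^sup>+x. 2 * (ennreal \<bar>f x\<bar>)\<^sup>2 + 2 * (ennreal \<bar>g x\<bar>)\<^sup>2 \<partial>M)"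
  proof (intro nn_integral_mono)
    fix x
    have "\<bar>f x - g x\<bar>\<^sup>2 \<le> 2 * \<bar>f x\<bar>\<^sup>2 + 2 * \<bar>g x\<bar>\<^sup>2"
      using sum_squares_ge_zero[of "f x + g x" 0] by (simp add: power2_eq_square algebra_simps)
    then have "ennreal (\<bar>f x - g x\<bar>\<^sup>2) \<le> ennreal (2 * \<bar>f x\<bar>\<^sup>2 + 2 * \<bar>g x\<bar>\<^sup>2)" by (rule ennreal_leI)
    then show "(ennreal \<bar>f x - g x\<bar>)\<^sup>2 \<le> 2 * (ennreal \<bar>f x\<bar>)\<^sup>2 + 2 * (ennreal \<bar>g x\<bar>)\<^sup>2"
      by (simp add: ennreal_power ennreal_plus ennreal_mult)
  qed
  also have "\<dots> = 2 * (\<integral>\<^sup>+x. (ennreal \<bar>f x\<bar>)\<^sup>2 \<partial>M) + 2 * (\<integral>\<^sup>+x. (ennreal \<bar>g x\<bar>)\<^sup>2 \<partial>M)"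
    by (subst nn_integral_add) (auto simp: nn_integral_cmult)
  also have "\<dots> < \<infinity>" using f g by (simp add: Lspace_2_iff ennreal_mult_less_top)
  finally show ?thesis by (simp add: Lspace_2_iff)
qed

section \<open>Sobolev functions and Green's formula\<close>

lemma Hnorm_power2: "(Hnorm k S f)\<^sup>2 = Hnorm_sq k S f"
  by (cases "Hnorm_sq k S f") (auto simp: Hnorm_def ennreal_power top_power_ennreal)

lemma Hnorm_1_bounds:
  "Lnorm 2 (leb S) f \<le> Hnorm 1 S f" "i \<in> Basis \<Longrightarrow> Lnorm 2 (leb S) (wd S i f) \<le> Hnorm 1 S f"
proof -
  have e: "(Hnorm 1 S f)\<^sup>2 = (Lnorm 2 (leb S) f)\<^sup>2 + (\<Sum>i\<in>Basis. (Lnorm 2 (leb S) (wd S i f))\<^sup>2)"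
    by (simp add: Hnorm_power2)
  show "Lnorm 2 (leb S) f \<le> Hnorm 1 S f" by (rule ennreal_le_of_power2_le) (simp only: e, simp)
  assume "i \<in> Basis"
  then have "(Lnorm 2 (leb S) (wd S i f))\<^sup>2 \<le> (\<Sum>i\<in>Basis. (Lnorm 2 (leb S) (wd S i f))\<^sup>2)"
    by (intro member_le_sum) auto
  then have "(Lnorm 2 (leb S) (wd S i f))\<^sup>2 \<le> (Hnorm 1 S f)\<^sup>2"
    unfolding e by (rule add_increasing[OF zero_le])
  then show "Lnorm 2 (leb S) (wd S i f) \<le> Hnorm 1 S f" by (rule ennreal_le_of_power2_le)
qed

lemma Hspace_1_iff:
  "f \<in> Hspace 1 S \<longleftrightarrow> f \<in> Lspace 2 (leb S) \<and> (\<forall>i\<in>Basis. \<exists>g\<in>Lspace 2 (leb S). weak_partial S i f g)"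
  by (simp only: One_nat_def Hspace.simps mem_Collect_eq)

lemma Hspace_1_wd:
  assumes S: "open S" and f: "f \<in> Hspace 1 S" and i: "i \<in> Basis"
  shows "f \<in> Lspace 2 (leb S)" "wd S i f \<in> Lspace 2 (leb S)" "weak_partial S i f (wd S i f)"
proof -
  show "f \<in> Lspace 2 (leb S)" using f unfolding Hspace_1_iff by blast
  obtain g where g: "g \<in> Lspace 2 (leb S)" "weak_partial S i f g" using f i unfolding Hspace_1_iff by blast
  show w: "weak_partial S i f (wd S i f)" by (rule wd_weak_partial[OF g(2)])
  then have "wd S i f \<in> borel_measurable (leb S)" by (simp add: weak_partial_def loc_integrable_def)
  then show "wd S i f \<in> Lspace 2 (leb S)" using wd_eq_AE[OF S g(2)] by (rule Lspace_2_cong_AE[OF g(1)])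
qed

text \<open>Membership in \<open>Hspace 2 S\<close> only provides some derivative in
  \<open>Hspace 1 S\<close>; the chosen \<open>wd S i f\<close> inherits that membership because it
  agrees with it almost everywhere.\<close>

lemma Hspace_2_wd:
  assumes S: "open S" and f: "f \<in> Hspace 2 S" and i: "i \<in> Basis"
  shows "wd S i f \<in> Hspace 1 S"
proof -
  have f': "f \<in> Hspace (Suc 1) S" using f by (simp add: numeral_2_eq_2)
  obtain g where g: "g \<in> Hspace 1 S" "weak_partial S i f g" using f' i unfolding Hspace.simps(2)[of "1"] by blast
  have w: "weak_partial S i f (wd S i f)" by (rule wd_weak_partial[OF g(2)])
  then have m: "wd S i f \<in> borel_measurable (leb S)" by (simp add: weak_partial_def loc_integrable_def)
  note ae = wd_eq_AE[OF S g(2)]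
  have ae': "AE x in leb S. g x = wd S i f x" using ae by eventually_elim simp
  have L: "wd S i f \<in> Lspace 2 (leb S)" using g(1) unfolding Hspace_1_iff by (intro Lspace_2_cong_AE[OF _ m ae]) blast
  have "\<exists>h\<in>Lspace 2 (leb S). weak_partial S j (wd S i f) h" if j: "j \<in> Basis" for j
    using Hspace_1_wd[OF S g(1) j] weak_partial_cong_AE[OF S _ m ae' j] by blast
  then show ?thesis using L unfolding Hspace_1_iff by blast
qed

text \<open>For a test function in place of \<open>b\<close> this is the definition of the weak
  derivative of \<open>a\<close>. Both sides are continuous in \<open>b\<close> for the H^1 norm,
  and \<open>b\<close> is a limit of test functions in that norm.\<close>

lemma H10_by_parts:
  fixes S :: "'a::euclidean_space set"
  assumes S: "open S" "bounded S" and a: "a \<in> Hspace 1 S" and b: "b \<in> H10 S" and i: "i \<in> Basis"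
  shows "(LINT x|leb S. a x * wd S i b x) = - (LINT x|leb S. wd S i a x * b x)"
proof -
  interpret finite_measure "leb S" using S by (intro finite_leb) auto
  obtain \<eta> where b1: "b \<in> Hspace 1 S" and \<eta>: "\<And>n. \<eta> n \<in> test_functions S"
    and lim: "(\<lambda>n. Hnorm 1 S (\<lambda>x. \<eta> n x - b x)) \<longlonglongrightarrow> 0"
    using b unfolding H10_def by blast
  note aL = Hspace_1_wd[OF S(1) a i] and bL = Hspace_1_wd[OF S(1) b1 i]
  have test_L2: "\<zeta> \<in> Lspace 2 (leb S)" if t: "\<zeta> \<in> test_functions S" for \<zeta>
  proof -
    obtain B where "B \<ge> 0" "\<And>x. \<bar>\<zeta> x\<bar> \<le> B" by (rule test_function_bounded[OF t]) blast
    then show ?thesis using test_function_measurable[OF t]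
      by (intro Lspace_2_bounded[OF finite_measure_axioms, of _ B] measurable_restrict_space1) auto
  qed
  note d\<eta> = dpartial_test_function[OF \<eta> i]
  have l1: "(\<lambda>n. Lnorm 2 (leb S) (\<lambda>x. \<eta> n x - b x)) \<longlonglongrightarrow> 0"
    by (rule tendsto_sandwich[OF _ _ tendsto_const lim]; intro always_eventually allI Hnorm_1_bounds(1) zero_le)
  \<comment> \<open>The H^1 norm controls the chosen derivative of the difference
    \<open>\<eta> n - b\<close>; uniqueness identifies it with the difference of the
    derivatives.\<close>
  have l2: "(\<lambda>n. Lnorm 2 (leb S) (\<lambda>x. dpartial i (\<eta> n) x - wd S i b x)) \<longlonglongrightarrow> 0"
  proof (rule tendsto_sandwich[OF _ _ tendsto_const lim])
    have "Lnorm 2 (leb S) (\<lambda>x. dpartial i (\<eta> n) x - wd S i b x) = Lnorm 2 (leb S) (wd S i (\<lambda>x. \<eta> n x - b x))" for n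
    proof (rule Lnorm_2_cong_AE)
      have "AE x in leb S. wd S i (\<lambda>x. \<eta> n x - b x) x = dpartial i (\<eta> n) x - wd S i b x"
        by (rule wd_eq_AE[OF S(1) weak_partial_diff[OF S(1) i test_function_weak_partial[OF S(1) \<eta> i] bL(3)]])
      then show "AE x in leb S. dpartial i (\<eta> n) x - wd S i b x = wd S i (\<lambda>x. \<eta> n x - b x) x"
        by eventually_elim simp
    qed
    then show "\<forall>\<^sub>F n in sequentially. Lnorm 2 (leb S) (\<lambda>x. dpartial i (\<eta> n) x - wd S i b x) \<le> Hnorm 1 S (\<lambda>x. \<eta> n x - b x)"
      using Hnorm_1_bounds(2)[OF i] by (intro always_eventually allI) (simp only:)
  qed simp
  have "(\<lambda>n. LINT x|leb S. dpartial i (\<eta> n) x * a x) \<longlonglongrightarrow> (LINT x|leb S. wd S i b x * a x)"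
    by (rule Lspace_2_pairing_limit[OF test_L2[OF d\<eta>] bL(2) aL(1) Lspace_2_diff[OF test_L2[OF d\<eta>] bL(2)] l2])
  moreover have "(\<lambda>n. - (LINT x|leb S. \<eta> n x * wd S i a x)) \<longlonglongrightarrow> - (LINT x|leb S. b x * wd S i a x)"
    by (rule tendsto_minus, rule Lspace_2_pairing_limit[OF test_L2[OF \<eta>] bL(1) aL(2) Lspace_2_diff[OF test_L2[OF \<eta>] bL(1)] l1])
  moreover have "(LINT x|leb S. dpartial i (\<eta> n) x * a x) = - (LINT x|leb S. \<eta> n x * wd S i a x)" for n
    using aL(3) \<eta>[of n] by (simp add: weak_partial_def mult.commute)
  ultimately have "(LINT x|leb S. wd S i b x * a x) = - (LINT x|leb S. b x * wd S i a x)"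
    using LIMSEQ_unique by simp
  then show ?thesis by (simp add: mult.commute)
qed

text \<open>Both sides are minus the Dirichlet form of \<open>a\<close> and \<open>b\<close>, which
  is symmetric.\<close>

lemma green_identity:
  fixes S :: "'a::euclidean_space set"
  assumes S: "open S" "bounded S" and a: "a \<in> Hspace 2 S \<inter> H10 S" and b: "b \<in> Hspace 2 S \<inter> H10 S"
  shows "(LINT x|leb S. laplacian S a x * b x) = (LINT x|leb S. a x * laplacian S b x)"
proof -
  \<comment> \<open>Zero boundary values enter only through the second factor, and second
    derivatives only through the first; the other half is the same with the roles exchanged.\<close>
  have half: "(LINT x|leb S. laplacian S a x * b x) = - (\<Sum>i\<in>Basis. LINT x|leb S. wd S i a x * wd S i b x)"
    if a: "a \<in> Hspace 2 S" and b: "b \<in> H10 S" for a b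
  proof -
    have b1: "b \<in> Hspace 1 S" using b by (simp add: H10_def)
    have "b \<in> Lspace 2 (leb S)" using b1 unfolding Hspace_1_iff by blast
    then have "integrable (leb S) (\<lambda>x. wd S i (wd S i a) x * b x)" if "i \<in> Basis" for i
      using Hspace_1_wd(2)[OF S(1) Hspace_2_wd[OF S(1) a that] that] by (intro Lspace_2_mult(1))
    then have "(LINT x|leb S. laplacian S a x * b x) = (\<Sum>i\<in>Basis. LINT x|leb S. wd S i (wd S i a) x * b x)"
      unfolding laplacian_def sum_distrib_right by (intro Bochner_Integration.integral_sum) auto
    also have "\<dots> = (\<Sum>i\<in>Basis. - (LINT x|leb S. wd S i a x * wd S i b x))"
      using H10_by_parts[OF S Hspace_2_wd[OF S(1) a] b] by (intro sum.cong) auto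
    finally show ?thesis by (simp add: sum_negf)
  qed
  have "(LINT x|leb S. laplacian S a x * b x) = (LINT x|leb S. laplacian S b x * a x)"
    using half[of a b] half[of b a] a b by (simp add: mult.commute)
  then show ?thesis by (simp add: mult.commute)
qed

section \<open>Weak time derivatives\<close>

lemma smooth_on_diff_cmult:
  fixes f g :: "'a::euclidean_space \<Rightarrow> real"
  assumes f: "smooth_on UNIV f" and g: "smooth_on UNIV g"
  shows "smooth_on UNIV (\<lambda>x. f x - k * g x)"
proof -
  have eq: "foldr dpartial is (\<lambda>x. f x - k * g x) = (\<lambda>x. foldr dpartial is f x - k * foldr dpartial is g x)"
    if "is \<in> lists Basis" for "is"
    using that
  proof (induction "is")
    case (Cons i "is")
    have "dpartial i (\<lambda>x. foldr dpartial is f x - k * foldr dpartial is g x) x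
        = dpartial i (foldr dpartial is f) x - k * dpartial i (foldr dpartial is g) x" for x
    proof -
      obtain D1 where D1: "(foldr dpartial is f has_derivative D1) (at x)"
        using f Cons.hyps unfolding smooth_on_def differentiable_def by blast
      obtain D2 where D2: "(foldr dpartial is g has_derivative D2) (at x)"
        using g Cons.hyps unfolding smooth_on_def differentiable_def by blast
      show ?thesis
        using dpartial_has_derivative[OF has_derivative_diff[OF D1 has_derivative_mult_right[OF D2, of k]], of i]
          dpartial_has_derivative[OF D1, of i] dpartial_has_derivative[OF D2, of i] by simp
    qed
    then show ?case unfolding foldr.simps o_apply Cons.IH by (simp add: fun_eq_iff)
  qed simp
  show ?thesis unfolding smooth_on_def
  proof (intro ballI)
    fix "is" :: "'a list" and x assume "is \<in> lists Basis"
    then show "foldr dpartial is (\<lambda>x. f x - k * g x) differentiable (at x)"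
      using f g unfolding eq[OF \<open>is \<in> lists Basis\<close>] smooth_on_def
      by (intro differentiable_diff differentiable_mult differentiable_const) blast+
  qed
qed

lemma test_functions_diff_cmult:
  fixes f g :: "'a::euclidean_space \<Rightarrow> real"
  assumes f: "f \<in> test_functions S" and g: "g \<in> test_functions S"
  shows "(\<lambda>x. f x - k * g x) \<in> test_functions S"
proof -
  obtain K1 where K1: "compact K1" "K1 \<subseteq> S" "\<And>x. x \<notin> K1 \<Longrightarrow> f x = 0" and f': "smooth_on UNIV f"
    using f unfolding test_functions_def by blast
  obtain K2 where K2: "compact K2" "K2 \<subseteq> S" "\<And>x. x \<notin> K2 \<Longrightarrow> g x = 0" and g': "smooth_on UNIV g"
    using g unfolding test_functions_def by blast
  have "compact (K1 \<union> K2)" "K1 \<union> K2 \<subseteq> S" using K1 K2 by auto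
  moreover have "f x - k * g x = 0" if "x \<notin> K1 \<union> K2" for x using K1(3)[of x] K2(3)[of x] that by simp
  ultimately show ?thesis unfolding test_functions_def
    using smooth_on_diff_cmult[OF f' g'] by (intro CollectI conjI exI[of _ "K1 \<union> K2"] allI impI)
qed

lemma test_function_deriv:
  fixes \<psi> :: "real \<Rightarrow> real"
  assumes "\<psi> \<in> test_functions S"
  shows "(\<psi> has_real_derivative deriv \<psi> x) (at x)" "dpartial 1 \<psi> x = deriv \<psi> x"
proof -
  show d: "(\<psi> has_real_derivative deriv \<psi> x) (at x)"
    using test_function_differentiable[OF assms, of x]
    by (simp add: DERIV_deriv_iff_real_differentiable)
  then show "dpartial 1 \<psi> x = deriv \<psi> x" by (rule differentiable_dpartial_1)
qed

lemma compact_in_interval: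
  fixes K :: "real set"
  assumes K: "compact K" "K \<subseteq> {0<..<T}" "0 < T"
  obtains a b where "0 < a" "a \<le> b" "b < T" "K \<subseteq> {a..b}"
proof (cases "K = {}")
  case True
  then show ?thesis using assms that[of "T/2" "T/2"] by auto
next
  case False
  obtain a where "a \<in> K" "\<And>x. x \<in> K \<Longrightarrow> a \<le> x" using compact_attains_inf[OF K(1) False] by blast
  moreover obtain b where "b \<in> K" "\<And>x. x \<in> K \<Longrightarrow> x \<le> b" using compact_attains_sup[OF K(1) False] by blast
  ultimately show ?thesis using K that[of a b] by (force simp: subset_iff)
qed

text \<open>The primitive vanishes to the left of the support by construction and to the right of it
  because the mean is zero, so its support is again compact in (0, T).\<close>

lemma test_function_primitive:
  fixes \<theta> :: "real \<Rightarrow> real"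
  assumes T: "0 < T" and \<theta>: "\<theta> \<in> test_functions {0<..<T}" and z: "(LINT t|leb {0<..<T}. \<theta> t) = 0"
  obtains \<Theta> where "\<Theta> \<in> test_functions {0<..<T}" "deriv \<Theta> = \<theta>"
proof -
  obtain K where K: "compact K" "K \<subseteq> {0<..<T}" "\<And>x. x \<notin> K \<Longrightarrow> \<theta> x = 0" and sm: "smooth_on UNIV \<theta>"
    using \<theta> unfolding test_functions_def by blast
  obtain a b where ab: "0 < a" "a \<le> b" "b < T" "K \<subseteq> {a..b}" by (rule compact_in_interval[OF K(1,2) T])
  have out: "\<theta> t = 0" if "t < a \<or> b < t" for t using K(3)[of t] ab that by force
  have c: "continuous_on A \<theta>" for A using test_function_continuous[OF \<theta>] continuous_on_subset by blast
  have eq0: "integral A \<theta> = 0" if "\<And>t. t \<in> A \<Longrightarrow> \<theta> t = 0" for A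
    using Henstock_Kurzweil_Integration.integral_cong[of A \<theta> "\<lambda>_. 0"] that by simp
  \<comment> \<open>The lower limit -1 is strictly left of the support, so every point
    \<open>t \<ge> a\<close> is interior to the interval on which the integral is
    differentiated.\<close>
  define \<Theta> where "\<Theta> t = integral {-1..t} \<theta>" for t
  have low: "\<Theta> t = 0" if "t < a" for t
    unfolding \<Theta>_def using that out by (intro eq0) auto
  have full: "integral {-1..T} \<theta> = 0"
  proof -
    have "set_integrable lborel {-1..T} \<theta>"
      unfolding set_integrable_def by (intro borel_integrable_compact c) auto
    then have "integral {-1..T} \<theta> = (LINT t:{-1..T}|lborel. \<theta> t)" by (rule set_borel_integral_eq_integral(2)[symmetric])
    also have "\<dots> = (LINT t|leb {0<..<T}. \<theta> t)"
      unfolding set_lebesgue_integral_def using out ab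
      by (subst integral_restrict_space) (auto intro!: Bochner_Integration.integral_cong simp: indicator_def)
    finally show ?thesis using z by simp
  qed
  have high: "\<Theta> t = 0" if "b < t" for t
  proof (cases "t \<le> T")
    case True
    have "integral {-1..t} \<theta> + integral {t..T} \<theta> = integral {-1..T} \<theta>"
      using True that ab by (intro Henstock_Kurzweil_Integration.integral_combine integrable_continuous_real c) auto
    moreover have "integral {t..T} \<theta> = 0" using that out by (intro eq0) auto
    ultimately show ?thesis using full by (simp add: \<Theta>_def)
  next
    case False
    have "integral {-1..T} \<theta> + integral {T..t} \<theta> = integral {-1..t} \<theta>"
      using False T by (intro Henstock_Kurzweil_Integration.integral_combine integrable_continuous_real c) auto
    moreover have "integral {T..t} \<theta> = 0" using ab out by (intro eq0) auto
    ultimately show ?thesis using full by (simp add: \<Theta>_def)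
  qed
  have der: "(\<Theta> has_real_derivative \<theta> t) (at t)" for t
  proof (cases "t < a")
    case True
    have "((\<lambda>_. 0) has_real_derivative 0) (at t)" by simp
    then have "(\<Theta> has_real_derivative 0) (at t)"
      by (rule has_field_derivative_transform_within_open[where S="{..<a}"]) (use True low in auto)
    then show ?thesis using out True by simp
  next
    case False
    have "(\<Theta> has_real_derivative \<theta> t) (at t within {-1..t+1})"
      unfolding \<Theta>_def using False ab by (intro integral_has_real_derivative c) auto
    then have "(\<Theta> has_real_derivative \<theta> t) (at t within {-1<..<t+1})" by (rule DERIV_subset) auto
    then show ?thesis using False ab by (subst (asm) at_within_open) auto
  qed
  have dp: "dpartial 1 \<Theta> = \<theta>" using differentiable_dpartial_1[OF der] by (simp add: fun_eq_iff)
  have "smooth_on UNIV \<Theta>" unfolding smooth_on_def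
  proof (intro ballI)
    fix "is" :: "real list" and x :: real assume is1: "is \<in> lists Basis"
    show "foldr dpartial is \<Theta> differentiable (at x)"
    proof (cases "is" rule: rev_cases)
      case Nil
      then show ?thesis using der by (auto simp: real_differentiable_def)
    next
      case (snoc js j)
      then show ?thesis using is1 sm dp unfolding smooth_on_def by auto
    qed
  qed
  moreover have "\<forall>x. x \<notin> {a..b} \<longrightarrow> \<Theta> x = 0" using low high by auto
  ultimately have "\<Theta> \<in> test_functions {0<..<T}"
    unfolding test_functions_def using ab by (intro CollectI conjI exI[of _ "{a..b}"]) auto
  moreover have "deriv \<Theta> = \<theta>" using DERIV_imp_deriv[OF der] by (simp add: fun_eq_iff)
  ultimately show ?thesis by (rule that)
qed

section \<open>Convolution operators in time\<close>

text \<open>Fubini, justified by a Young type estimate: by translation invariance the integral of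
  |\<open>\<kappa> (t - s)\<close>| over t is at most the L^1 norm of \<open>\<kappa>\<close>,
  whatever s is, and \<open>b\<close> is bounded. The second claim keeps the constants, since later
  they depend on x and must be integrated.\<close>

lemma convolution_duality:
  fixes \<kappa> a b :: "real \<Rightarrow> real"
  assumes I: "I \<in> sets borel" and k: "integrable lborel \<kappa>" and a: "integrable (leb I) a"
    and b: "b \<in> borel_measurable (leb I)" and B: "AE t in leb I. \<bar>b t\<bar> \<le> B"
  shows "(LINT t|leb I. (LINT s|leb I. \<kappa> (t - s) * a s) * b t) = (LINT s|leb I. a s * (LINT t|leb I. \<kappa> (t - s) * b t))"
    and "(\<integral>\<^sup>+t. ennreal \<bar>(LINT s|leb I. \<kappa> (t - s) * a s) * b t\<bar> \<partial>leb I)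
      \<le> ennreal B * (\<integral>\<^sup>+r. ennreal \<bar>\<kappa> r\<bar> \<partial>lborel) * (\<integral>\<^sup>+s. ennreal \<bar>a s\<bar> \<partial>leb I)"
proof -
  let ?N = "leb I"
  interpret N: sigma_finite_measure ?N
    using I by (intro sigma_finite_measure_restrict_space sigma_finite_lborel) auto
  interpret NN: pair_sigma_finite ?N ?N ..
  have [measurable]: "\<kappa> \<in> borel_measurable borel" "a \<in> borel_measurable ?N" "b \<in> borel_measurable ?N"
    using k a b by auto
  have sub[measurable]: "(\<lambda>z. fst z - snd z) \<in> ?N \<Otimes>\<^sub>M ?N \<rightarrow>\<^sub>M (borel :: real measure)"
  proof -
    have [measurable]: "(\<lambda>x. x) \<in> ?N \<rightarrow>\<^sub>M (borel :: real measure)" by (intro measurable_restrict_space1) simp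
    have "(\<lambda>z. (\<lambda>x. x) (fst z) - (\<lambda>x. x) (snd z)) \<in> ?N \<Otimes>\<^sub>M ?N \<rightarrow>\<^sub>M (borel :: real measure)"
      by (intro borel_measurable_diff measurable_compose[OF measurable_fst] measurable_compose[OF measurable_snd]) measurable
    then show ?thesis by simp
  qed
  have km[measurable]: "(\<lambda>z. \<kappa> (fst z - snd z)) \<in> borel_measurable (?N \<Otimes>\<^sub>M ?N)"
    by (rule measurable_compose[OF sub]) simp
  let ?F = "\<lambda>(t, s). \<kappa> (t - s) * a s * b t"
  have Fm[measurable]: "?F \<in> borel_measurable (?N \<Otimes>\<^sub>M ?N)" unfolding case_prod_beta by measurable
  have kap: "(\<integral>\<^sup>+t. ennreal \<bar>\<kappa> (t - s)\<bar> \<partial>?N) \<le> (\<integral>\<^sup>+r. ennreal \<bar>\<kappa> r\<bar> \<partial>lborel)" for s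
  proof -
    have "(\<integral>\<^sup>+t. ennreal \<bar>\<kappa> (t - s)\<bar> \<partial>?N) \<le> (\<integral>\<^sup>+t. ennreal \<bar>\<kappa> (t - s)\<bar> \<partial>lborel)"
      using I by (subst nn_integral_restrict_space) (auto intro!: nn_integral_mono simp: indicator_def)
    also have "\<dots> = (\<integral>\<^sup>+r. ennreal \<bar>\<kappa> r\<bar> \<partial>distr lborel borel ((+) (- s)))"
      by (subst nn_integral_distr) auto
    finally show ?thesis by (simp add: lborel_distr_plus)
  qed
  have bound: "(\<integral>\<^sup>+t. (\<integral>\<^sup>+s. ennreal \<bar>\<kappa> (t - s) * a s * b t\<bar> \<partial>?N) \<partial>?N)
     \<le> ennreal B * (\<integral>\<^sup>+r. ennreal \<bar>\<kappa> r\<bar> \<partial>lborel) * (\<integral>\<^sup>+s. ennreal \<bar>a s\<bar> \<partial>?N)"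
  proof -
    have "(\<lambda>(t, s). ennreal \<bar>\<kappa> (t - s) * a s * b t\<bar>) \<in> borel_measurable (?N \<Otimes>\<^sub>M ?N)"
      using Fm unfolding case_prod_beta by measurable
    from NN.Fubini'[OF this]
    have "(\<integral>\<^sup>+t. (\<integral>\<^sup>+s. ennreal \<bar>\<kappa> (t - s) * a s * b t\<bar> \<partial>?N) \<partial>?N)
      = (\<integral>\<^sup>+s. (\<integral>\<^sup>+t. ennreal \<bar>\<kappa> (t - s) * a s * b t\<bar> \<partial>?N) \<partial>?N)" by simp
    also have "\<dots> \<le> (\<integral>\<^sup>+s. (\<integral>\<^sup>+t. ennreal B * ennreal \<bar>a s\<bar> * ennreal \<bar>\<kappa> (t - s)\<bar> \<partial>?N) \<partial>?N)"
    proof (rule nn_integral_mono)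
      fix s
      have "AE t in ?N. ennreal \<bar>\<kappa> (t - s) * a s * b t\<bar> \<le> ennreal B * ennreal \<bar>a s\<bar> * ennreal \<bar>\<kappa> (t - s)\<bar>"
        using B
      proof eventually_elim
        case (elim t)
        then have "0 \<le> B" by linarith
        have "\<bar>\<kappa> (t - s) * a s * b t\<bar> \<le> B * \<bar>a s\<bar> * \<bar>\<kappa> (t - s)\<bar>"
          using mult_left_mono[OF elim, of "\<bar>\<kappa> (t - s)\<bar> * \<bar>a s\<bar>"] by (simp add: abs_mult mult_ac)
        then have "ennreal \<bar>\<kappa> (t - s) * a s * b t\<bar> \<le> ennreal (B * \<bar>a s\<bar> * \<bar>\<kappa> (t - s)\<bar>)" by (rule ennreal_leI)
        then show ?case using \<open>0 \<le> B\<close> by (simp add: ennreal_mult)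
      qed
      then show "(\<integral>\<^sup>+t. ennreal \<bar>\<kappa> (t - s) * a s * b t\<bar> \<partial>?N) \<le> (\<integral>\<^sup>+t. ennreal B * ennreal \<bar>a s\<bar> * ennreal \<bar>\<kappa> (t - s)\<bar> \<partial>?N)"
        by (rule nn_integral_mono_AE)
    qed
    also have "\<dots> = (\<integral>\<^sup>+s. ennreal B * ennreal \<bar>a s\<bar> * (\<integral>\<^sup>+t. ennreal \<bar>\<kappa> (t - s)\<bar> \<partial>?N) \<partial>?N)"
    proof (rule nn_integral_cong)
      fix s
      have "(\<lambda>t. t - s) \<in> ?N \<rightarrow>\<^sub>M borel" by (intro measurable_restrict_space1) simp
      from measurable_compose[OF this, of \<kappa> borel]
      have [measurable]: "(\<lambda>t. \<kappa> (t - s)) \<in> borel_measurable ?N" by simp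
      have "(\<lambda>t. ennreal \<bar>\<kappa> (t - s)\<bar>) \<in> borel_measurable ?N" by measurable
      then show "(\<integral>\<^sup>+t. ennreal B * ennreal \<bar>a s\<bar> * ennreal \<bar>\<kappa> (t - s)\<bar> \<partial>?N)
        = ennreal B * ennreal \<bar>a s\<bar> * (\<integral>\<^sup>+t. ennreal \<bar>\<kappa> (t - s)\<bar> \<partial>?N)" by (rule nn_integral_cmult)
    qed
    also have "\<dots> \<le> (\<integral>\<^sup>+s. ennreal B * ennreal \<bar>a s\<bar> * (\<integral>\<^sup>+r. ennreal \<bar>\<kappa> r\<bar> \<partial>lborel) \<partial>?N)"
      by (intro nn_integral_mono mult_left_mono kap) auto
    also have "\<dots> = ennreal B * (\<integral>\<^sup>+r. ennreal \<bar>\<kappa> r\<bar> \<partial>lborel) * (\<integral>\<^sup>+s. ennreal \<bar>a s\<bar> \<partial>?N)"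
      by (subst nn_integral_multc, simp, subst nn_integral_cmult, simp) (simp add: mult_ac)
    finally show ?thesis .
  qed
  have kfin: "(\<integral>\<^sup>+r. ennreal \<bar>\<kappa> r\<bar> \<partial>lborel) < \<infinity>" and afin: "(\<integral>\<^sup>+s. ennreal \<bar>a s\<bar> \<partial>?N) < \<infinity>"
    using k a by (auto simp: integrable_iff_bounded)
  have Fi: "integrable (?N \<Otimes>\<^sub>M ?N) ?F"
  proof (rule integrableI_bounded[OF Fm])
    have "(\<integral>\<^sup>+z. ennreal (norm (?F z)) \<partial>(?N \<Otimes>\<^sub>M ?N)) = (\<integral>\<^sup>+t. (\<integral>\<^sup>+s. ennreal \<bar>\<kappa> (t - s) * a s * b t\<bar> \<partial>?N) \<partial>?N)"
      by (subst N.nn_integral_fst[symmetric]) (use Fm in \<open>auto simp: case_prod_beta\<close>)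
    also have "\<dots> < \<infinity>" using bound kfin afin
      by (auto intro!: le_less_trans[OF bound] simp: ennreal_mult_less_top)
    finally show "(\<integral>\<^sup>+z. ennreal (norm (?F z)) \<partial>(?N \<Otimes>\<^sub>M ?N)) < \<infinity>" .
  qed
  have "(LINT t|?N. (LINT s|?N. \<kappa> (t - s) * a s) * b t) = (LINT t|?N. (LINT s|?N. \<kappa> (t - s) * a s * b t))" by simp
  also have "\<dots> = (LINT s|?N. (LINT t|?N. \<kappa> (t - s) * a s * b t))"
    using NN.Fubini_integral[OF Fi] by simp
  also have "\<dots> = (LINT s|?N. (LINT t|?N. a s * (\<kappa> (t - s) * b t)))" by (simp add: mult_ac)
  also have "\<dots> = (LINT s|?N. a s * (LINT t|?N. \<kappa> (t - s) * b t))" by simp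
  finally show "(LINT t|leb I. (LINT s|leb I. \<kappa> (t - s) * a s) * b t) = (LINT s|leb I. a s * (LINT t|leb I. \<kappa> (t - s) * b t))" .
  have "(\<integral>\<^sup>+t. ennreal \<bar>(LINT s|leb I. \<kappa> (t - s) * a s) * b t\<bar> \<partial>?N)
     \<le> (\<integral>\<^sup>+t. (\<integral>\<^sup>+s. ennreal \<bar>\<kappa> (t - s) * a s * b t\<bar> \<partial>?N) \<partial>?N)"
  proof (intro nn_integral_mono_AE)
    show "AE t in ?N. ennreal \<bar>(LINT s|leb I. \<kappa> (t - s) * a s) * b t\<bar> \<le> (\<integral>\<^sup>+s. ennreal \<bar>\<kappa> (t - s) * a s * b t\<bar> \<partial>?N)"
      using NN.AE_integrable_fst'[OF Fi]
    proof eventually_elim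
      case (elim t)
      then have "integrable ?N (\<lambda>s. \<kappa> (t - s) * a s * b t)" by simp
      from integral_norm_bound_ennreal[OF this] show ?case by simp
    qed
  qed
  then show "(\<integral>\<^sup>+t. ennreal \<bar>(LINT s|leb I. \<kappa> (t - s) * a s) * b t\<bar> \<partial>leb I)
      \<le> ennreal B * (\<integral>\<^sup>+r. ennreal \<bar>\<kappa> r\<bar> \<partial>lborel) * (\<integral>\<^sup>+s. ennreal \<bar>a s\<bar> \<partial>leb I)"
    using bound by (rule order_trans)
qed

text \<open>The integral runs over the whole interval and the direction of time is in the kernel:
  one supported in (0, T) looks at the past of t, its reflection at the future. Transposing the
  operator is thus replacing \<open>\<kappa> r\<close> by \<open>\<kappa> (- r)\<close>.\<close>

definition volterra :: "real \<Rightarrow> (real \<Rightarrow> real) \<Rightarrow> (real \<Rightarrow> 'a \<Rightarrow> real) \<Rightarrow> real \<Rightarrow> 'a \<Rightarrow> real" where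
  "volterra T \<kappa> v t x = (LINT s|leb {0<..<T}. \<kappa> (t - s) * v s x)"

text \<open>
  Convolution with \<open>heaviside T\<close> is integration from \<open>0\<close> to \<open>t\<close>; the cut-off at \<open>T\<close>, which is
  harmless on \<open>(0,T)\<close>, makes the kernel integrable.
\<close>

definition heaviside :: "real \<Rightarrow> real \<Rightarrow> real" where
  "heaviside T = indicator {0<..<T}"

lemma integrable_heaviside: "integrable lborel (heaviside T)"
  unfolding heaviside_def using emeasure_bounded_finite[of "{0<..<T}"] by (intro integrable_real_indicator) auto

lemma volterra_measurable:
  assumes M: "sigma_finite_measure M" and k[measurable]: "\<kappa> \<in> borel_measurable borel"
    and v: "(\<lambda>(x, t). v t x) \<in> borel_measurable (M \<Otimes>\<^sub>M leb {0<..<T})"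
  shows "(\<lambda>(x, t). volterra T \<kappa> v t x) \<in> borel_measurable (M \<Otimes>\<^sub>M leb {0<..<T})"
proof -
  let ?N = "leb {0<..<T}"
  interpret N: finite_measure ?N by (rule finite_leb) auto
  have id: "(\<lambda>x. x) \<in> ?N \<rightarrow>\<^sub>M (borel :: real measure)" by (intro measurable_restrict_space1) simp
  have p1: "(\<lambda>z. snd (fst z)) \<in> (M \<Otimes>\<^sub>M ?N) \<Otimes>\<^sub>M ?N \<rightarrow>\<^sub>M ?N" by measurable
  have p2: "(\<lambda>z. snd z) \<in> (M \<Otimes>\<^sub>M ?N) \<Otimes>\<^sub>M ?N \<rightarrow>\<^sub>M ?N" by measurable
  have [measurable]: "(\<lambda>z. \<kappa> (snd (fst z) - snd z)) \<in> borel_measurable ((M \<Otimes>\<^sub>M ?N) \<Otimes>\<^sub>M ?N)"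
    by (rule measurable_compose[OF borel_measurable_diff[OF measurable_compose[OF p1 id] measurable_compose[OF p2 id]] k])
  have "(\<lambda>z. (\<lambda>(x, t). v t x) (fst (fst z), snd z)) \<in> borel_measurable ((M \<Otimes>\<^sub>M ?N) \<Otimes>\<^sub>M ?N)"
    by (rule measurable_compose[where N="M \<Otimes>\<^sub>M ?N", OF _ v]) measurable
  then have [measurable]: "(\<lambda>z. v (snd z) (fst (fst z))) \<in> borel_measurable ((M \<Otimes>\<^sub>M ?N) \<Otimes>\<^sub>M ?N)" by simp
  have "(\<lambda>z. LINT s|?N. \<kappa> (snd z - s) * v s (fst z)) \<in> borel_measurable (M \<Otimes>\<^sub>M ?N)"
    by (rule N.borel_measurable_lebesgue_integral) (simp add: case_prod_beta)
  then show ?thesis by (simp add: volterra_def case_prod_beta)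
qed

text \<open>The fundamental theorem of calculus on [s, T], with \<psi>(T) = 0. After a change in the
  order of integration it says that \<open>volterra T (heaviside T) v'\<close> has weak derivative
  \<open>v'\<close>.\<close>

lemma heaviside_test:
  fixes \<psi> :: "real \<Rightarrow> real"
  assumes T: "0 < T" and \<psi>: "\<psi> \<in> test_functions {0<..<T}" and s: "s \<in> {0<..<T}"
  shows "(LINT t|leb {0<..<T}. heaviside T (t - s) * deriv \<psi> t) = - \<psi> s"
proof -
  have "\<psi> T = 0" using \<psi> unfolding test_functions_def by fastforce
  have "continuous_on UNIV (dpartial 1 \<psi>)" by (rule test_function_continuous[OF dpartial_test_function[OF \<psi>]]) simp
  also have "dpartial 1 \<psi> = deriv \<psi>" using test_function_deriv(2)[OF \<psi>] by (simp add: fun_eq_iff)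
  finally have cont: "continuous_on UNIV (deriv \<psi>)" .
  then have [measurable]: "deriv \<psi> \<in> borel_measurable borel" by (rule borel_measurable_continuous_onI)
  have "set_integrable lborel {s..T} (deriv \<psi>)"
    unfolding set_integrable_def using cont by (intro borel_integrable_compact) (auto intro: continuous_on_subset)
  moreover have "(deriv \<psi> has_integral (\<psi> T - \<psi> s)) {s..T}"
    using s by (intro fundamental_theorem_of_calculus)
      (auto intro!: has_field_derivative_at_within[OF test_function_deriv(1)[OF \<psi>]] simp: has_real_derivative_iff_has_vector_derivative[symmetric])
  ultimately have "(LINT t:{s..T}|lborel. deriv \<psi> t) = - \<psi> s"
    using set_borel_integral_eq_integral(2) \<open>\<psi> T = 0\<close> by (metis diff_0 integral_unique)
  moreover have "(LINT t|leb {0<..<T}. heaviside T (t - s) * deriv \<psi> t) = (LINT t:{s<..<T}|lborel. deriv \<psi> t)"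
    unfolding set_lebesgue_integral_def using s
    by (subst integral_restrict_space) (auto intro!: Bochner_Integration.integral_cong simp: indicator_def heaviside_def)
  moreover have "(LINT t:{s<..<T}|lborel. deriv \<psi> t) = (LINT t:{s..T}|lborel. deriv \<psi> t)"
    unfolding set_lebesgue_integral_def
  proof (rule integral_cong_AE)
    show "AE t in lborel. indicat_real {s<..<T} t *\<^sub>R deriv \<psi> t = indicat_real {s..T} t *\<^sub>R deriv \<psi> t"
      using AE_lborel_singleton[of s] AE_lborel_singleton[of T] by eventually_elim (auto simp: indicator_def)
  qed simp_all
  ultimately show ?thesis by simp
qed

section \<open>Recovering a curve from its weak time derivative\<close>

lemma box_Pair: "box (a, s) (b, r) = box a b \<times> box s r"
  for a b :: "'a::euclidean_space" and s r :: "'b::euclidean_space"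
  by (force simp: box_def Basis_prod_def)

text \<open>The exceptional set of x depends on \<psi>, and there are uncountably many \<psi>, so
  the fundamental lemma cannot be applied for fixed x. Multiplying by the indicator of a box in x
  and integrating over x removes the exceptional sets and leaves integrals over product
  boxes.\<close>

lemma AE_zero_if_tested_in_time:
  fixes S :: "'a::euclidean_space set" and T :: real and g :: "'a \<times> real \<Rightarrow> real"
  assumes S: "open S" and g: "integrable (leb S \<Otimes>\<^sub>M leb {0<..<T}) g"
    and z: "\<And>\<psi>. \<psi> \<in> test_functions {0<..<T} \<Longrightarrow> AE x in leb S. (LINT t|leb {0<..<T}. \<psi> t * g (x, t)) = 0"
  shows "AE z in leb S \<Otimes>\<^sub>M leb {0<..<T}. g z = 0"
proof -
  let ?I = "{0<..<T}" and ?M = "leb S" and ?N = "leb {0<..<T}"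
  interpret M: sigma_finite_measure ?M
    using S by (intro sigma_finite_measure_restrict_space sigma_finite_lborel) auto
  interpret N: finite_measure ?N by (rule finite_leb) auto
  interpret MN: pair_sigma_finite ?M ?N ..
  have MN: "?M \<Otimes>\<^sub>M ?N = leb (S \<times> ?I)" using S by (intro leb_Times[symmetric]) auto
  have SI: "open (S \<times> ?I)" using S by (intro open_Times) auto
  then have SIm: "S \<times> ?I \<inter> space lborel \<in> sets lborel" by simp
  have gm[measurable]: "g \<in> borel_measurable (?M \<Otimes>\<^sub>M ?N)" using g by simp
  have gi: "integrable lborel (\<lambda>z. indicator (S \<times> ?I) z *\<^sub>R g z)"
    using g unfolding MN integrable_restrict_space[OF SIm] .
  have loc: "loc_integrable (S \<times> ?I) g"
    unfolding loc_integrable_def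
  proof (intro conjI allI impI)
    show "g \<in> borel_measurable (leb (S \<times> ?I))" using g unfolding MN by simp
    fix K assume K: "compact K \<and> K \<subseteq> S \<times> ?I"
    have "integrable lborel (\<lambda>z. indicator K z *\<^sub>R (indicator (S \<times> ?I) z *\<^sub>R g z))"
      using K by (intro integrable_mult_indicator gi) (simp add: compact_imp_closed)
    also have "(\<lambda>z. indicator K z *\<^sub>R (indicator (S \<times> ?I) z *\<^sub>R g z)) = (\<lambda>z. indicator K z *\<^sub>R g z)"
      using K by (auto simp: fun_eq_iff indicator_def)
    finally show "set_integrable lborel K g" unfolding set_integrable_def .
  qed
  have "AE z in leb (S \<times> ?I). g z = 0"
  proof (rule AE_zero_if_inner_box_integrals_zero[OF SI loc])
    fix p q :: "'a \<times> real" assume sub: "cbox p q \<subseteq> S \<times> ?I"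
    obtain a s b r where pq: "p = (a, s)" "q = (b, r)" by (cases p, cases q)
    show "set_lebesgue_integral lborel (box p q) g = 0"
    proof (cases "cbox p q = {}")
      case True
      then have "box p q = {}" using box_subset_cbox[of p q] by auto
      then show ?thesis by (simp add: set_lebesgue_integral_def)
    next
      case False
      then have sr: "cbox s r \<subseteq> ?I" using sub unfolding pq cbox_Pair_eq by blast
      have bi: "indicat_real (box p q) z = indicator (box a b) (fst z) * indicator (box s r) (snd z)" for z
        unfolding pq box_Pair by (cases z) (auto simp: indicator_def)
      have e0: "set_lebesgue_integral lborel (box p q) g
        = (LINT z|(?M \<Otimes>\<^sub>M ?N). indicator (box a b) (fst z) * indicator (box s r) (snd z) * g z)"
      proof -
        have "set_lebesgue_integral lborel (box p q) g
          = (LINT z|lborel. indicator (S \<times> ?I) z *\<^sub>R (indicator (box p q) z * g z))"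
          unfolding set_lebesgue_integral_def using sub box_subset_cbox[of p q]
          by (intro Bochner_Integration.integral_cong) (auto simp: indicator_def)
        also have "\<dots> = (LINT z|(?M \<Otimes>\<^sub>M ?N). indicator (box p q) z * g z)"
          unfolding MN integral_restrict_space[OF SIm] ..
        finally show ?thesis unfolding bi .
      qed
      \<comment> \<open>Only the time factor has to be a test function; the indicator in x stays as
        it is.\<close>
      let ?F = "\<lambda>n z. indicator (box a b) (fst z) * box_bump s r n (snd z) * g z"
      have fsm[measurable]: "(\<lambda>z. indicat_real (box a b) (fst z)) \<in> borel_measurable (?M \<Otimes>\<^sub>M ?N)"
        by (intro measurable_compose[OF measurable_fst measurable_restrict_space1]) simp
      have snm[measurable]: "(\<lambda>z. indicat_real (box s r) (snd z)) \<in> borel_measurable (?M \<Otimes>\<^sub>M ?N)"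
        by (intro measurable_compose[OF measurable_snd measurable_restrict_space1]) simp
      have bbm[measurable]: "(\<lambda>z. box_bump s r n (snd z)) \<in> borel_measurable (?M \<Otimes>\<^sub>M ?N)" for n
        using box_bump_measurable[of s r n] by (intro measurable_compose[OF measurable_snd measurable_restrict_space1]) simp
      have bnd: "norm (?F n z) \<le> \<bar>g z\<bar>" for n z
        using box_bump_bounds[of s r n "snd z"] by (auto simp: abs_mult indicator_def intro!: mult_left_le_one_le)
      have Fi: "integrable (?M \<Otimes>\<^sub>M ?N) (?F n)" for n
      proof (rule Bochner_Integration.integrable_bound[OF g])
        show "AE z in ?M \<Otimes>\<^sub>M ?N. norm (?F n z) \<le> norm (g z)"
          unfolding real_norm_def[of "g _"] by (intro AE_I2 bnd)
      qed measurable
      have F0: "(LINT z|(?M \<Otimes>\<^sub>M ?N). ?F n z) = 0" for n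
      proof -
        have "(LINT z|(?M \<Otimes>\<^sub>M ?N). ?F n z) = (LINT x|?M. LINT t|?N. ?F n (x, t))"
          by (rule MN.integral_fst'[OF Fi, symmetric])
        also have "\<dots> = (LINT x|?M. indicator (box a b) x * (LINT t|?N. box_bump s r n t * g (x, t)))"
          by (simp add: mult.assoc)
        also have "\<dots> = (LINT x|?M. 0)"
        proof (rule integral_cong_AE)
          have m1: "(\<lambda>x. LINT t|?N. box_bump s r n t * g (x, t)) \<in> borel_measurable ?M"
            by (rule N.borel_measurable_lebesgue_integral) (use gm bbm[of n] in \<open>simp add: case_prod_beta\<close>)
          show "(\<lambda>x. indicator (box a b) x * (LINT t|?N. box_bump s r n t * g (x, t))) \<in> borel_measurable ?M"
            by (rule borel_measurable_times[OF measurable_restrict_space1 m1]) simp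
          show "AE x in ?M. indicator (box a b) x * (LINT t|?N. box_bump s r n t * g (x, t)) = 0"
            using z[OF box_bump_test_functions[OF sr, of n]] by eventually_elim simp
        qed simp
        finally show ?thesis by simp
      qed
      have "(\<lambda>n. LINT z|(?M \<Otimes>\<^sub>M ?N). ?F n z) \<longlonglongrightarrow> (LINT z|(?M \<Otimes>\<^sub>M ?N). indicator (box a b) (fst z) * indicator (box s r) (snd z) * g z)"
      proof (rule integral_dominated_convergence[where w="\<lambda>z. \<bar>g z\<bar>"])
        show "AE z in ?M \<Otimes>\<^sub>M ?N. (\<lambda>n. ?F n z) \<longlonglongrightarrow> indicator (box a b) (fst z) * indicator (box s r) (snd z) * g z"
          by (intro AE_I2 tendsto_mult tendsto_const box_bump_limit)
        show "AE z in ?M \<Otimes>\<^sub>M ?N. norm (?F n z) \<le> \<bar>g z\<bar>" for n using bnd by (intro AE_I2)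
        show "integrable (?M \<Otimes>\<^sub>M ?N) (\<lambda>z. \<bar>g z\<bar>)" using g by simp
      qed measurable
      then show ?thesis by (simp add: e0 F0 LIMSEQ_const_iff)
    qed
  qed
  then show ?thesis unfolding MN .
qed

text \<open>The lemma of du Bois-Reymond with x as a parameter: after subtraction of the primitive
  \<open>P\<close> of \<open>v'\<close>, the rest \<open>V\<close> has weak time derivative 0 and is
  therefore independent of time.\<close>

lemma time_primitive:
  fixes S :: "'a::euclidean_space set"
  assumes S: "open S" and T: "0 < T"
    and v: "integrable (leb S \<Otimes>\<^sub>M leb {0<..<T}) (\<lambda>(x, t). v t x)"
    and v': "integrable (leb S \<Otimes>\<^sub>M leb {0<..<T}) (\<lambda>(x, t). v' t x)"
    and tv: "time_deriv T S v v'"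
  obtains c where "c \<in> borel_measurable (leb S)"
    "AE z in leb S \<Otimes>\<^sub>M leb {0<..<T}. v (snd z) (fst z) = c (fst z) + volterra T (heaviside T) v' (snd z) (fst z)"
proof -
  let ?I = "{0<..<T}" and ?M = "leb S" and ?N = "leb {0<..<T}"
  interpret M: sigma_finite_measure ?M
    using S by (intro sigma_finite_measure_restrict_space sigma_finite_lborel) auto
  interpret N: finite_measure ?N by (rule finite_leb) auto
  interpret MN: pair_sigma_finite ?M ?N ..
  define P where "P t x = volterra T (heaviside T) v' t x" for t x
  define V where "V t x = v t x - P t x" for t x
  have hm[measurable]: "heaviside T \<in> borel_measurable borel" by (simp add: heaviside_def)
  have Pm: "(\<lambda>(x, t). P t x) \<in> borel_measurable (?M \<Otimes>\<^sub>M ?N)"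
    unfolding P_def using v' by (intro volterra_measurable M.sigma_finite_measure_axioms hm) auto
  have Pi: "integrable (?M \<Otimes>\<^sub>M ?N) (\<lambda>(x, t). P t x)"
  proof (rule integrableI_bounded[OF Pm])
    have "(\<integral>\<^sup>+z. ennreal (norm ((\<lambda>(x, t). P t x) z)) \<partial>(?M \<Otimes>\<^sub>M ?N)) = (\<integral>\<^sup>+x. (\<integral>\<^sup>+t. ennreal \<bar>P t x\<bar> \<partial>?N) \<partial>?M)"
      by (subst N.nn_integral_fst[symmetric]) (use Pm in \<open>auto simp: case_prod_beta\<close>)
    also have "\<dots> \<le> (\<integral>\<^sup>+x. (\<integral>\<^sup>+s. ennreal \<bar>v' s x\<bar> \<partial>?N) * emeasure ?N (space ?N) \<partial>?M)"
    proof (rule nn_integral_mono_AE)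
      have "AE x in ?M. integrable ?N (\<lambda>s. v' s x)" using MN.AE_integrable_fst'[OF v'] by simp
      then show "AE x in ?M. (\<integral>\<^sup>+t. ennreal \<bar>P t x\<bar> \<partial>?N) \<le> (\<integral>\<^sup>+s. ennreal \<bar>v' s x\<bar> \<partial>?N) * emeasure ?N (space ?N)"
      proof eventually_elim
        case (elim x)
        have "ennreal \<bar>P t x\<bar> \<le> (\<integral>\<^sup>+s. ennreal \<bar>v' s x\<bar> \<partial>?N)" for t
        proof (cases "integrable ?N (\<lambda>s. heaviside T (t - s) * v' s x)")
          case True
          have "ennreal \<bar>P t x\<bar> \<le> (\<integral>\<^sup>+s. ennreal (norm (heaviside T (t - s) * v' s x)) \<partial>?N)"
            using integral_norm_bound_ennreal[OF True] by (simp add: P_def volterra_def)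
          also have "\<dots> \<le> (\<integral>\<^sup>+s. ennreal \<bar>v' s x\<bar> \<partial>?N)"
            by (intro nn_integral_mono ennreal_leI) (auto simp: heaviside_def indicator_def)
          finally show ?thesis .
        next
          \<comment> \<open>The integral of a function that is not integrable is 0 by convention, so
            the bound holds here too.\<close>
          case False
          then show ?thesis by (simp add: P_def volterra_def not_integrable_integral_eq)
        qed
        then have "(\<integral>\<^sup>+t. ennreal \<bar>P t x\<bar> \<partial>?N) \<le> (\<integral>\<^sup>+t. (\<integral>\<^sup>+s. ennreal \<bar>v' s x\<bar> \<partial>?N) \<partial>?N)"
          by (rule nn_integral_mono)
        then show ?case by (simp only: nn_integral_const)
      qed
    qed
    also have "\<dots> = (\<integral>\<^sup>+x. (\<integral>\<^sup>+s. ennreal \<bar>v' s x\<bar> \<partial>?N) \<partial>?M) * emeasure ?N (space ?N)"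
      using v' by (intro nn_integral_multc N.borel_measurable_nn_integral) auto
    also have "(\<integral>\<^sup>+x. (\<integral>\<^sup>+s. ennreal \<bar>v' s x\<bar> \<partial>?N) \<partial>?M) = (\<integral>\<^sup>+z. ennreal (norm ((\<lambda>(x, t). v' t x) z)) \<partial>(?M \<Otimes>\<^sub>M ?N))"
      by (subst N.nn_integral_fst[symmetric]) (use v' in \<open>auto simp: case_prod_beta\<close>)
    also have "\<dots> * emeasure ?N (space ?N) < \<infinity>"
      using v' by (auto simp: integrable_iff_bounded ennreal_mult_eq_top_iff less_top[symmetric])
    finally show "(\<integral>\<^sup>+z. ennreal (norm ((\<lambda>(x, t). P t x) z)) \<partial>(?M \<Otimes>\<^sub>M ?N)) < \<infinity>" .
  qed
  have Vi: "integrable (?M \<Otimes>\<^sub>M ?N) (\<lambda>(x, t). V t x)"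
    using Bochner_Integration.integrable_diff[OF v Pi] by (simp add: V_def case_prod_unfold)
  have test_int: "integrable ?N (\<lambda>t. \<psi> t * f t)" if t: "\<psi> \<in> test_functions ?I" and f: "integrable ?N f" for \<psi> f
  proof -
    obtain B where B: "B \<ge> 0" "\<And>x. \<bar>\<psi> x\<bar> \<le> B" by (rule test_function_bounded[OF t]) blast
    have m: "\<psi> \<in> borel_measurable ?N" using test_function_measurable[OF t] by (intro measurable_restrict_space1) simp
    show ?thesis
      by (rule Bochner_Integration.integrable_bound[OF integrable_mult_right[OF f, of B]])
         (use m f B in \<open>auto simp: abs_mult intro!: mult_right_mono\<close>)
  qed
  have ae_v: "AE x in ?M. integrable ?N (\<lambda>t. v t x)" using MN.AE_integrable_fst'[OF v] by simp
  have ae_v': "AE x in ?M. integrable ?N (\<lambda>t. v' t x)" using MN.AE_integrable_fst'[OF v'] by simp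
  have ae_P: "AE x in ?M. integrable ?N (\<lambda>t. P t x)" using MN.AE_integrable_fst'[OF Pi] by simp
  have dV: "AE x in ?M. (LINT t|?N. deriv \<psi> t * V t x) = 0" if \<psi>: "\<psi> \<in> test_functions ?I" for \<psi>
  proof -
    have "dpartial 1 \<psi> \<in> test_functions ?I" by (rule dpartial_test_function[OF \<psi>]) simp
    also have "dpartial 1 \<psi> = deriv \<psi>" using test_function_deriv(2)[OF \<psi>] by (simp add: fun_eq_iff)
    finally have d\<psi>: "deriv \<psi> \<in> test_functions ?I" .
    obtain B where B: "B \<ge> 0" "\<And>x. \<bar>deriv \<psi> x\<bar> \<le> B" by (rule test_function_bounded[OF d\<psi>]) blast
    have m: "deriv \<psi> \<in> borel_measurable ?N" using test_function_measurable[OF d\<psi>] by (intro measurable_restrict_space1) simp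
    have "AE x in ?M. (LINT t|?N. deriv \<psi> t * v t x) = - (LINT t|?N. \<psi> t * v' t x)"
      using tv \<psi> by (simp add: time_deriv_def)
    then show ?thesis using ae_v ae_v' ae_P
    proof eventually_elim
      case (elim x)
      have "(LINT t|?N. P t x * deriv \<psi> t) = (LINT s|?N. v' s x * (LINT t|?N. heaviside T (t - s) * deriv \<psi> t))"
        unfolding P_def volterra_def
        by (rule convolution_duality(1)[OF _ integrable_heaviside elim(3) m, of B]) (use B in auto)
      also have "\<dots> = (LINT s|?N. v' s x * (- \<psi> s))"
        by (intro Bochner_Integration.integral_cong refl) (simp add: heaviside_test[OF T \<psi>])
      also have "\<dots> = - (LINT t|?N. \<psi> t * v' t x)" by (simp add: mult.commute)
      finally have "(LINT t|?N. deriv \<psi> t * P t x) = - (LINT t|?N. \<psi> t * v' t x)" by (simp add: mult.commute)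
      then show ?case
        using elim(1) test_int[OF d\<psi> elim(2)] test_int[OF d\<psi> elim(4)] by (simp add: V_def right_diff_distrib)
    qed
  qed
  \<comment> \<open>Subtracting a multiple of a fixed bump makes every test function the derivative of one.\<close>
  define \<xi> where "\<xi> = box_bump (T/3) (2*T/3) 0"
  have \<xi>: "\<xi> \<in> test_functions ?I" unfolding \<xi>_def using T by (intro box_bump_test_functions) auto
  define m where "m = (LINT t|?N. \<xi> t)"
  have m0: "m \<noteq> 0"
  proof
    assume "m = 0"
    have "AE t in ?N. \<xi> t = 0"
    proof (rule integral_nonneg_eq_0_iff_AE[THEN iffD1])
      show "integrable ?N \<xi>" using test_int[OF \<xi>, of "\<lambda>_. 1"] by simp
      show "integral\<^sup>L ?N \<xi> = 0" using \<open>m = 0\<close> by (simp add: m_def)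
      show "AE t in ?N. 0 \<le> \<xi> t" by (simp add: \<xi>_def box_bump_bounds)
    qed
    then have "AE t in lborel. t \<in> ?I \<longrightarrow> \<xi> t = 0" by (simp add: AE_restrict_space_iff)
    then have "AE t in lborel. t \<notin> {T/3<..<2*T/3}"
    proof eventually_elim
      case (elim t)
      have "\<xi> t \<noteq> 0" if "t \<in> {T/3<..<2*T/3}" using that by (simp add: \<xi>_def box_bump_def bump_def)
      moreover have "t \<in> ?I" if "t \<in> {T/3<..<2*T/3}" using that T by auto
      ultimately show ?case using elim by blast
    qed
    then have "{T/3<..<2*T/3} \<in> null_sets lborel" by (simp add: AE_iff_null_sets)
    then show False using T by (simp add: null_sets_def)
  qed
  \<comment> \<open>If \<open>V\<close> does not depend on time, its value is forced to be its
    average against \<open>\<xi>\<close>.\<close>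
  define c where "c x = (LINT t|?N. \<xi> t * V t x) / m" for x
  have cm[measurable]: "c \<in> borel_measurable ?M"
  proof -
    have "(\<lambda>z. \<xi> (snd z) * (\<lambda>(x, t). V t x) z) \<in> borel_measurable (?M \<Otimes>\<^sub>M ?N)"
      using Vi test_function_measurable[OF \<xi>]
      by (intro borel_measurable_times measurable_compose[OF measurable_snd measurable_restrict_space1]) auto
    then have "(\<lambda>x. LINT t|?N. \<xi> t * V t x) \<in> borel_measurable ?M"
      by (intro N.borel_measurable_lebesgue_integral) (simp add: case_prod_beta)
    then show ?thesis unfolding c_def by simp
  qed
  have ae_V: "AE x in ?M. integrable ?N (\<lambda>t. V t x)" using MN.AE_integrable_fst'[OF Vi] by simp
  have zero: "AE x in ?M. (LINT t|?N. \<psi> t * (V t x - c x)) = 0" if \<psi>: "\<psi> \<in> test_functions ?I" for \<psi>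
  proof -
    define k where "k = (LINT t|?N. \<psi> t) / m"
    have \<theta>: "(\<lambda>t. \<psi> t - k * \<xi> t) \<in> test_functions ?I" by (rule test_functions_diff_cmult[OF \<psi> \<xi>])
    have i1: "integrable ?N \<psi>" "integrable ?N \<xi>"
      using test_int[OF \<psi>, of "\<lambda>_. 1"] test_int[OF \<xi>, of "\<lambda>_. 1"] by auto
    have "(LINT t|?N. \<psi> t - k * \<xi> t) = 0" using i1 m0 by (simp add: k_def m_def[symmetric])
    then obtain \<Theta> where \<Theta>: "\<Theta> \<in> test_functions ?I" "deriv \<Theta> = (\<lambda>t. \<psi> t - k * \<xi> t)"
      by (rule test_function_primitive[OF T \<theta>])
    show ?thesis using dV[OF \<Theta>(1)] ae_V unfolding \<Theta>(2)
    proof eventually_elim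
      case (elim x)
      have "(LINT t|?N. \<psi> t * V t x) = k * (LINT t|?N. \<xi> t * V t x)"
        using elim(1) test_int[OF \<psi> elim(2)] test_int[OF \<xi> elim(2)] by (simp add: left_diff_distrib mult.assoc)
      also have "\<dots> = (LINT t|?N. \<psi> t) * c x" by (simp add: k_def c_def)
      finally show ?case using test_int[OF \<psi> elim(2)] i1 by (simp add: right_diff_distrib)
    qed
  qed
  have ci: "integrable ?M c"
  proof -
    have "integrable (?M \<Otimes>\<^sub>M ?N) (\<lambda>z. \<xi> (snd z) * (\<lambda>(x, t). V t x) z)"
    proof (rule Bochner_Integration.integrable_bound[OF Vi])
      show "(\<lambda>z. \<xi> (snd z) * (\<lambda>(x, t). V t x) z) \<in> borel_measurable (?M \<Otimes>\<^sub>M ?N)"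
        using Vi test_function_measurable[OF \<xi>]
        by (intro borel_measurable_times measurable_compose[OF measurable_snd measurable_restrict_space1]) auto
      show "AE z in ?M \<Otimes>\<^sub>M ?N. norm (\<xi> (snd z) * (\<lambda>(x, t). V t x) z) \<le> norm ((\<lambda>(x, t). V t x) z)"
        using box_bump_bounds[of "T/3" "2*T/3" 0] unfolding \<xi>_def
        by (intro AE_I2) (auto simp: abs_mult intro!: mult_left_le_one_le)
    qed
    from MN.integrable_fst'[OF this] show ?thesis unfolding c_def by simp
  qed
  have cI: "integrable (?M \<Otimes>\<^sub>M ?N) (\<lambda>z. c (fst z))"
  proof (rule integrableI_bounded)
    have "(\<integral>\<^sup>+z. ennreal (norm (c (fst z))) \<partial>(?M \<Otimes>\<^sub>M ?N)) = (\<integral>\<^sup>+x. ennreal (norm (c x)) * emeasure ?N (space ?N) \<partial>?M)"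
      by (subst N.nn_integral_fst[symmetric]) (simp_all only: fst_conv nn_integral_const, measurable)
    also have "\<dots> = (\<integral>\<^sup>+x. ennreal (norm (c x)) \<partial>?M) * emeasure ?N (space ?N)"
      by (rule nn_integral_multc) simp
    also have "\<dots> < \<infinity>"
      using ci by (auto simp: integrable_iff_bounded ennreal_mult_less_top less_top[symmetric] ennreal_mult_eq_top_iff)
    finally show "(\<integral>\<^sup>+z. ennreal (norm (c (fst z))) \<partial>(?M \<Otimes>\<^sub>M ?N)) < \<infinity>" .
  qed measurable
  have "integrable (?M \<Otimes>\<^sub>M ?N) (\<lambda>z. V (snd z) (fst z) - c (fst z))"
    using Vi cI by (intro Bochner_Integration.integrable_diff) (simp_all add: case_prod_unfold)
  then have "AE z in ?M \<Otimes>\<^sub>M ?N. V (snd z) (fst z) - c (fst z) = 0"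
    using zero by (intro AE_zero_if_tested_in_time[OF S]) auto
  then have "AE z in ?M \<Otimes>\<^sub>M ?N. v (snd z) (fst z) = c (fst z) + volterra T (heaviside T) v' (snd z) (fst z)"
    by eventually_elim (simp add: V_def P_def)
  with cm show ?thesis by (rule that)
qed

section \<open>Values of curves at the end points of the time interval\<close>

lemma (in pair_sigma_finite) AE_pair_swap:
  assumes "AE z in M1 \<Otimes>\<^sub>M M2. Q (fst z) (snd z)"
  shows "AE y in M2. AE x in M1. Q x y"
proof -
  interpret Q: pair_sigma_finite M2 M1 ..
  have "AE z in distr (M2 \<Otimes>\<^sub>M M1) (M1 \<Otimes>\<^sub>M M2) (\<lambda>(x, y). (y, x)). Q (fst z) (snd z)"
    using assms by (simp only: distr_pair_swap[symmetric])
  then have "AE z in M2 \<Otimes>\<^sub>M M1. Q (snd z) (fst z)"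
    by (auto dest!: AE_distrD[OF measurable_pair_swap'] simp: case_prod_unfold)
  from Q.AE_pair[OF this] show ?thesis by simp
qed

text \<open>On a finite measure space \<open>a \<le> 1 + a^2\<close> passes from the square of the
  time integral to the time integral itself.\<close>

lemma L2_of_L1_integrable:
  assumes M: "finite_measure M" and N: "sigma_finite_measure N" and u: "L2_of_L1 M N u"
  shows "integrable (M \<Otimes>\<^sub>M N) (\<lambda>(x, t). u t x)"
proof -
  interpret M: finite_measure M by fact
  interpret N: sigma_finite_measure N by fact
  have um: "(\<lambda>(x, t). u t x) \<in> borel_measurable (M \<Otimes>\<^sub>M N)" using u by (simp add: L2_of_L1_def)
  then have um': "(\<lambda>z. u (snd z) (fst z)) \<in> borel_measurable (M \<Otimes>\<^sub>M N)" by (simp add: case_prod_unfold)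
  have Am: "(\<lambda>x. \<integral>\<^sup>+t. ennreal \<bar>u t x\<bar> \<partial>N) \<in> borel_measurable M"
    using um' by (intro N.borel_measurable_nn_integral) (simp add: case_prod_unfold)
  show ?thesis
  proof (rule integrableI_bounded[OF um])
    have "(\<integral>\<^sup>+z. ennreal (norm ((\<lambda>(x, t). u t x) z)) \<partial>(M \<Otimes>\<^sub>M N)) = (\<integral>\<^sup>+x. (\<integral>\<^sup>+t. ennreal \<bar>u t x\<bar> \<partial>N) \<partial>M)"
      by (subst N.nn_integral_fst[symmetric]) (use um' in \<open>auto simp: case_prod_unfold\<close>)
    also have "\<dots> \<le> (\<integral>\<^sup>+x. 1 + (\<integral>\<^sup>+t. ennreal \<bar>u t x\<bar> \<partial>N)\<^sup>2 \<partial>M)"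
    proof (rule nn_integral_mono)
      fix x
      show "(\<integral>\<^sup>+t. ennreal \<bar>u t x\<bar> \<partial>N) \<le> 1 + (\<integral>\<^sup>+t. ennreal \<bar>u t x\<bar> \<partial>N)\<^sup>2" (is "?a \<le> 1 + ?a\<^sup>2")
      proof (cases "?a \<le> 1")
        case False
        then have "?a * 1 \<le> ?a * ?a" by (intro mult_left_mono) auto
        then show ?thesis by (simp add: power2_eq_square add_increasing)
      qed (simp add: add_increasing2)
    qed
    also have "\<dots> = emeasure M (space M) + (\<integral>\<^sup>+x. (\<integral>\<^sup>+t. ennreal \<bar>u t x\<bar> \<partial>N)\<^sup>2 \<partial>M)"
      using Am by (subst nn_integral_add) auto
    also have "\<dots> < \<infinity>" using u by (simp add: L2_of_L1_def less_top[symmetric])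
    finally show "(\<integral>\<^sup>+z. ennreal (norm ((\<lambda>(x, t). u t x) z)) \<partial>(M \<Otimes>\<^sub>M N)) < \<infinity>" .
  qed
qed

text \<open>Even when \<open>t0\<close> is an end point, its neighbourhood meets (0, T) in an
  interval of positive length. This supplies good times converging to a prescribed one.\<close>

lemma AE_Ioo_approx:
  fixes t0 T :: real
  assumes T: "0 < T" and t0: "t0 \<in> {0..T}" and ae: "AE t in leb {0<..<T}. Q t" and e: "0 < e"
  shows "\<exists>t\<in>{0<..<T}. \<bar>t - t0\<bar> < e \<and> Q t"
proof (rule ccontr)
  assume n: "\<not> ?thesis"
  define A where "A = {max 0 (t0 - e)<..<min T (t0 + e)}"
  have "AE t in lborel. t \<in> {0<..<T} \<longrightarrow> Q t" using ae by (simp add: AE_restrict_space_iff)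
  then have "AE t in lborel. t \<notin> A"
  proof eventually_elim
    case (elim t)
    have "t \<in> {0<..<T} \<and> \<bar>t - t0\<bar> < e" if "t \<in> A" using that by (auto simp: A_def)
    then show ?case using elim n by blast
  qed
  moreover have "A \<in> sets lborel" by (simp add: A_def)
  ultimately have "A \<in> null_sets lborel" by (simp only: AE_iff_null_sets)
  then have "emeasure lborel A = 0" by (rule null_setsD1)
  moreover have lt: "max 0 (t0 - e) < min T (t0 + e)" using T t0 e by auto
  then have "emeasure lborel A = ennreal (min T (t0 + e) - max 0 (t0 - e))"
    unfolding A_def by (intro emeasure_lborel_Ioo less_imp_le)
  ultimately have "ennreal (min T (t0 + e) - max 0 (t0 - e)) = 0" by (simp only:)
  then have "min T (t0 + e) - max 0 (t0 - e) \<le> 0" by (simp only: ennreal_eq_0_iff)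
  then show False using lt by linarith
qed

text \<open>The curve is known only at almost every time, and its trace is that of a continuous
  representative \<open>w\<close>. At good times \<open>\<tau> n\<close> tending to
  \<open>t0\<close> the two descriptions agree; the primitives converge in L^1 over x and so does
  \<open>w (\<tau> n)\<close>, which leaves \<open>c\<close> plus the primitive at \<open>t0\<close>
  with L^1 norm 0.\<close>

lemma time_trace_zero:
  fixes S :: "'a::euclidean_space set"
  assumes S: "open S" "bounded S" and T: "0 < T" and t0: "t0 \<in> {0..T}"
    and v': "integrable (leb S \<Otimes>\<^sub>M leb {0<..<T}) (\<lambda>(x, t). v' t x)"
    and c: "c \<in> borel_measurable (leb S)"
    and vc: "AE z in leb S \<Otimes>\<^sub>M leb {0<..<T}. v (snd z) (fst z) = c (fst z) + volterra T (heaviside T) v' (snd z) (fst z)"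
    and tr: "has_time_trace T S v t0 (\<lambda>x. 0)"
  shows "AE x in leb S. c x + volterra T (heaviside T) v' t0 x = 0"
proof -
  let ?I = "{0<..<T}" and ?M = "leb S" and ?N = "leb {0<..<T}"
  let ?P = "volterra T (heaviside T) v'"
  interpret M: finite_measure ?M using S by (intro finite_leb) auto
  interpret N: finite_measure ?N by (rule finite_leb) auto
  interpret MN: pair_sigma_finite ?M ?N ..
  interpret NM: pair_sigma_finite ?N ?M ..
  have v'm[measurable]: "(\<lambda>z. v' (snd z) (fst z)) \<in> borel_measurable (?M \<Otimes>\<^sub>M ?N)" using v' by (simp add: case_prod_unfold)
  have hm[measurable]: "heaviside T \<in> borel_measurable borel" by (simp add: heaviside_def)
  have hs[measurable]: "(\<lambda>s. heaviside T (t - s)) \<in> borel_measurable ?N" for t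
    by (rule measurable_compose[OF _ hm], intro measurable_restrict_space1) simp
  obtain w where w: "\<And>t. t \<in> {0..T} \<Longrightarrow> w t \<in> Lspace 2 ?M"
      "((\<lambda>s. Lnorm 2 ?M (\<lambda>x. w s x - w t0 x)) \<longlongrightarrow> 0) (at t0 within {0..T})"
      "AE t in ?N. AE x in ?M. v t x = w t x" "AE x in ?M. w t0 x = 0"
    using tr t0 unfolding has_time_trace_def by blast
  have "AE t in ?N. AE x in ?M. v t x = c x + ?P t x" by (rule MN.AE_pair_swap[OF vc])
  with w(3) have good: "AE t in ?N. (AE x in ?M. v t x = w t x) \<and> (AE x in ?M. v t x = c x + ?P t x)"
    by eventually_elim simp
  have "\<forall>n. \<exists>t. t \<in> ?I \<and> \<bar>t - t0\<bar> < 1 / Suc n \<and> (AE x in ?M. v t x = w t x) \<and> (AE x in ?M. v t x = c x + ?P t x)"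
    using AE_Ioo_approx[OF T t0 good] by (metis of_nat_0_less_iff zero_less_Suc zero_less_divide_1_iff)
  from choice[OF this] obtain \<tau> where \<tau>': "\<forall>n. \<tau> n \<in> ?I \<and> \<bar>\<tau> n - t0\<bar> < 1 / Suc n \<and>
    (AE x in ?M. v (\<tau> n) x = w (\<tau> n) x) \<and> (AE x in ?M. v (\<tau> n) x = c x + ?P (\<tau> n) x)" ..
  note \<tau> = \<tau>'[rule_format, THEN conjunct1] \<tau>'[rule_format, THEN conjunct2, THEN conjunct1]
    \<tau>'[rule_format, THEN conjunct2, THEN conjunct2, THEN conjunct1] \<tau>'[rule_format, THEN conjunct2, THEN conjunct2, THEN conjunct2]
  have lim\<tau>: "\<tau> \<longlonglongrightarrow> t0"
  proof (rule LIM_zero_cancel, rule Lim_null_comparison)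
    show "\<forall>\<^sub>F n in sequentially. norm (\<tau> n - t0) \<le> 1 / real (Suc n)" using \<tau>(2) by (simp add: less_imp_le del: of_nat_Suc)
    show "(\<lambda>n. 1 / real (Suc n)) \<longlonglongrightarrow> 0" by (rule LIMSEQ_Suc[OF lim_1_over_n])
  qed
  define n1 where "n1 s = (\<integral>\<^sup>+x. ennreal \<bar>v' s x\<bar> \<partial>?M)" for s
  have sw: "(\<lambda>(s, x). ennreal \<bar>v' s x\<bar>) \<in> borel_measurable (?N \<Otimes>\<^sub>M ?M)"
  proof -
    have "(\<lambda>z. (\<lambda>z. v' (snd z) (fst z)) (snd z, fst z)) \<in> borel_measurable (?N \<Otimes>\<^sub>M ?M)"
      by (rule measurable_compose[OF _ v'm]) measurable
    then have [measurable]: "(\<lambda>z. v' (fst z) (snd z)) \<in> borel_measurable (?N \<Otimes>\<^sub>M ?M)" by simp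
    show ?thesis unfolding case_prod_unfold by measurable
  qed
  have n1m[measurable]: "n1 \<in> borel_measurable ?N" unfolding n1_def by (rule M.borel_measurable_nn_integral[OF sw])
  have n1fin: "(\<integral>\<^sup>+s. n1 s \<partial>?N) < \<infinity>"
  proof -
    have "(\<integral>\<^sup>+s. n1 s \<partial>?N) = (\<integral>\<^sup>+x. (\<integral>\<^sup>+s. ennreal \<bar>v' s x\<bar> \<partial>?N) \<partial>?M)"
      unfolding n1_def using NM.Fubini'[OF sw] by simp
    also have "\<dots> = (\<integral>\<^sup>+z. ennreal (norm ((\<lambda>(x, t). v' t x) z)) \<partial>(?M \<Otimes>\<^sub>M ?N))"
      by (subst N.nn_integral_fst[symmetric]) (use v'm in \<open>auto simp: case_prod_unfold\<close>)
    also have "\<dots> < \<infinity>" using v' by (simp add: integrable_iff_bounded)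
    finally show ?thesis .
  qed
  \<comment> \<open>\<open>a n\<close> bounds the L^1 distance between the primitives at
    \<open>t0\<close> and \<open>\<tau> n\<close>; \<open>b n\<close> bounds that between
    \<open>w (\<tau> n)\<close> and \<open>w t0\<close>, by Cauchy-Schwarz against the constant
    1.\<close>
  define a where "a n = (\<integral>\<^sup>+s. ennreal \<bar>heaviside T (t0 - s) - heaviside T (\<tau> n - s)\<bar> * n1 s \<partial>?N)" for n
  define b where "b n = Lnorm 2 ?M (\<lambda>x. w (\<tau> n) x - w t0 x) * Lnorm 2 ?M (\<lambda>x. 1)" for n
  have one: "(\<lambda>x. 1) \<in> Lspace 2 ?M" by (rule Lspace_2_bounded[OF M.finite_measure_axioms, of _ 1]) auto
  have la: "a \<longlonglongrightarrow> 0"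
  proof -
    have "a \<longlonglongrightarrow> (\<integral>\<^sup>+s. 0 \<partial>?N)"
      unfolding a_def
    proof (rule nn_integral_dominated_convergence[where w=n1])
      show "AE s in ?N. ennreal \<bar>heaviside T (t0 - s) - heaviside T (\<tau> n - s)\<bar> * n1 s \<le> n1 s" for n
      proof (intro AE_I2)
        fix s
        have "ennreal \<bar>heaviside T (t0 - s) - heaviside T (\<tau> n - s)\<bar> \<le> 1"
          by (auto simp: heaviside_def indicator_def)
        from mult_right_mono[OF this, of "n1 s"]
        show "ennreal \<bar>heaviside T (t0 - s) - heaviside T (\<tau> n - s)\<bar> * n1 s \<le> n1 s" by simp
      qed
      \<comment> \<open>Away from the jump at s = \<open>t0\<close> the two values of the kernel
        agree as soon as \<open>\<tau> n\<close> is on the same side of s as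
        \<open>t0\<close>.\<close>
      have "AE s in lborel. s \<in> ?I \<longrightarrow> s \<noteq> t0 \<and> s \<in> ?I" using AE_lborel_singleton[of t0] by eventually_elim simp
      then have "AE s in ?N. s \<noteq> t0 \<and> s \<in> ?I" by (subst AE_restrict_space_iff) auto
      then show "AE s in ?N. (\<lambda>n. ennreal \<bar>heaviside T (t0 - s) - heaviside T (\<tau> n - s)\<bar> * n1 s) \<longlonglongrightarrow> 0"
      proof eventually_elim
        case (elim s)
        have "\<forall>\<^sub>F n in sequentially. heaviside T (\<tau> n - s) = heaviside T (t0 - s)"
        proof (cases "s < t0")
          case True
          have "\<forall>\<^sub>F n in sequentially. s < \<tau> n" using order_tendstoD(1)[OF lim\<tau> True] .
          then show ?thesis
          proof eventually_elim
            case (elim n)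
            then show ?case using True \<tau>(1)[of n] t0 \<open>s \<noteq> t0 \<and> s \<in> ?I\<close> by (simp add: heaviside_def)
          qed
        next
          case False
          then have "t0 < s" using elim by simp
          have "\<forall>\<^sub>F n in sequentially. \<tau> n < s" using order_tendstoD(2)[OF lim\<tau> \<open>t0 < s\<close>] .
          then show ?thesis by eventually_elim (use \<open>t0 < s\<close> in \<open>simp add: heaviside_def\<close>)
        qed
        then have "\<forall>\<^sub>F n in sequentially. ennreal \<bar>heaviside T (t0 - s) - heaviside T (\<tau> n - s)\<bar> * n1 s = 0"
          by eventually_elim simp
        then show ?case by (rule tendsto_eventually)
      qed
    qed (use n1fin in measurable)
    then show ?thesis by simp
  qed
  have lb: "b \<longlonglongrightarrow> 0"
  proof -
    let ?f = "\<lambda>s. Lnorm 2 ?M (\<lambda>x. w s x - w t0 x)"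
    \<comment> \<open>The limit in \<open>w(2)\<close> leaves out \<open>t0\<close> itself, which
      some \<open>\<tau> n\<close> may hit; the value 0 there turns it into continuity.\<close>
    have z: "?f t0 = 0" by (simp add: Lnorm_def)
    have "continuous (at t0 within {0..T}) ?f" unfolding continuous_within z by (rule w(2))
    moreover have "\<forall>\<^sub>F n in sequentially. \<tau> n \<in> {0..T}" using \<tau>(1) by (auto intro!: always_eventually less_imp_le)
    ultimately have "(\<lambda>n. ?f (\<tau> n)) \<longlonglongrightarrow> ?f t0" using lim\<tau> by (rule continuous_within_tendsto_compose)
    then have "(\<lambda>n. Lnorm 2 ?M (\<lambda>x. 1) * ?f (\<tau> n)) \<longlonglongrightarrow> Lnorm 2 ?M (\<lambda>x. 1) * 0"
      unfolding z using one by (intro ennreal_tendsto_cmult) (auto simp: Lspace_def)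
    then show ?thesis by (simp add: b_def[abs_def] mult.commute)
  qed
  have wm: "w t \<in> borel_measurable ?M" if "t \<in> {0..T}" for t using w(1)[OF that] by (simp add: Lspace_2_iff)
  have Pm: "(\<lambda>x. ?P t x) \<in> borel_measurable ?M" for t
    unfolding volterra_def by (rule N.borel_measurable_lebesgue_integral) (simp add: case_prod_unfold)
  have ae_v': "AE x in ?M. integrable ?N (\<lambda>t. v' t x)" using MN.AE_integrable_fst'[OF v'] by simp
  \<comment> \<open>Compare with the value along good times \<open>\<tau> n\<close> converging to \<open>t0\<close>.\<close>
  have X: "(\<integral>\<^sup>+x. ennreal \<bar>c x + ?P t0 x\<bar> \<partial>?M) \<le> a n + b n" for n
  proof -
    have \<tau>0: "\<tau> n \<in> {0..T}" using \<tau>(1)[of n] by auto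
    have "(\<integral>\<^sup>+x. ennreal \<bar>c x + ?P t0 x\<bar> \<partial>?M)
       \<le> (\<integral>\<^sup>+x. (\<integral>\<^sup>+s. ennreal \<bar>heaviside T (t0 - s) - heaviside T (\<tau> n - s)\<bar> * ennreal \<bar>v' s x\<bar> \<partial>?N)
            + ennreal \<bar>w (\<tau> n) x - w t0 x\<bar> * ennreal \<bar>1\<bar> \<partial>?M)"
    proof (rule nn_integral_mono_AE)
      show "AE x in ?M. ennreal \<bar>c x + ?P t0 x\<bar>
         \<le> (\<integral>\<^sup>+s. ennreal \<bar>heaviside T (t0 - s) - heaviside T (\<tau> n - s)\<bar> * ennreal \<bar>v' s x\<bar> \<partial>?N)
            + ennreal \<bar>w (\<tau> n) x - w t0 x\<bar> * ennreal \<bar>1\<bar>"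
        using \<tau>(3)[of n] \<tau>(4)[of n] w(4) ae_v'
      proof eventually_elim
        case (elim x)
        have hi: "integrable ?N (\<lambda>s. heaviside T (t - s) * v' s x)" for t
          by (rule Bochner_Integration.integrable_bound[OF elim(4)])
             (use borel_measurable_times[OF hs borel_measurable_integrable[OF elim(4)]] in \<open>auto simp: heaviside_def indicator_def intro!: AE_I2\<close>)
        have d: "?P t0 x - ?P (\<tau> n) x = (LINT s|?N. (heaviside T (t0 - s) - heaviside T (\<tau> n - s)) * v' s x)"
          unfolding volterra_def using hi by (simp add: left_diff_distrib)
        have "integrable ?N (\<lambda>s. (heaviside T (t0 - s) - heaviside T (\<tau> n - s)) * v' s x)"
          using hi by (simp add: left_diff_distrib)
        from integral_norm_bound_ennreal[OF this]
        have 1: "ennreal \<bar>?P t0 x - ?P (\<tau> n) x\<bar>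
          \<le> (\<integral>\<^sup>+s. ennreal \<bar>heaviside T (t0 - s) - heaviside T (\<tau> n - s)\<bar> * ennreal \<bar>v' s x\<bar> \<partial>?N)"
          unfolding d by (simp add: abs_mult ennreal_mult)
        have "\<bar>c x + ?P t0 x\<bar> \<le> \<bar>?P t0 x - ?P (\<tau> n) x\<bar> + \<bar>w (\<tau> n) x - w t0 x\<bar>" using elim by linarith
        then have "ennreal \<bar>c x + ?P t0 x\<bar> \<le> ennreal (\<bar>?P t0 x - ?P (\<tau> n) x\<bar> + \<bar>w (\<tau> n) x - w t0 x\<bar>)" by (rule ennreal_leI)
        also have "\<dots> = ennreal \<bar>?P t0 x - ?P (\<tau> n) x\<bar> + ennreal \<bar>w (\<tau> n) x - w t0 x\<bar>" by simp
        finally show ?case using 1 by (simp add: add_mono order_trans[OF _ add_right_mono])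
      qed
    qed
    also have "\<dots> = (\<integral>\<^sup>+x. (\<integral>\<^sup>+s. ennreal \<bar>heaviside T (t0 - s) - heaviside T (\<tau> n - s)\<bar> * ennreal \<bar>v' s x\<bar> \<partial>?N) \<partial>?M)
        + (\<integral>\<^sup>+x. ennreal \<bar>w (\<tau> n) x - w t0 x\<bar> * ennreal \<bar>1\<bar> \<partial>?M)"
    proof (rule nn_integral_add)
      have "(\<lambda>z. ennreal \<bar>heaviside T (t0 - snd z) - heaviside T (\<tau> n - snd z)\<bar> * ennreal \<bar>v' (snd z) (fst z)\<bar>)
          \<in> borel_measurable (?M \<Otimes>\<^sub>M ?N)"
        using measurable_compose[OF measurable_snd hs] by measurable
      then show "(\<lambda>x. \<integral>\<^sup>+s. ennreal \<bar>heaviside T (t0 - s) - heaviside T (\<tau> n - s)\<bar> * ennreal \<bar>v' s x\<bar> \<partial>?N) \<in> borel_measurable ?M"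
        by (intro N.borel_measurable_nn_integral) (simp add: case_prod_unfold)
      show "(\<lambda>x. ennreal \<bar>w (\<tau> n) x - w t0 x\<bar> * ennreal \<bar>1\<bar>) \<in> borel_measurable ?M"
        using wm[OF \<tau>0] wm[OF t0] by measurable
    qed
    also have "(\<integral>\<^sup>+x. (\<integral>\<^sup>+s. ennreal \<bar>heaviside T (t0 - s) - heaviside T (\<tau> n - s)\<bar> * ennreal \<bar>v' s x\<bar> \<partial>?N) \<partial>?M) = a n"
    proof -
      have "(\<lambda>(s, x). ennreal \<bar>heaviside T (t0 - s) - heaviside T (\<tau> n - s)\<bar> * ennreal \<bar>v' s x\<bar>) \<in> borel_measurable (?N \<Otimes>\<^sub>M ?M)"
        using measurable_compose[OF measurable_fst hs] sw unfolding case_prod_unfold by measurable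
      from NM.Fubini'[OF this]
      have "(\<integral>\<^sup>+x. (\<integral>\<^sup>+s. ennreal \<bar>heaviside T (t0 - s) - heaviside T (\<tau> n - s)\<bar> * ennreal \<bar>v' s x\<bar> \<partial>?N) \<partial>?M)
        = (\<integral>\<^sup>+s. (\<integral>\<^sup>+x. ennreal \<bar>heaviside T (t0 - s) - heaviside T (\<tau> n - s)\<bar> * ennreal \<bar>v' s x\<bar> \<partial>?M) \<partial>?N)" by simp
      also have "\<dots> = a n"
        unfolding a_def n1_def
      proof (rule nn_integral_cong)
        fix s assume s: "s \<in> space ?N"
        have "(\<lambda>x. ennreal \<bar>v' s x\<bar>) \<in> borel_measurable ?M"
          using measurable_compose[OF measurable_Pair1'[OF s] sw] by simp
        then show "(\<integral>\<^sup>+x. ennreal \<bar>heaviside T (t0 - s) - heaviside T (\<tau> n - s)\<bar> * ennreal \<bar>v' s x\<bar> \<partial>?M)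
          = ennreal \<bar>heaviside T (t0 - s) - heaviside T (\<tau> n - s)\<bar> * (\<integral>\<^sup>+x. ennreal \<bar>v' s x\<bar> \<partial>?M)"
          by (rule nn_integral_cmult)
      qed
      finally show ?thesis .
    qed
    also have "a n + (\<integral>\<^sup>+x. ennreal \<bar>w (\<tau> n) x - w t0 x\<bar> * ennreal \<bar>1\<bar> \<partial>?M) \<le> a n + b n"
      unfolding b_def by (intro add_left_mono Lspace_2_mult(4) Lspace_2_diff w(1) \<tau>0 t0 one)
    finally show ?thesis .
  qed
  have "(\<lambda>n. a n + b n) \<longlonglongrightarrow> 0 + 0" by (intro tendsto_add la lb)
  then have "(\<integral>\<^sup>+x. ennreal \<bar>c x + ?P t0 x\<bar> \<partial>?M) \<le> 0 + 0"
    by (rule LIMSEQ_le_const) (use X in auto)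
  then have 0: "(\<integral>\<^sup>+x. ennreal \<bar>c x + ?P t0 x\<bar> \<partial>?M) = 0" by simp
  have "(\<lambda>x. ennreal \<bar>c x + ?P t0 x\<bar>) \<in> borel_measurable ?M" using c Pm[of t0] by measurable
  then have "AE x in ?M. ennreal \<bar>c x + ?P t0 x\<bar> = 0" using 0 by (rule nn_integral_0_iff_AE[THEN iffD1])
  then show ?thesis by eventually_elim simp
qed

section \<open>The kernel \<open>g_tilde\<close>\<close>

lemma integrable_powr_kernel:
  fixes a T :: real
  assumes a: "a > -1" and T: "0 \<le> T"
  shows "integrable lborel (\<lambda>r. indicator {0<..<T} r * r powr a)"
proof -
  have "(\<lambda>r. r powr a) integrable_on {0..T}" using a T by (rule integrable_on_powr_from_0)
  then have "(\<lambda>r. r powr a) absolutely_integrable_on {0..T}"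
    by (rule nonnegative_absolutely_integrable_1) simp
  then have "integrable lebesgue (\<lambda>r. indicator {0..T} r * r powr a)" by (simp add: set_integrable_def)
  then have i: "integrable lborel (\<lambda>r. indicator {0..T} r * r powr a)"
    by (subst (asm) integrable_completion) auto
  show ?thesis by (rule Bochner_Integration.integrable_bound[OF i]) (auto simp: indicator_def)
qed

locale variable_exponent =
  fixes T :: real and \<alpha> :: "real \<Rightarrow> real"
  assumes T: "0 < T" and H1: "hyp_H1 T \<alpha>"
begin

lemma \<alpha>_bounds: "t \<in> {0..T} \<Longrightarrow> 0 < \<alpha> t \<and> \<alpha> t < 1"
  using H1 unfolding hyp_H1_def by blast

abbreviation "\<alpha>' \<equiv> deriv_I T \<alpha>"

lemma \<alpha>_deriv: "t \<in> {0..T} \<Longrightarrow> (\<alpha> has_real_derivative \<alpha>' t) (at t within {0..T})"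
proof -
  assume t: "t \<in> {0..T}"
  have "(deriv_I T ^^ 0) \<alpha> differentiable_on {0..T}" using H1 unfolding hyp_H1_def by (meson zero_less_numeral)
  then have "\<alpha> differentiable (at t within {0..T})" using t by (simp add: differentiable_on_def)
  then show ?thesis
    unfolding vector_derivative_works deriv_I_def has_real_derivative_iff_has_vector_derivative .
qed

lemma \<alpha>_continuous: "continuous_on {0..T} \<alpha>"
  using \<alpha>_deriv DERIV_continuous_on by blast

lemma \<alpha>'_continuous: "continuous_on {0..T} \<alpha>'"
proof -
  have "(deriv_I T ^^ 1) \<alpha> differentiable_on {0..T}" using H1 unfolding hyp_H1_def by (meson one_less_numeral_iff semiring_norm(77))
  then show ?thesis by (auto intro: differentiable_imp_continuous_on)
qed

lemma \<alpha>_deriv_at: "t \<in> {0<..<T} \<Longrightarrow> (\<alpha> has_real_derivative \<alpha>' t) (at t)"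
  using \<alpha>_deriv[of t] at_within_interior[of t "{0..T}"] by (simp add: interior_atLeastAtMost_real)

definition R :: "real \<Rightarrow> real" where "R r = 1 / Gamma (1 - \<alpha> r)"

text \<open>The derivative of \<open>R\<close>: the logarithmic derivative of 1/Gamma is minus
  \<open>Digamma\<close>, and 1 - \<alpha> has derivative -\<alpha>'.\<close>

definition R' :: "real \<Rightarrow> real" where "R' r = Digamma (1 - \<alpha> r) * \<alpha>' r / Gamma (1 - \<alpha> r)"

lemma not_nonpos: "t \<in> {0..T} \<Longrightarrow> 1 - \<alpha> t \<notin> \<int>\<^sub>\<le>\<^sub>0"
  using \<alpha>_bounds[of t] by (auto elim!: nonpos_Ints_cases)

lemma R_deriv: "r \<in> {0..T} \<Longrightarrow> (R has_real_derivative R' r) (at r within {0..T})"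
proof -
  assume r: "r \<in> {0..T}"
  have "0 < Gamma (1 - \<alpha> r)" using \<alpha>_bounds[OF r] by (intro Gamma_real_pos) simp
  then have G: "Gamma (1 - \<alpha> r) \<noteq> 0" by simp
  show ?thesis unfolding R_def[abs_def] R'_def
    using not_nonpos[OF r] G
    by (auto intro!: derivative_eq_intros \<alpha>_deriv[OF r] simp: field_simps power2_eq_square)
qed

lemma R_continuous: "continuous_on {0..T} R"
  using R_deriv DERIV_continuous_on by blast

lemma R'_continuous: "continuous_on {0..T} R'"
proof -
  have s: "continuous_on {0..T} (\<lambda>r. 1 - \<alpha> r)" by (intro continuous_intros \<alpha>_continuous)
  have im: "(\<lambda>r. 1 - \<alpha> r) ` {0..T} \<subseteq> {0<..}" using \<alpha>_bounds by auto
  have np: "x \<notin> \<int>\<^sub>\<le>\<^sub>0" if "x \<in> {0<..}" for x :: real using that by (auto elim!: nonpos_Ints_cases)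
  have "continuous_on {0..T} (\<lambda>r. Digamma (1 - \<alpha> r))" "continuous_on {0..T} (\<lambda>r. Gamma (1 - \<alpha> r))"
    by (rule continuous_on_compose2[OF _ s im], intro continuous_on_Polygamma continuous_on_Gamma, use np in auto)+
  moreover have "Gamma (1 - \<alpha> r) \<noteq> 0" if "r \<in> {0..T}" for r
  proof -
    have "0 < Gamma (1 - \<alpha> r)" using \<alpha>_bounds[OF that] by (intro Gamma_real_pos) simp
    then show ?thesis by simp
  qed
  ultimately show ?thesis unfolding R'_def by (intro continuous_intros \<alpha>'_continuous) auto
qed

lemma powr_R_deriv:
  assumes r: "r \<in> {0..T}" and t: "0 < t"
  shows "((\<lambda>r. t powr (- \<alpha> r) * R r) has_real_derivative t powr (- \<alpha> r) * (- \<alpha>' r * ln t * R r + R' r)) (at r within {0..T})"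
  using t by (auto intro!: derivative_eq_intros \<alpha>_deriv[OF r] R_deriv[OF r] simp: powr_def algebra_simps)

text \<open>
  The fundamental theorem of calculus applies: the integrand of \<open>g_tilde\<close> is the derivative in \<open>r\<close>
  of \<open>t powr (- \<alpha> r) / Gamma (1 - \<alpha> r)\<close>.
\<close>

lemma g_tilde_eq:
  assumes t: "t \<in> {0<..<T}"
  shows "g_tilde T \<alpha> t = t powr (- \<alpha> t) * R t - t powr (- \<alpha> 0) * R 0"
proof -
  let ?f = "\<lambda>r. t powr (- \<alpha> r) * (- \<alpha>' r * ln t * R r + R' r)"
  have sub: "{0..t} \<subseteq> {0..T}" using t by auto
  have "(?f has_integral (t powr (- \<alpha> t) * R t - t powr (- \<alpha> 0) * R 0)) {0..t}"
  proof (rule fundamental_theorem_of_calculus)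
    fix r assume "r \<in> {0..t}"
    then show "((\<lambda>r. t powr (- \<alpha> r) * R r) has_vector_derivative ?f r) (at r within {0..t})"
      using powr_R_deriv[of r t] t sub DERIV_subset
      unfolding has_real_derivative_iff_has_vector_derivative[symmetric] by force
  qed (use t in auto)
  moreover have "set_integrable lborel {0..t} ?f"
    unfolding set_integrable_def using t sub
    by (intro borel_integrable_compact continuous_intros continuous_on_subset[OF \<alpha>_continuous]
        continuous_on_subset[OF \<alpha>'_continuous] continuous_on_subset[OF R_continuous] continuous_on_subset[OF R'_continuous]) auto
  ultimately have "(LINT r:{0..t}|lborel. ?f r) = t powr (- \<alpha> t) * R t - t powr (- \<alpha> 0) * R 0"
    using set_borel_integral_eq_integral(2) by (metis (no_types, lifting) integral_unique)
  moreover have "g_tilde T \<alpha> t = (LINT r:{0..t}|lborel. ?f r)"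
  proof -
    have m: "(\<lambda>r. indicat_real {0..t} r *\<^sub>R ?f r) \<in> borel_measurable lborel"
      using \<open>set_integrable lborel {0..t} ?f\<close> unfolding set_integrable_def by (rule borel_measurable_integrable)
    have "g_tilde T \<alpha> t = (LINT r|lborel. indicator {0<..<t} r *\<^sub>R ?f r)"
      unfolding g_tilde_def
      by (subst integral_restrict_space) (auto simp: R_def R'_def divide_inverse algebra_simps intro!: Bochner_Integration.integral_cong)
    also have "\<dots> = (LINT r|lborel. indicator {0..t} r *\<^sub>R ?f r)"
    proof (rule integral_cong_AE[OF _ m])
      have "(\<lambda>r. indicator {0<..<t} r *\<^sub>R (indicat_real {0..t} r *\<^sub>R ?f r)) \<in> borel_measurable lborel"
        by (intro borel_measurable_scaleR m) simp
      also have "(\<lambda>r. indicator {0<..<t} r *\<^sub>R (indicat_real {0..t} r *\<^sub>R ?f r)) = (\<lambda>r. indicator {0<..<t} r *\<^sub>R ?f r)"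
        by (auto simp: indicator_def)
      finally show "(\<lambda>r. indicator {0<..<t} r *\<^sub>R ?f r) \<in> borel_measurable lborel" .
      show "AE r in lborel. indicat_real {0<..<t} r *\<^sub>R ?f r = indicat_real {0..t} r *\<^sub>R ?f r"
        using AE_lborel_singleton[of 0] AE_lborel_singleton[of t] by eventually_elim (auto simp: indicator_def)
    qed
    finally show ?thesis unfolding set_lebesgue_integral_def .
  qed
  ultimately show ?thesis by simp
qed

text \<open>The derivative of the closed form in \<open>g_tilde_eq\<close>. The first summand comes
  from the t in the exponent and in \<open>R\<close>, the bracket from the base t of the two
  powers.\<close>

definition dg :: "real \<Rightarrow> real" where
  "dg t = t powr (- \<alpha> t) * (- \<alpha>' t * ln t * R t + R' t) - (\<alpha> t * (t powr (- \<alpha> t - 1) * R t) - \<alpha> 0 * (t powr (- \<alpha> 0 - 1) * R 0))"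

lemma deriv_g_tilde:
  assumes t: "t \<in> {0<..<T}"
  shows "deriv (g_tilde T \<alpha>) t = dg t"
proof -
  have R: "(R has_real_derivative R' t) (at t)"
    using R_deriv[of t] at_within_interior[of t "{0..T}"] t by (simp add: interior_atLeastAtMost_real)
  have p: "((\<lambda>t. t powr (- \<alpha> t)) has_real_derivative t powr (- \<alpha> t) * (- \<alpha>' t * ln t + 1 * (- \<alpha> t) / t)) (at t)"
    using t by (intro DERIV_powr DERIV_ident DERIV_minus \<alpha>_deriv_at) auto
  have "((\<lambda>t. t powr (- \<alpha> t) * R t - t powr (- \<alpha> 0) * R 0) has_real_derivative dg t) (at t)"
    using t unfolding dg_def
    by (auto intro!: derivative_eq_intros p R simp: powr_diff field_simps)
  then have "(g_tilde T \<alpha> has_real_derivative dg t) (at t)"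
    by (rule has_field_derivative_transform_within_open[where S="{0<..<T}"]) (use t g_tilde_eq in auto)
  then show ?thesis by (rule DERIV_imp_deriv)
qed

lemma dg_continuous: "continuous_on {0<..<T} dg"
proof -
  have sub: "{0<..<T} \<subseteq> {0..T}" by auto
  show ?thesis unfolding dg_def
    by (intro continuous_intros continuous_on_subset[OF \<alpha>_continuous sub]
        continuous_on_subset[OF \<alpha>'_continuous sub] continuous_on_subset[OF R_continuous sub] continuous_on_subset[OF R'_continuous sub]) auto
qed

text \<open>
  The two terms subtracted in \<open>dg\<close> are of order \<open>t powr (- \<alpha> t - 1)\<close> and not integrable at \<open>0\<close>;
  their difference gains a factor \<open>t\<close> by the mean value inequality in \<open>r\<close>.
\<close>

lemma dg_bound: "\<exists>C \<nu>. \<nu> < 1 \<and> (\<forall>t\<in>{0<..<T}. \<bar>dg t\<bar> \<le> C * t powr (- \<nu>))"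
proof -
  have "{0..T} \<noteq> {}" using T by auto
  then obtain tm where tm: "tm \<in> {0..T}" "\<And>t. t \<in> {0..T} \<Longrightarrow> \<alpha> t \<le> \<alpha> tm"
    using continuous_attains_sup[OF compact_Icc _ \<alpha>_continuous] by blast
  \<comment> \<open>The maximum of \<alpha> is attained, hence below 1; 1 - m is the room left for
    the logarithm.\<close>
  define m where "m = \<alpha> tm"
  have m: "0 < m" "m < 1" "\<And>t. t \<in> {0..T} \<Longrightarrow> \<alpha> t \<le> m" using tm \<alpha>_bounds[OF tm(1)] by (auto simp: m_def)
  have bdd: "\<exists>B\<ge>0. \<forall>r\<in>{0..T}. \<bar>f r\<bar> \<le> B" if "continuous_on {0..T} f" for f :: "real \<Rightarrow> real"
  proof -
    have "bounded (f ` {0..T})" by (intro compact_imp_bounded compact_continuous_image that compact_Icc)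
    then obtain B where "\<forall>r\<in>{0..T}. \<bar>f r\<bar> \<le> B" unfolding bounded_iff by (auto simp del: atLeastAtMost_iff)
    then show ?thesis by (intro exI[of _ "max B 0"]) (auto simp: max.coboundedI1)
  qed
  obtain L where L: "0 \<le> L" "\<And>r. r \<in> {0..T} \<Longrightarrow> \<bar>\<alpha>' r\<bar> \<le> L" using bdd[OF \<alpha>'_continuous] by blast
  obtain C1 where C1: "0 \<le> C1" "\<And>r. r \<in> {0..T} \<Longrightarrow> \<bar>R r\<bar> \<le> C1" using bdd[OF R_continuous] by blast
  obtain C2 where C2: "0 \<le> C2" "\<And>r. r \<in> {0..T} \<Longrightarrow> \<bar>R' r\<bar> \<le> C2" using bdd[OF R'_continuous] by blast
  \<comment> \<open>Two copies of \<open>L * \<bar>ln t\<bar> * C1 + C2\<close>, from the first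
    summand of \<open>dg\<close> and from the bracket, and \<open>L * C1\<close> for differentiating
    the factor \<open>\<alpha> r\<close> in the bracket.\<close>
  define D where "D t = L * C1 * (1 + 2 * \<bar>ln t\<bar>) + 2 * C2" for t
  \<comment> \<open>For t below 1 the largest exponent dominates; the factor 1 + T pays for t above
    1.\<close>
  have pw: "t powr (- \<alpha> r) \<le> (1 + T) * t powr (- m)" if t: "t \<in> {0<..<T}" and r: "r \<in> {0..T}" for t r
  proof -
    have e: "0 \<le> m - \<alpha> r" "m - \<alpha> r \<le> 1" using m(2) m(3)[OF r] \<alpha>_bounds[OF r] by auto
    have "t powr (m - \<alpha> r) \<le> 1 + T"
    proof (cases "t \<le> 1")
      case True
      then have "t powr (m - \<alpha> r) \<le> 1" using e t by (simp add: powr_le1)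
      then show ?thesis using T by simp
    next
      case False
      then have "t powr (m - \<alpha> r) \<le> t powr 1" using e by (intro powr_mono) auto
      then show ?thesis using t by simp
    qed
    moreover have "t powr (- \<alpha> r) = t powr (m - \<alpha> r) * t powr (- m)" by (simp add: powr_add[symmetric])
    ultimately show ?thesis by (simp add: mult_right_mono)
  qed
  have main: "\<bar>dg t\<bar> \<le> D t * ((1 + T) * t powr (- m))" if t: "t \<in> {0<..<T}" for t
  proof -
    \<comment> \<open>Here t is fixed and r varies from 0 to t: the bracket in \<open>dg\<close> is
      \<open>?q t - ?q 0\<close>.\<close>
    let ?q = "\<lambda>r. \<alpha> r * (t powr (- \<alpha> r - 1) * R r)"
    let ?q' = "\<lambda>r. t powr (- \<alpha> r - 1) * (\<alpha>' r * R r + \<alpha> r * (- \<alpha>' r * ln t * R r + R' r))"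
    have qd: "(?q has_real_derivative ?q' r) (at r within {0..T})" if r: "r \<in> {0..T}" for r
      using t by (auto intro!: derivative_eq_intros \<alpha>_deriv[OF r] R_deriv[OF r] simp: powr_def algebra_simps)
    let ?p = "(1 + T) * t powr (- m)"
    have core: "\<bar>- \<alpha>' r * ln t * R r + R' r\<bar> \<le> L * \<bar>ln t\<bar> * C1 + C2" if r: "r \<in> {0..T}" for r
    proof -
      have "\<bar>- \<alpha>' r * ln t * R r\<bar> \<le> L * \<bar>ln t\<bar> * C1"
        unfolding abs_mult abs_minus using L C1 r by (intro mult_mono mult_nonneg_nonneg) auto
      then show ?thesis using C2(2)[OF r] by linarith
    qed
    have q'b: "norm (?q' r) \<le> ?p / t * (L * C1 + (L * \<bar>ln t\<bar> * C1 + C2))" if r: "r \<in> {0..T}" for r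
    proof -
      have 1: "\<bar>\<alpha>' r * R r\<bar> \<le> L * C1" unfolding abs_mult using L C1 r by (intro mult_mono) auto
      have one': "\<bar>\<alpha> r * (- \<alpha>' r * ln t * R r + R' r)\<bar> \<le> 1 * (L * \<bar>ln t\<bar> * C1 + C2)"
        unfolding abs_mult[of "\<alpha> r"] using \<alpha>_bounds[OF r] core[OF r] by (intro mult_mono) auto
      have 2: "\<bar>\<alpha>' r * R r + \<alpha> r * (- \<alpha>' r * ln t * R r + R' r)\<bar> \<le> L * C1 + (L * \<bar>ln t\<bar> * C1 + C2)"
        using order_trans[OF abs_triangle_ineq add_mono[OF 1 one']] by simp
      have 3: "t powr (- \<alpha> r - 1) \<le> ?p / t"
        using pw[OF t r] t by (simp add: powr_diff divide_right_mono)
      show ?thesis unfolding real_norm_def abs_mult[of "t powr _"] using 2 3 t T by (intro mult_mono) auto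
    qed
    have "norm (?q t - ?q 0) \<le> ?p / t * (L * C1 + (L * \<bar>ln t\<bar> * C1 + C2)) * norm (t - 0)"
      by (rule field_differentiable_bound[OF convex_real_interval(5) qd q'b]) (use t T in auto)
    then have a: "\<bar>?q t - ?q 0\<bar> \<le> ?p * (L * C1 + (L * \<bar>ln t\<bar> * C1 + C2))" using t by simp
    have tT: "t \<in> {0..T}" using t by auto
    have b: "\<bar>t powr (- \<alpha> t) * (- \<alpha>' t * ln t * R t + R' t)\<bar> \<le> ?p * (L * \<bar>ln t\<bar> * C1 + C2)"
      unfolding abs_mult[of "t powr _"] using pw[OF t tT] core[OF tT] T by (intro mult_mono) auto
    have "\<bar>dg t\<bar> \<le> ?p * (L * \<bar>ln t\<bar> * C1 + C2) + ?p * (L * C1 + (L * \<bar>ln t\<bar> * C1 + C2))"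
      unfolding dg_def using a b by linarith
    also have "\<dots> = D t * ?p" by (simp add: D_def algebra_simps)
    finally show ?thesis .
  qed
  \<comment> \<open>Half of the gap below 1: the logarithm is absorbed by
    \<open>t powr (- \<epsilon>)\<close>, and m + \<epsilon> is the final exponent.\<close>
  define \<epsilon> where "\<epsilon> = (1 - m) / 2"
  have \<epsilon>: "0 < \<epsilon>" "m + \<epsilon> < 1" using m by (auto simp: \<epsilon>_def field_simps)
  \<comment> \<open>Bounds \<open>t powr \<epsilon>\<close> on (0, T), so that constants, too, are
    absorbed by \<open>t powr (- \<epsilon>)\<close>, even for t above 1.\<close>
  define K where "K = (1 + T) powr \<epsilon>"
  have one: "1 \<le> K * t powr (- \<epsilon>)" if t: "t \<in> {0<..<T}" for t
  proof -
    have "t powr \<epsilon> \<le> K" unfolding K_def using t \<epsilon> by (intro powr_mono2) auto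
    then have "t powr \<epsilon> * t powr (- \<epsilon>) \<le> K * t powr (- \<epsilon>)" by (intro mult_right_mono) auto
    moreover have "t powr \<epsilon> * t powr (- \<epsilon>) = 1" using t by (simp add: powr_add[symmetric])
    ultimately show ?thesis by simp
  qed
  have lnb: "\<bar>ln t\<bar> \<le> (1 / \<epsilon> + T * K) * t powr (- \<epsilon>)" if t: "t \<in> {0<..<T}" for t
  proof (cases "t < 1")
    case True
    then have "\<bar>ln t\<bar> = ln (1 / t)" using t by (simp add: ln_div)
    also have "\<dots> \<le> (1 / t) powr \<epsilon> / \<epsilon>" using t True \<epsilon> by (intro ln_powr_bound) auto
    also have "\<dots> = 1 / \<epsilon> * t powr (- \<epsilon>)" using t by (simp add: powr_divide powr_minus_divide)
    also have "\<dots> \<le> (1 / \<epsilon> + T * K) * t powr (- \<epsilon>)" using T by (intro mult_right_mono) (auto simp: K_def)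
    finally show ?thesis .
  next
    case False
    then have "\<bar>ln t\<bar> = ln t" by simp
    also have "\<dots> \<le> T" using ln_le_minus_one[of t] t by simp
    also have "\<dots> \<le> T * (K * t powr (- \<epsilon>))" using one[OF t] T by (simp add: mult_le_cancel_left1)
    also have "\<dots> \<le> (1 / \<epsilon> + T * K) * t powr (- \<epsilon>)" using \<epsilon> by (simp add: distrib_right)
    finally show ?thesis .
  qed
  define C where "C = ((L * C1 + 2 * C2) * K + 2 * (L * C1) * (1 / \<epsilon> + T * K)) * (1 + T)"
  have "\<bar>dg t\<bar> \<le> C * t powr (- (m + \<epsilon>))" if t: "t \<in> {0<..<T}" for t
  proof -
    have LC: "0 \<le> L * C1" using L C1 by simp
    have "D t = (L * C1 + 2 * C2) * 1 + 2 * (L * C1) * \<bar>ln t\<bar>" by (simp add: D_def algebra_simps)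
    also have "\<dots> \<le> (L * C1 + 2 * C2) * (K * t powr (- \<epsilon>)) + 2 * (L * C1) * ((1 / \<epsilon> + T * K) * t powr (- \<epsilon>))"
      using one[OF t] lnb[OF t] LC C2 by (intro add_mono mult_left_mono) auto
    finally have "D t \<le> ((L * C1 + 2 * C2) * K + 2 * (L * C1) * (1 / \<epsilon> + T * K)) * t powr (- \<epsilon>)"
      by (simp add: algebra_simps)
    then have "D t * ((1 + T) * t powr (- m)) \<le> ((L * C1 + 2 * C2) * K + 2 * (L * C1) * (1 / \<epsilon> + T * K)) * t powr (- \<epsilon>) * ((1 + T) * t powr (- m))"
      using T by (intro mult_right_mono) auto
    also have "\<dots> = C * t powr (- (m + \<epsilon>))" by (simp add: C_def powr_diff powr_minus_divide powr_add mult_ac)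
    finally show ?thesis using main[OF t] by linarith
  qed
  then show ?thesis using \<epsilon> by blast
qed

text \<open>Inside (0, T) the derivative is \<open>dg\<close>, whose continuity gives measurability
  and whose bound gives an integrable majorant; the cut-off removes the points where no formula is
  available.\<close>

lemma integrable_deriv_g_tilde: "integrable lborel (\<lambda>r. indicator {0<..<T} r * deriv (g_tilde T \<alpha>) r)"
proof -
  obtain C \<nu> where C: "\<nu> < 1" "\<And>t. t \<in> {0<..<T} \<Longrightarrow> \<bar>dg t\<bar> \<le> C * t powr (- \<nu>)" using dg_bound by blast
  have e: "(\<lambda>r. indicator {0<..<T} r * deriv (g_tilde T \<alpha>) r) = (\<lambda>r. indicator {0<..<T} r *\<^sub>R dg r)"
    using deriv_g_tilde by (auto simp: indicator_def)
  have i: "integrable lborel (\<lambda>r. C * (indicator {0<..<T} r * r powr (- \<nu>)))"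
    using C(1) T by (intro integrable_mult_right integrable_powr_kernel) auto
  show ?thesis unfolding e
  proof (rule Bochner_Integration.integrable_bound[OF i])
    show "(\<lambda>r. indicator {0<..<T} r *\<^sub>R dg r) \<in> borel_measurable lborel"
      using borel_measurable_continuous_on_indicator[OF _ dg_continuous] by simp
    show "AE r in lborel. norm (indicator {0<..<T} r *\<^sub>R dg r) \<le> norm (C * (indicator {0<..<T} r * r powr (- \<nu>)))"
    proof (intro AE_I2)
      fix r
      show "norm (indicator {0<..<T} r *\<^sub>R dg r) \<le> norm (C * (indicator {0<..<T} r * r powr (- \<nu>)))"
        using C(2)[of r] by (cases "r \<in> {0<..<T}") auto
    qed
  qed
qed

end

section \<open>The adjoint identity\<close>

text \<open>The dual partner of \<open>L2_of_L1\<close>: L^2 in x of L^\<infinity> in time. A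
  product from the two classes is integrable by Cauchy-Schwarz in x, whatever the exponents in
  time.\<close>

definition dominated :: "'x measure \<Rightarrow> 't measure \<Rightarrow> ('t \<Rightarrow> 'x \<Rightarrow> real) \<Rightarrow> bool" where
  "dominated M N b \<longleftrightarrow> (\<lambda>(x, t). b t x) \<in> borel_measurable (M \<Otimes>\<^sub>M N) \<and>
     (\<exists>B\<in>Lspace 2 M. AE x in M. AE t in N. \<bar>b t x\<bar> \<le> B x)"

lemma Lspace_2_abs: "f \<in> Lspace 2 M \<Longrightarrow> (\<lambda>x. \<bar>f x\<bar>) \<in> Lspace 2 M"
  by (auto simp: Lspace_2_iff)

lemma Lspace_2_add:
  assumes "f \<in> Lspace 2 M" "g \<in> Lspace 2 M"
  shows "(\<lambda>x. f x + g x) \<in> Lspace 2 M"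
proof -
  have "(\<lambda>x. - g x) \<in> Lspace 2 M" using assms(2) by (simp add: Lspace_2_iff)
  from Lspace_2_diff[OF assms(1) this] show ?thesis by simp
qed

text \<open>Gives the extended-real time integral a real representative in L^2; the two agree where
  the integral is finite, that is at almost every x.\<close>

lemma L2_of_L1_total:
  assumes N: "sigma_finite_measure N" and a: "L2_of_L1 M N a"
  shows "\<exists>A\<in>Lspace 2 M. (\<forall>x. 0 \<le> A x) \<and> (AE x in M. (\<integral>\<^sup>+t. ennreal \<bar>a t x\<bar> \<partial>N) = ennreal (A x))"
proof -
  interpret N: sigma_finite_measure N by fact
  have am[measurable]: "(\<lambda>z. a (snd z) (fst z)) \<in> borel_measurable (M \<Otimes>\<^sub>M N)"
    using a by (simp add: L2_of_L1_def case_prod_unfold)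
  define F where "F x = (\<integral>\<^sup>+t. ennreal \<bar>a t x\<bar> \<partial>N)" for x
  have Fm[measurable]: "F \<in> borel_measurable M"
    unfolding F_def by (intro N.borel_measurable_nn_integral) (simp add: case_prod_unfold)
  have fin: "(\<integral>\<^sup>+x. (F x)\<^sup>2 \<partial>M) < \<infinity>" using a by (simp add: L2_of_L1_def F_def)
  then have "AE x in M. (F x)\<^sup>2 \<noteq> \<infinity>" by (intro nn_integral_PInf_AE) auto
  then have F: "AE x in M. F x = ennreal (enn2real (F x))"
    by eventually_elim (auto simp: power2_eq_square ennreal_mult_eq_top_iff less_top)
  define A where "A x = enn2real (F x)" for x
  have "(\<integral>\<^sup>+x. (ennreal \<bar>A x\<bar>)\<^sup>2 \<partial>M) = (\<integral>\<^sup>+x. (F x)\<^sup>2 \<partial>M)"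
  proof (rule nn_integral_cong_AE)
    show "AE x in M. (ennreal \<bar>A x\<bar>)\<^sup>2 = (F x)\<^sup>2"
      using F by eventually_elim (simp add: A_def)
  qed
  moreover have "A \<in> borel_measurable M" unfolding A_def[abs_def] by measurable
  ultimately have "A \<in> Lspace 2 M" using fin unfolding Lspace_2_iff by simp
  moreover have "AE x in M. (\<integral>\<^sup>+t. ennreal \<bar>a t x\<bar> \<partial>N) = ennreal (A x)"
    using F by (simp add: A_def F_def)
  ultimately show ?thesis by (intro bexI[of _ A]) (simp_all add: A_def)
qed

lemma integrable_pair_if_bound:
  assumes N: "sigma_finite_measure N"
    and m: "F \<in> borel_measurable (M \<Otimes>\<^sub>M N)"
    and G: "G \<in> Lspace 2 M" "H \<in> Lspace 2 M"
    and b: "AE x in M. (\<integral>\<^sup>+t. ennreal \<bar>F (x, t)\<bar> \<partial>N) \<le> ennreal C * (ennreal \<bar>G x\<bar> * ennreal \<bar>H x\<bar>)"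
  shows "integrable (M \<Otimes>\<^sub>M N) (F :: _ \<Rightarrow> real)"
proof (rule integrableI_bounded[OF m])
  interpret N: sigma_finite_measure N by fact
  have [measurable]: "G \<in> borel_measurable M" "H \<in> borel_measurable M" using G by (auto simp: Lspace_2_iff)
  have "(\<integral>\<^sup>+z. ennreal (norm (F z)) \<partial>(M \<Otimes>\<^sub>M N)) = (\<integral>\<^sup>+x. (\<integral>\<^sup>+t. ennreal \<bar>F (x, t)\<bar> \<partial>N) \<partial>M)"
    by (subst N.nn_integral_fst[symmetric]) (use m in auto)
  also have "\<dots> \<le> (\<integral>\<^sup>+x. ennreal C * (ennreal \<bar>G x\<bar> * ennreal \<bar>H x\<bar>) \<partial>M)" by (rule nn_integral_mono_AE[OF b])
  also have "\<dots> = ennreal C * (\<integral>\<^sup>+x. ennreal \<bar>G x\<bar> * ennreal \<bar>H x\<bar> \<partial>M)" by (rule nn_integral_cmult) measurable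
  also have "\<dots> < \<infinity>" using Lspace_2_mult(3)[OF G] by (simp add: ennreal_mult_less_top)
  finally show "(\<integral>\<^sup>+z. ennreal (norm (F z)) \<partial>(M \<Otimes>\<^sub>M N)) < \<infinity>" .
qed

lemma integrable_L2_of_L1_mult_dominated:
  assumes N: "sigma_finite_measure N" and a: "L2_of_L1 M N a" and b: "dominated M N b"
  shows "integrable (M \<Otimes>\<^sub>M N) (\<lambda>z. a (snd z) (fst z) * b (snd z) (fst z))"
proof -
  obtain A where A: "A \<in> Lspace 2 M" "\<And>x. 0 \<le> A x" "AE x in M. (\<integral>\<^sup>+t. ennreal \<bar>a t x\<bar> \<partial>N) = ennreal (A x)"
    using L2_of_L1_total[OF N a] by blast
  obtain B where B: "B \<in> Lspace 2 M" "AE x in M. AE t in N. \<bar>b t x\<bar> \<le> B x" using b unfolding dominated_def by blast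
  have am: "(\<lambda>z. a (snd z) (fst z)) \<in> borel_measurable (M \<Otimes>\<^sub>M N)" using a by (simp add: L2_of_L1_def case_prod_unfold)
  have bm: "(\<lambda>z. b (snd z) (fst z)) \<in> borel_measurable (M \<Otimes>\<^sub>M N)" using b by (simp add: dominated_def case_prod_unfold)
  show ?thesis
  proof (rule integrable_pair_if_bound[OF N borel_measurable_times[OF am bm] A(1) B(1), where C=1])
    show "AE x in M. (\<integral>\<^sup>+t. ennreal \<bar>a (snd (x, t)) (fst (x, t)) * b (snd (x, t)) (fst (x, t))\<bar> \<partial>N)
        \<le> ennreal 1 * (ennreal \<bar>A x\<bar> * ennreal \<bar>B x\<bar>)"
      using A(3) B(2) AE_space
    proof eventually_elim
      case (elim x)
      have "(\<integral>\<^sup>+t. ennreal \<bar>a t x * b t x\<bar> \<partial>N) \<le> (\<integral>\<^sup>+t. ennreal \<bar>a t x\<bar> * ennreal \<bar>B x\<bar> \<partial>N)"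
      proof (rule nn_integral_mono_AE)
        show "AE t in N. ennreal \<bar>a t x * b t x\<bar> \<le> ennreal \<bar>a t x\<bar> * ennreal \<bar>B x\<bar>"
          using elim(2)
        proof eventually_elim
          case (elim t)
          then have "\<bar>a t x * b t x\<bar> \<le> \<bar>a t x\<bar> * \<bar>B x\<bar>" unfolding abs_mult by (intro mult_left_mono) auto
          then have "ennreal \<bar>a t x * b t x\<bar> \<le> ennreal (\<bar>a t x\<bar> * \<bar>B x\<bar>)" by (rule ennreal_leI)
          then show ?case by (simp add: ennreal_mult)
        qed
      qed
      also have "\<dots> = (\<integral>\<^sup>+t. ennreal \<bar>a t x\<bar> \<partial>N) * ennreal \<bar>B x\<bar>"
        using measurable_compose[OF measurable_Pair1'[OF elim(3)] am] by (intro nn_integral_multc) simp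
      finally show ?case using A(2)[of x] elim(1) by simp
    qed
  qed
qed

section \<open>Transposing convolutions\<close>

context
  fixes M :: "'x measure" and T :: real
  assumes M: "finite_measure M"
begin

interpretation M: finite_measure M by (rule M)
interpretation N: finite_measure "leb {0<..<T}" by (rule finite_leb) auto
interpretation MN: pair_sigma_finite M "leb {0<..<T}" ..

text \<open>\<open>convolution_duality\<close> at almost every fixed x, then Cauchy-Schwarz in x for
  the bound \<open>A x * B x\<close>. The right-hand side stays an iterated integral, as
  integrability over the product is established for the left integrand only.\<close>

lemma volterra_dominated_duality:
  assumes k: "integrable lborel \<kappa>" and a: "L2_of_L1 M (leb {0<..<T}) a" and b: "dominated M (leb {0<..<T}) b"
  shows "integrable (M \<Otimes>\<^sub>M leb {0<..<T}) (\<lambda>z. volterra T \<kappa> a (snd z) (fst z) * b (snd z) (fst z))"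
    and "(LINT z|(M \<Otimes>\<^sub>M leb {0<..<T}). volterra T \<kappa> a (snd z) (fst z) * b (snd z) (fst z))
      = (LINT x|M. LINT s|leb {0<..<T}. a s x * volterra T (\<lambda>r. \<kappa> (- r)) b s x)"
proof -
  let ?N = "leb {0<..<T}"
  have am: "(\<lambda>z. a (snd z) (fst z)) \<in> borel_measurable (M \<Otimes>\<^sub>M ?N)" using a by (simp add: L2_of_L1_def case_prod_unfold)
  have bm: "(\<lambda>z. b (snd z) (fst z)) \<in> borel_measurable (M \<Otimes>\<^sub>M ?N)" using b by (simp add: dominated_def case_prod_unfold)
  have vm: "(\<lambda>z. volterra T \<kappa> a (snd z) (fst z)) \<in> borel_measurable (M \<Otimes>\<^sub>M ?N)"
    using volterra_measurable[OF M.sigma_finite_measure_axioms, of \<kappa> a T] k a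
    by (simp add: L2_of_L1_def case_prod_unfold)
  obtain A where A: "A \<in> Lspace 2 M" "\<And>x. 0 \<le> A x" "AE x in M. (\<integral>\<^sup>+t. ennreal \<bar>a t x\<bar> \<partial>?N) = ennreal (A x)"
    using L2_of_L1_total[OF N.sigma_finite_measure_axioms a] by blast
  obtain B where B: "B \<in> Lspace 2 M" "AE x in M. AE t in ?N. \<bar>b t x\<bar> \<le> B x" using b unfolding dominated_def by blast
  have kfin: "(\<integral>\<^sup>+r. ennreal \<bar>\<kappa> r\<bar> \<partial>lborel) = ennreal (LINT r|lborel. \<bar>\<kappa> r\<bar>)"
    using k by (intro nn_integral_eq_integral) auto
  have dual: "AE x in M. (LINT t|?N. volterra T \<kappa> a t x * b t x) = (LINT s|?N. a s x * volterra T (\<lambda>r. \<kappa> (- r)) b s x)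
      \<and> (\<integral>\<^sup>+t. ennreal \<bar>volterra T \<kappa> a t x * b t x\<bar> \<partial>?N) \<le> ennreal (LINT r|lborel. \<bar>\<kappa> r\<bar>) * (ennreal \<bar>A x\<bar> * ennreal \<bar>B x\<bar>)"
    using A(3) B(2) AE_space
  proof eventually_elim
    case (elim x)
    have ai: "integrable ?N (\<lambda>t. a t x)"
      by (rule integrableI_bounded) (use elim(1) measurable_compose[OF measurable_Pair1'[OF elim(3)] am] in auto)
    have bx: "(\<lambda>t. b t x) \<in> borel_measurable ?N" using measurable_compose[OF measurable_Pair1'[OF elim(3)] bm] by simp
    have I: "{0<..<T} \<in> sets borel" by simp
    have B': "AE t in ?N. \<bar>b t x\<bar> \<le> \<bar>B x\<bar>" using elim(2) by eventually_elim simp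
    have "(\<integral>\<^sup>+t. ennreal \<bar>volterra T \<kappa> a t x * b t x\<bar> \<partial>?N) \<le> ennreal \<bar>B x\<bar> * ennreal (LINT r|lborel. \<bar>\<kappa> r\<bar>) * ennreal (A x)"
      using convolution_duality(2)[OF I k ai bx B'] unfolding kfin elim(1) volterra_def .
    moreover have "(LINT t|?N. volterra T \<kappa> a t x * b t x) = (LINT s|?N. a s x * volterra T (\<lambda>r. \<kappa> (- r)) b s x)"
      using convolution_duality(1)[OF I k ai bx B'] unfolding volterra_def minus_diff_eq .
    ultimately show ?case using A(2)[of x] by (simp add: mult_ac)
  qed
  show i: "integrable (M \<Otimes>\<^sub>M ?N) (\<lambda>z. volterra T \<kappa> a (snd z) (fst z) * b (snd z) (fst z))"
  proof (rule integrable_pair_if_bound[OF N.sigma_finite_measure_axioms borel_measurable_times[OF vm bm] A(1) B(1)])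
    show "AE x in M. (\<integral>\<^sup>+t. ennreal \<bar>volterra T \<kappa> a (snd (x, t)) (fst (x, t)) * b (snd (x, t)) (fst (x, t))\<bar> \<partial>?N)
      \<le> ennreal (LINT r|lborel. \<bar>\<kappa> r\<bar>) * (ennreal \<bar>A x\<bar> * ennreal \<bar>B x\<bar>)"
      using dual by eventually_elim simp
  qed
  have "(LINT z|(M \<Otimes>\<^sub>M ?N). volterra T \<kappa> a (snd z) (fst z) * b (snd z) (fst z))
    = (LINT x|M. LINT t|?N. volterra T \<kappa> a t x * b t x)"
    using MN.integral_fst'[OF i] by simp
  also have "\<dots> = (LINT x|M. LINT s|?N. a s x * volterra T (\<lambda>r. \<kappa> (- r)) b s x)"
  proof (rule integral_cong_AE)
    show "AE x in M. (LINT t|?N. volterra T \<kappa> a t x * b t x) = (LINT s|?N. a s x * volterra T (\<lambda>r. \<kappa> (- r)) b s x)"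
      using dual by eventually_elim simp
    show "(\<lambda>x. LINT t|?N. volterra T \<kappa> a t x * b t x) \<in> borel_measurable M"
      by (rule N.borel_measurable_lebesgue_integral) (use vm bm in \<open>simp add: case_prod_unfold\<close>)
    have "(\<lambda>z. volterra T (\<lambda>r. \<kappa> (- r)) b (snd z) (fst z)) \<in> borel_measurable (M \<Otimes>\<^sub>M ?N)"
      using volterra_measurable[OF M.sigma_finite_measure_axioms, of "\<lambda>r. \<kappa> (- r)" b T] k b
      by (simp add: dominated_def case_prod_unfold)
    then show "(\<lambda>x. LINT s|?N. a s x * volterra T (\<lambda>r. \<kappa> (- r)) b s x) \<in> borel_measurable M"
      by (intro N.borel_measurable_lebesgue_integral) (use am in \<open>simp add: case_prod_unfold\<close>)
  qed
  finally show "(LINT z|(M \<Otimes>\<^sub>M ?N). volterra T \<kappa> a (snd z) (fst z) * b (snd z) (fst z))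
      = (LINT x|M. LINT s|?N. a s x * volterra T (\<lambda>r. \<kappa> (- r)) b s x)" .
qed

end

text \<open>Both factors are merely integrable here, so \<open>convolution_duality\<close> does not
  apply; instead the kernel is bounded by 1 and the tensor product of the factors is a
  majorant.\<close>

lemma heaviside_duality:
  assumes a: "integrable (leb {0<..<T}) a" and b: "integrable (leb {0<..<T}) b"
  shows "(LINT s|leb {0<..<T}. a s * (LINT t|leb {0<..<T}. heaviside T (t - s) * b t))
     = (LINT t|leb {0<..<T}. b t * (LINT s|leb {0<..<T}. heaviside T (t - s) * a s))"
proof -
  let ?N = "leb {0<..<T}"
  interpret N: finite_measure ?N by (rule finite_leb) auto
  interpret NN: pair_sigma_finite ?N ?N ..
  have [measurable]: "a \<in> borel_measurable ?N" "b \<in> borel_measurable ?N" using a b by auto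
  have id: "(\<lambda>x. x) \<in> ?N \<rightarrow>\<^sub>M (borel :: real measure)" by (intro measurable_restrict_space1) simp
  have hm: "heaviside T \<in> borel_measurable borel" by (simp add: heaviside_def)
  have [measurable]: "(\<lambda>z. heaviside T (fst z - snd z)) \<in> borel_measurable (?N \<Otimes>\<^sub>M ?N)"
    by (rule measurable_compose[OF borel_measurable_diff[OF measurable_compose[OF measurable_fst id] measurable_compose[OF measurable_snd id]] hm])
  have ab: "integrable (?N \<Otimes>\<^sub>M ?N) (\<lambda>z. b (fst z) * a (snd z))"
  proof (rule integrableI_bounded)
    have "(\<integral>\<^sup>+z. ennreal (norm (b (fst z) * a (snd z))) \<partial>(?N \<Otimes>\<^sub>M ?N)) = (\<integral>\<^sup>+t. (\<integral>\<^sup>+s. ennreal \<bar>b t\<bar> * ennreal \<bar>a s\<bar> \<partial>?N) \<partial>?N)"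
      by (subst N.nn_integral_fst[symmetric]) (auto simp: abs_mult ennreal_mult)
    also have "\<dots> = (\<integral>\<^sup>+t. ennreal \<bar>b t\<bar> \<partial>?N) * (\<integral>\<^sup>+s. ennreal \<bar>a s\<bar> \<partial>?N)"
      by (simp add: nn_integral_cmult nn_integral_multc)
    also have "\<dots> < \<infinity>" using a b by (simp add: integrable_iff_bounded ennreal_mult_less_top)
    finally show "(\<integral>\<^sup>+z. ennreal (norm (b (fst z) * a (snd z))) \<partial>(?N \<Otimes>\<^sub>M ?N)) < \<infinity>" .
  qed measurable
  have i: "integrable (?N \<Otimes>\<^sub>M ?N) (\<lambda>(t, s). heaviside T (t - s) * (b t * a s))"
  proof (rule Bochner_Integration.integrable_bound[OF ab])
    show "(\<lambda>(t, s). heaviside T (t - s) * (b t * a s)) \<in> borel_measurable (?N \<Otimes>\<^sub>M ?N)"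
      unfolding case_prod_unfold by measurable
  qed (auto simp: heaviside_def indicator_def intro!: AE_I2)
  have "(LINT s|?N. a s * (LINT t|?N. heaviside T (t - s) * b t)) = (LINT s|?N. (LINT t|?N. heaviside T (t - s) * (b t * a s)))"
    by (simp add: mult_ac flip: integral_mult_right_zero)
  also have "\<dots> = (LINT t|?N. (LINT s|?N. heaviside T (t - s) * (b t * a s)))"
    using NN.Fubini_integral[OF i] by simp
  also have "\<dots> = (LINT t|?N. b t * (LINT s|?N. heaviside T (t - s) * a s))"
    by (simp add: mult_ac flip: integral_mult_right_zero)
  finally show ?thesis .
qed

text \<open>The primitive of \<open>v'\<close> is bounded at all times by the total variation
  \<open>A x\<close>, and the remaining part \<open>c\<close> is independent of time, so its size
  can be read off at a single time at which \<open>v\<close> is in L^2.\<close>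

lemma dominated_time_derivative:
  fixes S :: "'a::euclidean_space set"
  assumes S: "open S" "bounded S" and T: "0 < T"
    and v: "L2_of_L1 (leb S) (leb {0<..<T}) v" and vL: "AE t in leb {0<..<T}. v t \<in> Lspace 2 (leb S)"
    and v': "L2_of_L1 (leb S) (leb {0<..<T}) v'" and tv: "time_deriv T S v v'"
  shows "dominated (leb S) (leb {0<..<T}) v"
proof -
  let ?M = "leb S" and ?N = "leb {0<..<T}"
  interpret M: finite_measure ?M using S by (intro finite_leb) auto
  interpret N: finite_measure ?N by (rule finite_leb) auto
  interpret MN: pair_sigma_finite ?M ?N ..
  note vi = L2_of_L1_integrable[OF M.finite_measure_axioms N.sigma_finite_measure_axioms v]
  note v'i = L2_of_L1_integrable[OF M.finite_measure_axioms N.sigma_finite_measure_axioms v']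
  obtain c where c: "c \<in> borel_measurable ?M"
    "AE z in ?M \<Otimes>\<^sub>M ?N. v (snd z) (fst z) = c (fst z) + volterra T (heaviside T) v' (snd z) (fst z)"
    by (rule time_primitive[OF S(1) T vi v'i tv])
  obtain A where A: "A \<in> Lspace 2 ?M" "\<And>x. 0 \<le> A x" "AE x in ?M. (\<integral>\<^sup>+t. ennreal \<bar>v' t x\<bar> \<partial>?N) = ennreal (A x)"
    using L2_of_L1_total[OF N.sigma_finite_measure_axioms v'] by blast
  have v'm: "(\<lambda>z. v' (snd z) (fst z)) \<in> borel_measurable (?M \<Otimes>\<^sub>M ?N)" using v' by (simp add: L2_of_L1_def case_prod_unfold)
  have P: "AE x in ?M. \<forall>t. \<bar>volterra T (heaviside T) v' t x\<bar> \<le> A x"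
    using A(3)
  proof eventually_elim
    case (elim x)
    show ?case
    proof
      fix t
      show "\<bar>volterra T (heaviside T) v' t x\<bar> \<le> A x"
      proof (cases "integrable ?N (\<lambda>s. heaviside T (t - s) * v' s x)")
        case True
        have "ennreal \<bar>volterra T (heaviside T) v' t x\<bar> \<le> (\<integral>\<^sup>+s. ennreal (norm (heaviside T (t - s) * v' s x)) \<partial>?N)"
          unfolding volterra_def using integral_norm_bound_ennreal[OF True] by simp
        also have "\<dots> \<le> (\<integral>\<^sup>+s. ennreal \<bar>v' s x\<bar> \<partial>?N)"
          by (intro nn_integral_mono ennreal_leI) (auto simp: heaviside_def indicator_def)
        finally show ?thesis using elim A(2) by simp
      next
        case False
        then show ?thesis using A(2) by (simp add: volterra_def not_integrable_integral_eq)
      qed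
    qed
  qed
  have "AE t in ?N. AE x in ?M. v t x = c x + volterra T (heaviside T) v' t x" by (rule MN.AE_pair_swap[OF c(2)])
  with vL have good: "AE t in ?N. v t \<in> Lspace 2 ?M \<and> (AE x in ?M. v t x = c x + volterra T (heaviside T) v' t x)"
    by eventually_elim simp
  \<comment> \<open>Any time in (0, T) with both properties will do; the target 0 and the distance 1
    are arbitrary.\<close>
  obtain t where t: "v t \<in> Lspace 2 ?M" "AE x in ?M. v t x = c x + volterra T (heaviside T) v' t x"
    using AE_Ioo_approx[OF T _ good, of 0 1] T by auto
  \<comment> \<open>One \<open>A x\<close> is spent on recovering \<open>c\<close> from
    \<open>v t\<close>, the other on the primitive at the current time.\<close>
  have "(\<lambda>x. (\<bar>v t x\<bar> + A x) + A x) \<in> Lspace 2 ?M" by (intro Lspace_2_add Lspace_2_abs t A(1))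
  moreover have "AE x in ?M. AE s in ?N. \<bar>v s x\<bar> \<le> (\<bar>v t x\<bar> + A x) + A x"
    using t(2) P MN.AE_pair[OF c(2)]
  proof eventually_elim
    case (elim x)
    have cx: "\<bar>c x\<bar> \<le> \<bar>v t x\<bar> + A x" using elim(1) elim(2)[rule_format, of t] by linarith
    show ?case using elim(3)
    proof eventually_elim
      case (elim s)
      show ?case using elim cx \<open>\<forall>t. \<bar>volterra T (heaviside T) v' t x\<bar> \<le> A x\<close>[rule_format, of s] by simp
    qed
  qed
  moreover have "(\<lambda>(x, t). v t x) \<in> borel_measurable (?M \<Otimes>\<^sub>M ?N)" using v by (simp add: L2_of_L1_def)
  ultimately show ?thesis unfolding dominated_def
    by (intro conjI bexI[of _ "\<lambda>x. (\<bar>v t x\<bar> + A x) + A x"])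
qed

section \<open>Fractional operators as convolutions and their duality\<close>

text \<open>The factor 1 / Gamma(1 - \<mu>) is kept outside. The cut-off at T makes the power
  integrable on the line for \<mu> < 1 and is invisible for times in (0, T).\<close>

definition caputo_kernel :: "real \<Rightarrow> real \<Rightarrow> real \<Rightarrow> real" where
  "caputo_kernel T \<mu> r = indicator {0<..<T} r * r powr (- \<mu>)"

lemma LINT_past:
  fixes t T :: real
  assumes t: "t \<in> {0<..<T}"
  shows "(LINT s|leb {0<..<t}. h (t - s) * f s) = (LINT s|leb {0<..<T}. indicat_real {0<..<T} (t - s) * h (t - s) * (f s :: real))"
  using t by (subst (1 2) integral_restrict_space) (auto intro!: Bochner_Integration.integral_cong simp: indicator_def)

lemma LINT_future:
  fixes t T :: real
  assumes t: "t \<in> {0<..<T}"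
  shows "(LINT s|leb {t<..<T}. h (s - t) * f s) = (LINT s|leb {0<..<T}. indicat_real {0<..<T} (s - t) * h (s - t) * (f s :: real))"
  using t by (subst (1 2) integral_restrict_space) (auto intro!: Bochner_Integration.integral_cong simp: indicator_def)

lemma caputo_volterra:
  "t \<in> {0<..<T} \<Longrightarrow> caputo \<mu> u t x = 1 / Gamma (1 - \<mu>) * volterra T (caputo_kernel T \<mu>) u t x"
  unfolding caputo_def volterra_def caputo_kernel_def by (subst LINT_past[where h="\<lambda>r. r powr (- \<mu>)"]) auto

text \<open>As (1 - \<mu>) - 1 = -\<mu>, the backward integral of order 1 - \<mu> has the reflected
  Caputo kernel with the same constant: it is the transpose of the map from \<open>u'\<close> to the
  Caputo derivative.\<close>

lemma J_right_volterra:
  "t \<in> {0<..<T} \<Longrightarrow> J_right T (1 - \<mu>) u t x = 1 / Gamma (1 - \<mu>) * volterra T (\<lambda>r. caputo_kernel T \<mu> (- r)) u t x"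
  unfolding J_right_def volterra_def caputo_kernel_def by (subst LINT_future[where h="\<lambda>r. r powr (1 - \<mu> - 1)"]) auto

lemma conv_volterra:
  "t \<in> {0<..<T} \<Longrightarrow> conv h u t x = volterra T (\<lambda>r. indicator {0<..<T} r * h r) u t x"
  unfolding conv_def volterra_def by (subst LINT_past[where h=h]) auto

lemma adj_conv_volterra:
  "t \<in> {0<..<T} \<Longrightarrow> adj_conv T h u t x = volterra T (\<lambda>r. indicator {0<..<T} (- r) * h (- r)) u t x"
  unfolding adj_conv_def volterra_def by (subst LINT_future[where h=h]) auto

lemma integrable_caputo_kernel: "\<mu> < 1 \<Longrightarrow> 0 < T \<Longrightarrow> integrable lborel (caputo_kernel T \<mu>)"
  unfolding caputo_kernel_def[abs_def] by (rule integrable_powr_kernel) auto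

lemma integrable_reflect: "integrable lborel (\<kappa> :: real \<Rightarrow> real) \<Longrightarrow> integrable lborel (\<lambda>r. \<kappa> (- r))"
  using lborel_integrable_real_affine_iff[of "-1" \<kappa> 0] by simp

lemma dominated_const: 
  assumes "finite_measure M" shows "dominated M N (\<lambda>t x. c)"
  unfolding dominated_def
  by (intro conjI bexI[of _ "\<lambda>_. \<bar>c\<bar>"] Lspace_2_bounded[OF assms, of _ "\<bar>c\<bar>"]) auto

text \<open>The two traces turn both weak derivatives into primitives, u from 0 and the fractional
  integral of \<phi> from T. What remains is two exchanges of integrals, one for the Caputo kernel
  and one for \<open>heaviside T\<close>; this needs no regularity in time beyond integrability of
  \<open>u'\<close> and \<open>d\<close>.\<close>

lemma duality_time_derivatives:
  fixes S :: "'a::euclidean_space set"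
  assumes S: "open S" "bounded S" and T: "0 < T" and \<mu>: "\<mu> < 1"
    and u: "dominated (leb S) (leb {0<..<T}) u" "L2_of_L1 (leb S) (leb {0<..<T}) u"
    and u': "L2_of_L1 (leb S) (leb {0<..<T}) u'" "time_deriv T S u u'"
    and u0: "has_time_trace T S u 0 (\<lambda>x. 0)"
    and \<phi>: "dominated (leb S) (leb {0<..<T}) \<phi>" "L2_of_L1 (leb S) (leb {0<..<T}) \<phi>"
    and d: "L2_of_L1 (leb S) (leb {0<..<T}) d" "has_D_right T S \<mu> \<phi> d"
    and JT: "has_time_trace T S (J_right T (1 - \<mu>) \<phi>) T (\<lambda>x. 0)"
  shows "integrable (leb S \<Otimes>\<^sub>M leb {0<..<T}) (\<lambda>z. caputo \<mu> u' (snd z) (fst z) * \<phi> (snd z) (fst z))"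
    and "integrable (leb S \<Otimes>\<^sub>M leb {0<..<T}) (\<lambda>z. d (snd z) (fst z) * u (snd z) (fst z))"
    and "(LINT z|(leb S \<Otimes>\<^sub>M leb {0<..<T}). caputo \<mu> u' (snd z) (fst z) * \<phi> (snd z) (fst z))
       = (LINT z|(leb S \<Otimes>\<^sub>M leb {0<..<T}). d (snd z) (fst z) * u (snd z) (fst z))"
proof -
  let ?M = "leb S" and ?N = "leb {0<..<T}"
  let ?\<kappa> = "caputo_kernel T \<mu>" and ?G = "1 / Gamma (1 - \<mu>)"
  let ?V = "volterra T ?\<kappa> u'" and ?J = "volterra T (\<lambda>r. ?\<kappa> (- r)) \<phi>"
  interpret M: finite_measure ?M using S by (intro finite_leb) auto
  interpret N: finite_measure ?N by (rule finite_leb) auto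
  interpret MN: pair_sigma_finite ?M ?N ..
  have sp: "snd z \<in> {0<..<T}" if "z \<in> space (?M \<Otimes>\<^sub>M ?N)" for z using that by (auto simp: space_pair_measure)
  have km: "integrable lborel ?\<kappa>" by (rule integrable_caputo_kernel[OF \<mu> T])
  have km': "integrable lborel (\<lambda>r. ?\<kappa> (- r))" by (rule integrable_reflect[OF km])
  note dual = volterra_dominated_duality[OF M.finite_measure_axioms km u'(1) \<phi>(1)]
  have ceq: "caputo \<mu> u' (snd z) (fst z) * \<phi> (snd z) (fst z) = ?G * (?V (snd z) (fst z) * \<phi> (snd z) (fst z))"
    if "z \<in> space (?M \<Otimes>\<^sub>M ?N)" for z by (simp add: caputo_volterra[OF sp[OF that]])
  show "integrable (?M \<Otimes>\<^sub>M ?N) (\<lambda>z. caputo \<mu> u' (snd z) (fst z) * \<phi> (snd z) (fst z))"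
  proof -
    have "integrable (?M \<Otimes>\<^sub>M ?N) (\<lambda>z. caputo \<mu> u' (snd z) (fst z) * \<phi> (snd z) (fst z))
       = integrable (?M \<Otimes>\<^sub>M ?N) (\<lambda>z. ?G * (?V (snd z) (fst z) * \<phi> (snd z) (fst z)))"
      by (intro Bochner_Integration.integrable_cong refl ceq)
    then show ?thesis using integrable_mult_right[OF dual(1), of ?G] by (simp only:)
  qed
  show du: "integrable (?M \<Otimes>\<^sub>M ?N) (\<lambda>z. d (snd z) (fst z) * u (snd z) (fst z))"
    by (rule integrable_L2_of_L1_mult_dominated[OF N.sigma_finite_measure_axioms d(1) u(1)])
  note u'i = L2_of_L1_integrable[OF M.finite_measure_axioms N.sigma_finite_measure_axioms u'(1)]
  note ui = L2_of_L1_integrable[OF M.finite_measure_axioms N.sigma_finite_measure_axioms u(2)]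
  note di = L2_of_L1_integrable[OF M.finite_measure_axioms N.sigma_finite_measure_axioms d(1)]
  have sec: "AE x in ?M. integrable ?N (\<lambda>t. u' t x)" "AE x in ?M. integrable ?N (\<lambda>t. d t x)"
    using MN.AE_integrable_fst'[OF u'i] MN.AE_integrable_fst'[OF di] by simp_all
  have hm: "heaviside T \<in> borel_measurable borel" by (simp add: heaviside_def)
  have hs: "(\<lambda>s. heaviside T (t - s)) \<in> borel_measurable ?N" for t
    by (rule measurable_compose[OF _ hm], intro measurable_restrict_space1) simp
  have hs': "(\<lambda>s. heaviside T (s - t)) \<in> borel_measurable ?N" for t
    by (rule measurable_compose[OF _ hm], intro measurable_restrict_space1) simp
  have uP: "AE x in ?M. AE t in ?N. u t x = volterra T (heaviside T) u' t x"
  proof -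
    obtain c where c: "c \<in> borel_measurable ?M"
      "AE z in ?M \<Otimes>\<^sub>M ?N. u (snd z) (fst z) = c (fst z) + volterra T (heaviside T) u' (snd z) (fst z)"
      by (rule time_primitive[OF S(1) T ui u'i u'(2)])
    have "AE x in ?M. c x + volterra T (heaviside T) u' 0 x = 0"
      by (rule time_trace_zero[OF S T _ u'i c u0]) (use T in auto)
    then show ?thesis using MN.AE_pair[OF c(2)]
    proof eventually_elim
      case (elim x)
      \<comment> \<open>At time 0 the kernel is evaluated at -s < 0, where it vanishes.\<close>
      have "volterra T (heaviside T) u' 0 x = (LINT s|?N. 0)"
        unfolding volterra_def by (intro Bochner_Integration.integral_cong) (auto simp: heaviside_def)
      then have "c x = 0" using elim(1) by simp
      then show ?case using elim(2) by simp
    qed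
  qed
  have JP: "AE x in ?M. AE t in ?N. ?G * ?J t x = (LINT s|?N. heaviside T (s - t) * d s x)"
  proof -
    have Jeq: "J_right T (1 - \<mu>) \<phi> (snd z) (fst z) = ?G * ?J (snd z) (fst z)" if "z \<in> space (?M \<Otimes>\<^sub>M ?N)" for z
      by (rule J_right_volterra[OF sp[OF that]])
    \<comment> \<open>Pairing with the constant function 1 makes integrability of the fractional
      integral itself a case of the duality lemma.\<close>
    have "integrable (?M \<Otimes>\<^sub>M ?N) (\<lambda>z. ?J (snd z) (fst z) * 1)"
      by (rule volterra_dominated_duality(1)[OF M.finite_measure_axioms km' \<phi>(2) dominated_const[OF M.finite_measure_axioms]])
    then have "integrable (?M \<Otimes>\<^sub>M ?N) (\<lambda>z. ?G * ?J (snd z) (fst z))" by (intro integrable_mult_right) simp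
    moreover have "integrable (?M \<Otimes>\<^sub>M ?N) (\<lambda>z. J_right T (1 - \<mu>) \<phi> (snd z) (fst z))
      = integrable (?M \<Otimes>\<^sub>M ?N) (\<lambda>z. ?G * ?J (snd z) (fst z))"
      by (intro Bochner_Integration.integrable_cong refl Jeq)
    ultimately have "integrable (?M \<Otimes>\<^sub>M ?N) (\<lambda>z. J_right T (1 - \<mu>) \<phi> (snd z) (fst z))" by (simp only:)
    then have Ji: "integrable (?M \<Otimes>\<^sub>M ?N) (\<lambda>(x, t). J_right T (1 - \<mu>) \<phi> t x)" by (simp add: case_prod_unfold)
    have mdi: "integrable (?M \<Otimes>\<^sub>M ?N) (\<lambda>(x, t). - d t x)"
      using di by (simp add: case_prod_unfold)
    obtain c where c: "c \<in> borel_measurable ?M"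
      "AE z in ?M \<Otimes>\<^sub>M ?N. J_right T (1 - \<mu>) \<phi> (snd z) (fst z) = c (fst z) + volterra T (heaviside T) (\<lambda>t x. - d t x) (snd z) (fst z)"
      by (rule time_primitive[OF S(1) T Ji mdi d(2)[unfolded has_D_right_def]])
    have "AE x in ?M. c x + volterra T (heaviside T) (\<lambda>t x. - d t x) T x = 0"
      by (rule time_trace_zero[OF S T _ mdi c JT]) (use T in auto)
    then show ?thesis using MN.AE_pair[OF c(2)] sec(2)
    proof eventually_elim
      case (elim x)
      \<comment> \<open>At time T the kernel is 1 on all of (0, T), so the vanishing trace makes
        \<open>c\<close> the integral of \<open>d\<close> over the whole interval.\<close>
      have "volterra T (heaviside T) (\<lambda>t x. - d t x) T x = (LINT s|?N. - d s x)"
        unfolding volterra_def by (intro Bochner_Integration.integral_cong) (auto simp: heaviside_def)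
      then have cx: "c x = (LINT s|?N. d s x)" using elim(1) by simp
      have "AE t in ?N. t \<in> {0<..<T}" using AE_space[of ?N] by simp
      then show ?case using elim(2)
      proof eventually_elim
        case el: (elim t)
        have hi: "integrable ?N (\<lambda>s. heaviside T (t - s) * d s x)"
          by (rule Bochner_Integration.integrable_bound[OF elim(3)])
             (use borel_measurable_times[OF hs borel_measurable_integrable[OF elim(3)]] in \<open>auto simp: heaviside_def indicator_def intro!: AE_I2\<close>)
        have "?G * ?J t x = (LINT s|?N. d s x) - (LINT s|?N. heaviside T (t - s) * d s x)"
          using el J_right_volterra[OF el(1), of \<mu> \<phi> x] cx by (simp add: volterra_def)
        also have "\<dots> = (LINT s|?N. d s x - heaviside T (t - s) * d s x)" using elim(3) hi by simp
        \<comment> \<open>The two step functions add up to 1 except at s = t.\<close>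
        also have "\<dots> = (LINT s|?N. heaviside T (s - t) * d s x)"
        proof (rule integral_cong_AE)
          show "(\<lambda>s. d s x - heaviside T (t - s) * d s x) \<in> borel_measurable ?N"
            using elim(3) hi by auto
          show "(\<lambda>s. heaviside T (s - t) * d s x) \<in> borel_measurable ?N"
            by (rule borel_measurable_times[OF hs' borel_measurable_integrable[OF elim(3)]])
          have "AE s in lborel. s \<in> {0<..<T} \<longrightarrow> s \<noteq> t \<and> s \<in> {0<..<T}" using AE_lborel_singleton[of t] by eventually_elim simp
          then have "AE s in ?N. s \<noteq> t \<and> s \<in> {0<..<T}" by (subst AE_restrict_space_iff) auto
          then show "AE s in ?N. d s x - heaviside T (t - s) * d s x = heaviside T (s - t) * d s x"
            by eventually_elim (use el(1) in \<open>auto simp: heaviside_def indicator_def\<close>)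
        qed
        finally show ?case .
      qed
    qed
  qed
  have u'm: "(\<lambda>z. u' (snd z) (fst z)) \<in> borel_measurable (?M \<Otimes>\<^sub>M ?N)" using u'(1) by (simp add: L2_of_L1_def case_prod_unfold)
  have Jm: "(\<lambda>z. ?J (snd z) (fst z)) \<in> borel_measurable (?M \<Otimes>\<^sub>M ?N)"
    using volterra_measurable[OF M.sigma_finite_measure_axioms, of "\<lambda>r. ?\<kappa> (- r)" \<phi> T] km' \<phi>
    by (simp add: dominated_def case_prod_unfold)
  have Vm: "(\<lambda>z. volterra T (heaviside T) u' (snd z) (fst z)) \<in> borel_measurable (?M \<Otimes>\<^sub>M ?N)"
    using volterra_measurable[OF M.sigma_finite_measure_axioms hm, of u' T] u'(1)
    by (simp add: L2_of_L1_def case_prod_unfold)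
  have dm: "(\<lambda>z. d (snd z) (fst z)) \<in> borel_measurable (?M \<Otimes>\<^sub>M ?N)" using d(1) by (simp add: L2_of_L1_def case_prod_unfold)
  have um: "(\<lambda>z. u (snd z) (fst z)) \<in> borel_measurable (?M \<Otimes>\<^sub>M ?N)" using u(1) by (simp add: dominated_def case_prod_unfold)
  have "(LINT z|(?M \<Otimes>\<^sub>M ?N). caputo \<mu> u' (snd z) (fst z) * \<phi> (snd z) (fst z))
     = (LINT z|(?M \<Otimes>\<^sub>M ?N). ?G * (?V (snd z) (fst z) * \<phi> (snd z) (fst z)))"
    by (rule Bochner_Integration.integral_cong[OF refl ceq])
  also have "\<dots> = ?G * (LINT x|?M. LINT s|?N. u' s x * ?J s x)" using dual(2) by simp
  also have "\<dots> = (LINT x|?M. LINT s|?N. u' s x * (?G * ?J s x))"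
    by (simp only: integral_mult_right_zero[symmetric] mult.left_commute)
  also have "\<dots> = (LINT x|?M. LINT t|?N. d t x * u t x)"
  proof (rule integral_cong_AE)
    show "(\<lambda>x. LINT s|?N. u' s x * (?G * ?J s x)) \<in> borel_measurable ?M"
      by (rule N.borel_measurable_lebesgue_integral) (use u'm Jm in \<open>simp add: case_prod_unfold\<close>)
    show "(\<lambda>x. LINT t|?N. d t x * u t x) \<in> borel_measurable ?M"
      by (rule N.borel_measurable_lebesgue_integral) (use dm um in \<open>simp add: case_prod_unfold\<close>)
    show "AE x in ?M. (LINT s|?N. u' s x * (?G * ?J s x)) = (LINT t|?N. d t x * u t x)"
      using JP uP sec AE_space
    proof eventually_elim
      case (elim x)
      note s = measurable_compose[OF measurable_Pair1'[OF elim(5)]]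
      have sm: "(\<lambda>s. u' s x) \<in> borel_measurable ?N" "(\<lambda>s. ?J s x) \<in> borel_measurable ?N"
        "(\<lambda>s. volterra T (heaviside T) u' s x) \<in> borel_measurable ?N" "(\<lambda>s. d s x) \<in> borel_measurable ?N" "(\<lambda>s. u s x) \<in> borel_measurable ?N"
        using s[OF u'm] s[OF Jm] s[OF Vm] s[OF dm] s[OF um] by simp_all
      have "(LINT s|?N. u' s x * (?G * ?J s x)) = (LINT s|?N. u' s x * (LINT t|?N. heaviside T (t - s) * d t x))"
      proof (rule integral_cong_AE)
        show "(\<lambda>s. u' s x * (?G * ?J s x)) \<in> borel_measurable ?N" using sm by measurable
        have "(\<lambda>z. heaviside T (snd z - fst z) * d (snd z) x) \<in> borel_measurable (?N \<Otimes>\<^sub>M ?N)"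
        proof -
          have id: "(\<lambda>x. x) \<in> ?N \<rightarrow>\<^sub>M (borel :: real measure)" by (intro measurable_restrict_space1) simp
          show ?thesis
            by (intro borel_measurable_times measurable_compose[OF measurable_snd sm(4)]
              measurable_compose[OF borel_measurable_diff[OF measurable_compose[OF measurable_snd id] measurable_compose[OF measurable_fst id]] hm])
        qed
        then have "(\<lambda>s. LINT t|?N. heaviside T (t - s) * d t x) \<in> borel_measurable ?N"
          by (intro N.borel_measurable_lebesgue_integral) (simp add: case_prod_unfold)
        then show "(\<lambda>s. u' s x * (LINT t|?N. heaviside T (t - s) * d t x)) \<in> borel_measurable ?N" using sm by measurable
        show "AE s in ?N. u' s x * (?G * ?J s x) = u' s x * (LINT t|?N. heaviside T (t - s) * d t x)"
          using elim(1) by eventually_elim simp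
      qed
      also have "\<dots> = (LINT t|?N. d t x * volterra T (heaviside T) u' t x)"
        unfolding volterra_def by (rule heaviside_duality[OF elim(3,4)])
      also have "\<dots> = (LINT t|?N. d t x * u t x)"
      proof (rule integral_cong_AE)
        show "AE t in ?N. d t x * volterra T (heaviside T) u' t x = d t x * u t x"
          using elim(2) by eventually_elim simp
      qed (use sm in measurable)
      finally show ?case .
    qed
  qed
  also have "\<dots> = (LINT z|(?M \<Otimes>\<^sub>M ?N). d (snd z) (fst z) * u (snd z) (fst z))"
    using MN.integral_fst'[OF du] by simp
  finally show "(LINT z|(?M \<Otimes>\<^sub>M ?N). caputo \<mu> u' (snd z) (fst z) * \<phi> (snd z) (fst z))
       = (LINT z|(?M \<Otimes>\<^sub>M ?N). d (snd z) (fst z) * u (snd z) (fst z))" .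
qed

section \<open>The Laplacian terms and the full identity\<close>

lemma integrable_pair_if_dominated:
  assumes N: "finite_measure N"
    and m: "F \<in> borel_measurable (M \<Otimes>\<^sub>M N)"
    and G: "G \<in> Lspace 2 M" "H \<in> Lspace 2 M" and C: "0 \<le> C"
    and b: "AE x in M. AE t in N. \<bar>F (x, t)\<bar> \<le> C * (\<bar>G x\<bar> * \<bar>H x\<bar>)"
  shows "integrable (M \<Otimes>\<^sub>M N) (F :: _ \<Rightarrow> real)"
proof -
  interpret N: finite_measure N by fact
  show ?thesis
  proof (rule integrable_pair_if_bound[OF N.sigma_finite_measure_axioms m G, where C="C * measure N (space N)"])
    show "AE x in M. (\<integral>\<^sup>+t. ennreal \<bar>F (x, t)\<bar> \<partial>N) \<le> ennreal (C * measure N (space N)) * (ennreal \<bar>G x\<bar> * ennreal \<bar>H x\<bar>)"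
      using b
    proof eventually_elim
      case (elim x)
      have "(\<integral>\<^sup>+t. ennreal \<bar>F (x, t)\<bar> \<partial>N) \<le> (\<integral>\<^sup>+t. ennreal (C * (\<bar>G x\<bar> * \<bar>H x\<bar>)) \<partial>N)"
        using elim by (intro nn_integral_mono_AE) (auto elim!: eventually_mono intro!: ennreal_leI)
      also have "\<dots> = ennreal (C * (\<bar>G x\<bar> * \<bar>H x\<bar>)) * ennreal (measure N (space N))"
        by (simp add: N.emeasure_eq_measure)
      also have "\<dots> = ennreal (C * measure N (space N)) * (ennreal \<bar>G x\<bar> * ennreal \<bar>H x\<bar>)"
        using C by (simp add: ennreal_mult mult_ac)
      finally show ?case .
    qed
  qed
qed

lemma laplacian_measurable:
  assumes S: "open S" and a: "a \<in> Hspace 2 S"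
  shows "laplacian S a \<in> borel_measurable (leb S)"
  unfolding laplacian_def[abs_def]
proof (rule borel_measurable_sum)
  fix i :: 'a assume i: "i \<in> Basis"
  show "wd S i (wd S i a) \<in> borel_measurable (leb S)"
    using Hspace_1_wd(2)[OF S Hspace_2_wd[OF S a i] i] by (simp add: Lspace_2_iff)
qed

text \<open>Green's formula at almost every time, integrated over time. The jointly measurable
  \<open>w\<close> and \<open>v\<close> stand for the Laplacians because
  \<open>laplacian S (u t)\<close> rests on a separate choice at each t and need not be measurable
  in time.\<close>

lemma integral_laplacian_symmetric:
  fixes S :: "'a::euclidean_space set" and T :: real
  assumes S: "open S" "bounded S"
    and u: "AE t in leb {0<..<T}. u t \<in> Hspace 2 S \<inter> H10 S" and \<phi>: "AE t in leb {0<..<T}. \<phi> t \<in> Hspace 2 S \<inter> H10 S"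
    and um: "(\<lambda>z. u (snd z) (fst z)) \<in> borel_measurable (leb S \<Otimes>\<^sub>M leb {0<..<T})"
    and \<phi>m: "(\<lambda>z. \<phi> (snd z) (fst z)) \<in> borel_measurable (leb S \<Otimes>\<^sub>M leb {0<..<T})"
    and wm: "(\<lambda>z. w (snd z) (fst z)) \<in> borel_measurable (leb S \<Otimes>\<^sub>M leb {0<..<T})"
    and vm: "(\<lambda>z. v (snd z) (fst z)) \<in> borel_measurable (leb S \<Otimes>\<^sub>M leb {0<..<T})"
    and w: "AE t in leb {0<..<T}. AE x in leb S. w t x = laplacian S (u t) x"
    and v: "AE t in leb {0<..<T}. AE x in leb S. v t x = laplacian S (\<phi> t) x"
    and wi: "integrable (leb S \<Otimes>\<^sub>M leb {0<..<T}) (\<lambda>z. w (snd z) (fst z) * \<phi> (snd z) (fst z))"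
    and vi: "integrable (leb S \<Otimes>\<^sub>M leb {0<..<T}) (\<lambda>z. v (snd z) (fst z) * u (snd z) (fst z))"
  shows "(LINT z|(leb S \<Otimes>\<^sub>M leb {0<..<T}). w (snd z) (fst z) * \<phi> (snd z) (fst z))
     = (LINT z|(leb S \<Otimes>\<^sub>M leb {0<..<T}). v (snd z) (fst z) * u (snd z) (fst z))"
proof -
  let ?M = "leb S" and ?N = "leb {0<..<T}"
  interpret M: finite_measure ?M using S by (intro finite_leb) auto
  interpret N: finite_measure ?N by (rule finite_leb) auto
  interpret MN: pair_sigma_finite ?M ?N ..
  have wi': "integrable (?M \<Otimes>\<^sub>M ?N) (\<lambda>(x, t). w t x * \<phi> t x)" using wi by (simp add: case_prod_unfold)
  have vi': "integrable (?M \<Otimes>\<^sub>M ?N) (\<lambda>(x, t). v t x * u t x)" using vi by (simp add: case_prod_unfold)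
  have "(LINT z|(?M \<Otimes>\<^sub>M ?N). w (snd z) (fst z) * \<phi> (snd z) (fst z)) = (LINT t|?N. LINT x|?M. w t x * \<phi> t x)"
    using MN.integral_snd[OF wi'] by (simp add: case_prod_unfold)
  also have "\<dots> = (LINT t|?N. LINT x|?M. v t x * u t x)"
  proof (rule integral_cong_AE)
    show "(\<lambda>t. LINT x|?M. w t x * \<phi> t x) \<in> borel_measurable ?N"
      by (rule borel_measurable_integrable[OF MN.integrable_snd[OF wi']])
    show "(\<lambda>t. LINT x|?M. v t x * u t x) \<in> borel_measurable ?N"
      by (rule borel_measurable_integrable[OF MN.integrable_snd[OF vi']])
    show "AE t in ?N. (LINT x|?M. w t x * \<phi> t x) = (LINT x|?M. v t x * u t x)"
      using u \<phi> w v AE_space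
    proof eventually_elim
      case (elim t)
      note s = measurable_compose[OF measurable_Pair2'[OF elim(5)]]
      have m: "u t \<in> borel_measurable ?M" "\<phi> t \<in> borel_measurable ?M" "w t \<in> borel_measurable ?M" "v t \<in> borel_measurable ?M"
        using s[OF um] s[OF \<phi>m] s[OF wm] s[OF vm] by simp_all
      have lm: "laplacian S (u t) \<in> borel_measurable ?M" "laplacian S (\<phi> t) \<in> borel_measurable ?M"
        using elim(1,2) by (auto intro: laplacian_measurable[OF S(1)])
      have "(LINT x|?M. w t x * \<phi> t x) = (LINT x|?M. laplacian S (u t) x * \<phi> t x)"
      proof (rule integral_cong_AE)
        show "AE x in ?M. w t x * \<phi> t x = laplacian S (u t) x * \<phi> t x" using elim(3) by eventually_elim simp
      qed (use m lm in measurable)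
      also have "\<dots> = (LINT x|?M. u t x * laplacian S (\<phi> t) x)" by (rule green_identity[OF S elim(1,2)])
      also have "\<dots> = (LINT x|?M. v t x * u t x)"
      proof (rule integral_cong_AE)
        show "AE x in ?M. u t x * laplacian S (\<phi> t) x = v t x * u t x" using elim(4) by eventually_elim simp
      qed (use m lm in measurable)
      finally show ?case .
    qed
  qed
  also have "\<dots> = (LINT z|(?M \<Otimes>\<^sub>M ?N). v (snd z) (fst z) * u (snd z) (fst z))"
    using MN.integral_snd[OF vi'] by (simp add: case_prod_unfold)
  finally show ?thesis .
qed

lemma solution_space_facts:
  fixes S :: "'a::euclidean_space set"
  assumes S: "open S" "bounded S" and T: "0 < T" and p: "1 < p" and u: "u \<in> solution_space p T S"
  shows "L2_of_L1 (leb S) (leb {0<..<T}) u" "dominated (leb S) (leb {0<..<T}) u"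
    "AE t in leb {0<..<T}. u t \<in> Hspace 2 S \<inter> H10 S"
    "(\<lambda>z. u (snd z) (fst z)) \<in> borel_measurable (leb S \<Otimes>\<^sub>M leb {0<..<T})"
proof -
  have Sb: "S \<in> sets borel" and p1: "1 \<le> p" using S p by auto
  have ub: "u \<in> bochner_L (ennreal p) T 2 S" using u unfolding solution_space_def W1_bochner_L_def by blast
  obtain v where v: "v \<in> bochner_L (ennreal p) T 2 S" "time_deriv T S u v"
    using u unfolding solution_space_def W1_bochner_L_def by blast
  show u2: "L2_of_L1 (leb S) (leb {0<..<T}) u" by (rule bochner_imp_L2_of_L1[OF Sb p1 ub])
  have "AE t in leb {0<..<T}. u t \<in> Lspace 2 (leb S)" using ub unfolding bochner_def by blast
  from dominated_time_derivative[OF S T u2 this bochner_imp_L2_of_L1[OF Sb p1 v(1)] v(2)]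
  show "dominated (leb S) (leb {0<..<T}) u" .
  show "AE t in leb {0<..<T}. u t \<in> Hspace 2 S \<inter> H10 S"
    using u unfolding solution_space_def bochner_def by blast
  show "(\<lambda>z. u (snd z) (fst z)) \<in> borel_measurable (leb S \<Otimes>\<^sub>M leb {0<..<T})"
    using u2 by (simp add: L2_of_L1_def case_prod_unfold)
qed

text \<open>The direct equation is multiplied by \<phi> and the adjoint one by u. Caputo,
  convolution and Laplacian terms agree pairwise, so the two sources do as well.\<close>

lemma adjoint_identity:
  fixes S S0 :: "'a::euclidean_space set"
  assumes S: "open S" "bounded S" and S0: "open S0" "S0 \<subseteq> S" and T: "0 < T" and H1: "hyp_H1 T \<alpha>"
    and f: "f \<in> Lspace 2 (leb S)" and \<beta>: "\<beta> \<in> borel_measurable (leb {0<..<T})" "AE t in leb {0<..<T}. \<bar>\<beta> t\<bar> \<le> B"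
    and \<omega>m: "(\<lambda>(x, t). \<omega> t x) \<in> borel_measurable (leb (S0 \<times> {0<..<T}))"
    and \<omega>: "AE z in leb (S0 \<times> {0<..<T}). \<bar>\<omega> (snd z) (fst z)\<bar> \<le> W"
    and ds: "direct_solution T S \<alpha> \<beta> f u" and as: "adjoint_solution T S S0 \<alpha> \<omega> \<phi>"
  shows "integrable (leb (S \<times> {0<..<T})) (\<lambda>z. \<beta> (snd z) * f (fst z) * \<phi> (snd z) (fst z))"
    and "integrable (leb (S \<times> {0<..<T})) (\<lambda>z. indicator S0 (fst z) * \<omega> (snd z) (fst z) * u (snd z) (fst z))"
    and "(LINT z|leb (S \<times> {0<..<T}). \<beta> (snd z) * f (fst z) * \<phi> (snd z) (fst z))
       = (LINT z|leb (S \<times> {0<..<T}). indicator S0 (fst z) * \<omega> (snd z) (fst z) * u (snd z) (fst z))"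
    and "(\<lambda>z. u (snd z) (fst z)) \<in> borel_measurable (leb (S \<times> {0<..<T}))"
proof -
  let ?I = "{0<..<T}" and ?M = "leb S" and ?N = "leb {0<..<T}"
  have Sb: "S \<in> sets borel" using S by auto
  have MN: "leb (S \<times> ?I) = ?M \<Otimes>\<^sub>M ?N" using Sb by (intro leb_Times) auto
  interpret M: finite_measure ?M using S by (intro finite_leb) auto
  interpret N: finite_measure ?N by (rule finite_leb) auto
  interpret MN: pair_sigma_finite ?M ?N ..
  interpret variable_exponent T \<alpha> by unfold_locales (rule T, rule H1)
  have \<mu>: "\<alpha> 0 < 1" using \<alpha>_bounds[of 0] T by simp
  obtain p u' w where D: "1 < p" "u \<in> solution_space p T S" "u' \<in> bochner_L (ennreal p) T 2 S" "time_deriv T S u u'"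
    "has_laplacian T S u w" "AE (x, t) in leb (S \<times> ?I).
        caputo (\<alpha> 0) u' t x - w t x + conv (deriv (g_tilde T \<alpha>)) u t x = f x * \<beta> t"
    "has_time_trace T S u 0 (\<lambda>x. 0)" using ds unfolding direct_solution_def by blast
  obtain q d v where A: "1 < q" "\<phi> \<in> solution_space q T S" "d \<in> bochner_L 1 T 2 S" "has_D_right T S (\<alpha> 0) \<phi> d"
    "has_laplacian T S \<phi> v" "AE (x, t) in leb (S \<times> ?I).
        d t x - v t x + adj_conv T (deriv (g_tilde T \<alpha>)) \<phi> t x = indicator S0 x * \<omega> t x"
    "has_time_trace T S (J_right T (1 - \<alpha> 0) \<phi>) T (\<lambda>x. 0)" using as unfolding adjoint_solution_def by blast
  note uf = solution_space_facts[OF S T D(1,2)] and \<phi>f = solution_space_facts[OF S T A(1,2)]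
  have u'2: "L2_of_L1 ?M ?N u'" by (rule bochner_imp_L2_of_L1[OF Sb _ D(3)]) (use D(1) in simp)
  have d2: "L2_of_L1 ?M ?N d" by (rule bochner_imp_L2_of_L1[OF Sb, of 1]) (use A(3) in simp_all)
  note time = duality_time_derivatives[OF S T \<mu> uf(2,1) u'2 D(4) D(7) \<phi>f(2,1) d2 A(4) A(7)]
  define k where "k r = indicator ?I r * deriv (g_tilde T \<alpha>) r" for r
  have ki: "integrable lborel k" unfolding k_def[abs_def] by (rule integrable_deriv_g_tilde)
  note dual1 = volterra_dominated_duality[OF M.finite_measure_axioms ki uf(1) \<phi>f(2)]
  \<comment> \<open>Supplies the integrability by which the iterated integral in
    \<open>dual1\<close> becomes a double integral.\<close>
  note dual2 = volterra_dominated_duality[OF M.finite_measure_axioms integrable_reflect[OF ki] \<phi>f(1) uf(2)]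
  have sp: "snd z \<in> ?I" if "z \<in> space (?M \<Otimes>\<^sub>M ?N)" for z using that by (auto simp: space_pair_measure)
  have ceq: "conv (deriv (g_tilde T \<alpha>)) u (snd z) (fst z) = volterra T k u (snd z) (fst z)" if "z \<in> space (?M \<Otimes>\<^sub>M ?N)" for z
    by (simp add: conv_volterra[OF sp[OF that]] k_def[abs_def])
  have aeq: "adj_conv T (deriv (g_tilde T \<alpha>)) \<phi> (snd z) (fst z) = volterra T (\<lambda>r. k (- r)) \<phi> (snd z) (fst z)" if "z \<in> space (?M \<Otimes>\<^sub>M ?N)" for z
    by (simp add: adj_conv_volterra[OF sp[OF that]] k_def[abs_def])
  have conv_dual: "(LINT z|(?M \<Otimes>\<^sub>M ?N). volterra T k u (snd z) (fst z) * \<phi> (snd z) (fst z))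
     = (LINT z|(?M \<Otimes>\<^sub>M ?N). volterra T (\<lambda>r. k (- r)) \<phi> (snd z) (fst z) * u (snd z) (fst z))"
    unfolding dual1(2) MN.integral_fst'[OF dual2(1), symmetric] by (simp add: mult.commute)
  obtain \<Phi> where \<Phi>: "\<Phi> \<in> Lspace 2 ?M" "AE x in ?M. AE t in ?N. \<bar>\<phi> t x\<bar> \<le> \<Phi> x" using \<phi>f(2) unfolding dominated_def by blast
  obtain U where U: "U \<in> Lspace 2 ?M" "AE x in ?M. AE t in ?N. \<bar>u t x\<bar> \<le> U x" using uf(2) unfolding dominated_def by blast
  have fm: "f \<in> borel_measurable ?M" using f by (simp add: Lspace_2_iff)
  have Fi: "integrable (?M \<Otimes>\<^sub>M ?N) (\<lambda>z. \<beta> (snd z) * f (fst z) * \<phi> (snd z) (fst z))"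
  proof (rule integrable_pair_if_dominated[OF N.finite_measure_axioms _ f \<Phi>(1), of _ "\<bar>B\<bar>"])
    show "(\<lambda>z. \<beta> (snd z) * f (fst z) * \<phi> (snd z) (fst z)) \<in> borel_measurable (?M \<Otimes>\<^sub>M ?N)"
      by (intro borel_measurable_times \<phi>f(4) measurable_compose[OF measurable_snd \<beta>(1)] measurable_compose[OF measurable_fst fm])
    show "AE x in ?M. AE t in ?N. \<bar>\<beta> (snd (x, t)) * f (fst (x, t)) * \<phi> (snd (x, t)) (fst (x, t))\<bar> \<le> \<bar>B\<bar> * (\<bar>f x\<bar> * \<bar>\<Phi> x\<bar>)"
      using \<Phi>(2)
    proof eventually_elim
      case (elim x)
      show ?case using elim \<beta>(2)
      proof eventually_elim
        case (elim t)
        then show ?case unfolding snd_conv fst_conv abs_mult mult.assoc by (intro mult_mono mult_nonneg_nonneg) auto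
      qed
    qed
  qed simp
  have S0b: "S0 \<in> sets borel" using S0 by auto
  \<comment> \<open>\<open>\<omega>\<close> is given as a measurable function on
    \<open>S0 \<times> ?I\<close> only; the indicator extends it by zero.\<close>
  have \<omega>m': "(\<lambda>z. indicator S0 (fst z) * \<omega> (snd z) (fst z)) \<in> borel_measurable (?M \<Otimes>\<^sub>M ?N)"
  proof -
    have SI: "S0 \<times> ?I \<inter> space lborel \<in> sets (lborel :: ('a \<times> real) measure)"
      using S0(1) by (simp add: open_Times borel_open)
    have "(\<lambda>z. indicat_real (S0 \<times> ?I) z * \<omega> (snd z) (fst z)) \<in> borel_measurable lborel"
      using \<omega>m unfolding borel_measurable_restrict_space_iff[OF SI] by (simp add: case_prod_unfold)
    then have "(\<lambda>z. indicat_real (S0 \<times> ?I) z * \<omega> (snd z) (fst z)) \<in> borel_measurable (?M \<Otimes>\<^sub>M ?N)"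
      unfolding MN[symmetric] by (rule measurable_restrict_space1)
    moreover have "indicat_real (S0 \<times> ?I) z * \<omega> (snd z) (fst z) = indicator S0 (fst z) * \<omega> (snd z) (fst z)"
      if "z \<in> space (?M \<Otimes>\<^sub>M ?N)" for z using sp[OF that] by (cases z) (auto simp: indicator_def)
    ultimately show ?thesis by (subst (asm) measurable_cong) auto
  qed
  have \<omega>b: "AE x in ?M. AE t in ?N. \<bar>indicator S0 x * \<omega> t x\<bar> \<le> \<bar>W\<bar>"
  proof -
    have "AE z in lborel. z \<in> S0 \<times> ?I \<longrightarrow> \<bar>\<omega> (snd z) (fst z)\<bar> \<le> W"
      using \<omega> S0(1) by (subst (asm) AE_restrict_space_iff) (auto simp: open_Times borel_open)
    then have "AE z in lborel. z \<in> S \<times> ?I \<longrightarrow> \<bar>indicator S0 (fst z) * \<omega> (snd z) (fst z)\<bar> \<le> \<bar>W\<bar>"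
      by eventually_elim (auto simp: indicator_def)
    then have "AE z in leb (S \<times> ?I). \<bar>indicator S0 (fst z) * \<omega> (snd z) (fst z)\<bar> \<le> \<bar>W\<bar>"
      using S(1) by (subst AE_restrict_space_iff) (auto simp: open_Times borel_open)
    from MN.AE_pair[OF this[unfolded MN]] show ?thesis by simp
  qed
  have \<omega>i: "integrable (?M \<Otimes>\<^sub>M ?N) (\<lambda>z. indicator S0 (fst z) * \<omega> (snd z) (fst z) * u (snd z) (fst z))"
  proof (rule integrable_pair_if_dominated[OF N.finite_measure_axioms borel_measurable_times[OF \<omega>m' uf(4)] _ U(1), of "\<lambda>_. 1" "\<bar>W\<bar>"])
    show "(\<lambda>_. 1) \<in> Lspace 2 ?M" by (rule Lspace_2_bounded[OF M.finite_measure_axioms, of _ 1]) auto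
    show "AE x in ?M. AE t in ?N. \<bar>indicator S0 (fst (x, t)) * \<omega> (snd (x, t)) (fst (x, t)) * u (snd (x, t)) (fst (x, t))\<bar> \<le> \<bar>W\<bar> * (\<bar>1\<bar> * \<bar>U x\<bar>)"
      using U(2) \<omega>b
    proof eventually_elim
      case (elim x)
      show ?case using elim
      proof eventually_elim
        case (elim t)
        have "\<bar>indicator S0 x * \<omega> t x\<bar> * \<bar>u t x\<bar> \<le> \<bar>W\<bar> * \<bar>U x\<bar>" using elim by (intro mult_mono) auto
        then show ?case by (simp add: abs_mult)
      qed
    qed
  qed simp
  have wm: "(\<lambda>z. w (snd z) (fst z)) \<in> borel_measurable (?M \<Otimes>\<^sub>M ?N)"
    using D(5) unfolding has_laplacian_def MN by (simp add: case_prod_unfold)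
  have vm: "(\<lambda>z. v (snd z) (fst z)) \<in> borel_measurable (?M \<Otimes>\<^sub>M ?N)"
    using A(5) unfolding has_laplacian_def MN by (simp add: case_prod_unfold)
  \<comment> \<open>The equation times \<phi>, solved for the Laplacian term: every term on the left
    is integrable, hence so is the one on the right.\<close>
  have D6: "AE z in ?M \<Otimes>\<^sub>M ?N. caputo (\<alpha> 0) u' (snd z) (fst z) * \<phi> (snd z) (fst z) + volterra T k u (snd z) (fst z) * \<phi> (snd z) (fst z)
       - \<beta> (snd z) * f (fst z) * \<phi> (snd z) (fst z) = w (snd z) (fst z) * \<phi> (snd z) (fst z)"
    using D(6)[unfolded MN case_prod_unfold] AE_space
  proof eventually_elim
    case (elim z)
    have e: "w (snd z) (fst z) = caputo (\<alpha> 0) u' (snd z) (fst z) + volterra T k u (snd z) (fst z) - \<beta> (snd z) * f (fst z)"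
      using elim(1) ceq[OF elim(2)] by (simp add: algebra_simps)
    show ?case unfolding e by (simp add: algebra_simps)
  qed
  have A6: "AE z in ?M \<Otimes>\<^sub>M ?N. d (snd z) (fst z) * u (snd z) (fst z) + volterra T (\<lambda>r. k (- r)) \<phi> (snd z) (fst z) * u (snd z) (fst z)
       - indicator S0 (fst z) * \<omega> (snd z) (fst z) * u (snd z) (fst z) = v (snd z) (fst z) * u (snd z) (fst z)"
    using A(6)[unfolded MN case_prod_unfold] AE_space
  proof eventually_elim
    case (elim z)
    have e: "v (snd z) (fst z) = d (snd z) (fst z) + volterra T (\<lambda>r. k (- r)) \<phi> (snd z) (fst z) - indicator S0 (fst z) * \<omega> (snd z) (fst z)"
      using elim(1) aeq[OF elim(2)] by (simp add: algebra_simps)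
    show ?case unfolding e by (simp add: algebra_simps)
  qed
  note Di = Bochner_Integration.integrable_diff[OF Bochner_Integration.integrable_add[OF time(1) dual1(1)] Fi]
  note Ai = Bochner_Integration.integrable_diff[OF Bochner_Integration.integrable_add[OF time(2) dual2(1)] \<omega>i]
  note wim = borel_measurable_times[OF wm \<phi>f(4)] and vim = borel_measurable_times[OF vm uf(4)]
  have wi: "integrable (?M \<Otimes>\<^sub>M ?N) (\<lambda>z. w (snd z) (fst z) * \<phi> (snd z) (fst z))"
    by (rule integrable_cong_AE_imp[OF Di wim D6])
  have vi: "integrable (?M \<Otimes>\<^sub>M ?N) (\<lambda>z. v (snd z) (fst z) * u (snd z) (fst z))"
    by (rule integrable_cong_AE_imp[OF Ai vim A6])
  have w_int: "(LINT z|(?M \<Otimes>\<^sub>M ?N). caputo (\<alpha> 0) u' (snd z) (fst z) * \<phi> (snd z) (fst z))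
      + (LINT z|(?M \<Otimes>\<^sub>M ?N). volterra T k u (snd z) (fst z) * \<phi> (snd z) (fst z))
      - (LINT z|(?M \<Otimes>\<^sub>M ?N). \<beta> (snd z) * f (fst z) * \<phi> (snd z) (fst z))
    = (LINT z|(?M \<Otimes>\<^sub>M ?N). w (snd z) (fst z) * \<phi> (snd z) (fst z))"
    using integral_cong_AE[OF borel_measurable_integrable[OF Di] wim D6]
    unfolding Bochner_Integration.integral_diff[OF Bochner_Integration.integrable_add[OF time(1) dual1(1)] Fi]
      Bochner_Integration.integral_add[OF time(1) dual1(1)] .
  have v_int: "(LINT z|(?M \<Otimes>\<^sub>M ?N). d (snd z) (fst z) * u (snd z) (fst z))
      + (LINT z|(?M \<Otimes>\<^sub>M ?N). volterra T (\<lambda>r. k (- r)) \<phi> (snd z) (fst z) * u (snd z) (fst z))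
      - (LINT z|(?M \<Otimes>\<^sub>M ?N). indicator S0 (fst z) * \<omega> (snd z) (fst z) * u (snd z) (fst z))
    = (LINT z|(?M \<Otimes>\<^sub>M ?N). v (snd z) (fst z) * u (snd z) (fst z))"
    using integral_cong_AE[OF borel_measurable_integrable[OF Ai] vim A6]
    unfolding Bochner_Integration.integral_diff[OF Bochner_Integration.integrable_add[OF time(2) dual2(1)] \<omega>i]
      Bochner_Integration.integral_add[OF time(2) dual2(1)] .
  have wL: "AE t in ?N. AE x in ?M. w t x = laplacian S (u t) x" using D(5) by (simp add: has_laplacian_def)
  have vL: "AE t in ?N. AE x in ?M. v t x = laplacian S (\<phi> t) x" using A(5) by (simp add: has_laplacian_def)
  have green: "(LINT z|(?M \<Otimes>\<^sub>M ?N). w (snd z) (fst z) * \<phi> (snd z) (fst z)) = (LINT z|(?M \<Otimes>\<^sub>M ?N). v (snd z) (fst z) * u (snd z) (fst z))"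
    by (rule integral_laplacian_symmetric[OF S uf(3) \<phi>f(3) uf(4) \<phi>f(4) wm vm wL vL wi vi])
  show "integrable (leb (S \<times> ?I)) (\<lambda>z. \<beta> (snd z) * f (fst z) * \<phi> (snd z) (fst z))" unfolding MN by (rule Fi)
  show "integrable (leb (S \<times> ?I)) (\<lambda>z. indicator S0 (fst z) * \<omega> (snd z) (fst z) * u (snd z) (fst z))" unfolding MN by (rule \<omega>i)
  show "(LINT z|leb (S \<times> ?I). \<beta> (snd z) * f (fst z) * \<phi> (snd z) (fst z))
       = (LINT z|leb (S \<times> ?I). indicator S0 (fst z) * \<omega> (snd z) (fst z) * u (snd z) (fst z))"
    unfolding MN using w_int v_int green time(3) conv_dual by linarith
  show "(\<lambda>z. u (snd z) (fst z)) \<in> borel_measurable (leb (S \<times> ?I))" unfolding MN by (rule uf(4))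
qed

section \<open>The bound on the weighted norm\<close>

text \<open>The identities for \<open>f1\<close> and \<open>f2\<close> share the same \<phi>, so
  subtracting them gives the one for the difference without forming a solution for
  \<open>f1 - f2\<close>. Hoelder's inequality with exponents \<infinity> and 1 on
  \<open>S0 \<times> {0<..<T}\<close> finishes.\<close>

lemma B_form_bound:
  fixes S S0 :: "'a::euclidean_space set"
  assumes S: "open S" "bounded S" and S0: "open S0" "S0 \<subseteq> S" and T: "0 < T" and H1: "hyp_H1 T \<alpha>"
    and f: "f1 \<in> Lspace 2 (leb S)" "f2 \<in> Lspace 2 (leb S)"
    and \<beta>: "\<beta> \<in> borel_measurable (leb {0<..<T})" "AE t in leb {0<..<T}. \<bar>\<beta> t\<bar> \<le> B"
    and \<omega>: "\<omega> \<in> weights T S0"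
    and ds: "direct_solution T S \<alpha> \<beta> f1 u1" "direct_solution T S \<alpha> \<beta> f2 u2" and as: "adjoint_solution T S S0 \<alpha> \<omega> \<phi>"
  shows "ennreal \<bar>B_form T S \<beta> (\<lambda>x. f1 x - f2 x) \<phi>\<bar> / Lnorm \<infinity> (leb (S0 \<times> {0<..<T})) (\<lambda>(x, t). \<omega> t x)
     \<le> Lnorm 1 (leb (S0 \<times> {0<..<T})) (\<lambda>(x, t). u1 t x - u2 t x)"
proof -
  let ?I = "{0<..<T}"
  let ?L = "leb (S \<times> ?I)" and ?K = "leb (S0 \<times> ?I)"
  let ?W = "Lnorm \<infinity> ?K (\<lambda>(x, t). \<omega> t x)"
  have \<omega>m: "(\<lambda>(x, t). \<omega> t x) \<in> borel_measurable ?K"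
    using \<omega> unfolding weights_def W1_bochner_L_def bochner_def by blast
  have W: "?W = esssup ?K (\<lambda>z. ennreal \<bar>\<omega> (snd z) (fst z)\<bar>)" by (simp add: Lnorm_def case_prod_unfold)
  have \<omega>b: "AE z in ?K. ennreal \<bar>\<omega> (snd z) (fst z)\<bar> \<le> ?W" unfolding W by (rule esssup_AE)
  have L1: "Lnorm 1 ?K (\<lambda>(x, t). u1 t x - u2 t x) = (\<integral>\<^sup>+z. ennreal \<bar>u1 (snd z) (fst z) - u2 (snd z) (fst z)\<bar> \<partial>?K)"
    by (cases "(\<integral>\<^sup>+z. ennreal \<bar>u1 (snd z) (fst z) - u2 (snd z) (fst z)\<bar> \<partial>?K)")
       (auto simp: Lnorm_def Let_def case_prod_unfold)
  show ?thesis
  proof (cases "?W = \<infinity>")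
    \<comment> \<open>Division by \<infinity> gives 0.\<close>
    case True
    then show ?thesis by simp
  next
    case False
    then obtain W where W': "?W = ennreal W" "0 \<le> W" by (cases ?W) auto
    have "AE z in ?K. \<bar>\<omega> (snd z) (fst z)\<bar> \<le> W" using \<omega>b unfolding W'(1) by eventually_elim (use W'(2) in simp)
    note id1 = adjoint_identity[OF S S0 T H1 f(1) \<beta> \<omega>m this ds(1) as]
      and id2 = adjoint_identity[OF S S0 T H1 f(2) \<beta> \<omega>m this ds(2) as]
    let ?\<omega> = "\<lambda>z. indicat_real S0 (fst z) * \<omega> (snd z) (fst z)"
    let ?u = "\<lambda>z. u1 (snd z) (fst z) - u2 (snd z) (fst z)"
    \<comment> \<open>A weight is not almost everywhere zero; the final division by
      \<open>?W\<close> relies on this.\<close>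
    have pos: "0 < ?W"
    proof (rule ccontr)
      assume "\<not> 0 < ?W"
      then have "?W = 0" by simp
      then have "AE z in ?K. (case z of (x, t) \<Rightarrow> \<omega> t x = 0)"
        using \<omega>b by (auto simp: case_prod_unfold elim!: eventually_mono)
      then show False using \<omega> by (simp add: weights_def)
    qed
    have ii: "integrable ?L (\<lambda>z. ?\<omega> z * ?u z)"
      using Bochner_Integration.integrable_diff[OF id1(2) id2(2)] by (simp add: right_diff_distrib)
    have "B_form T S \<beta> (\<lambda>x. f1 x - f2 x) \<phi>
      = (LINT z|?L. \<beta> (snd z) * f1 (fst z) * \<phi> (snd z) (fst z) - \<beta> (snd z) * f2 (fst z) * \<phi> (snd z) (fst z))"
      unfolding B_form_def case_prod_unfold by (simp add: algebra_simps)
    also have "\<dots> = (LINT z|?L. ?\<omega> z * u1 (snd z) (fst z)) - (LINT z|?L. ?\<omega> z * u2 (snd z) (fst z))"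
      unfolding Bochner_Integration.integral_diff[OF id1(1) id2(1)] id1(3) id2(3) ..
    also have "\<dots> = (LINT z|?L. ?\<omega> z * ?u z)"
      using Bochner_Integration.integral_diff[OF id1(2) id2(2)] by (simp add: right_diff_distrib)
    finally have "ennreal \<bar>B_form T S \<beta> (\<lambda>x. f1 x - f2 x) \<phi>\<bar> \<le> (\<integral>\<^sup>+z. ennreal \<bar>?\<omega> z * ?u z\<bar> \<partial>?L)"
      using integral_norm_bound_ennreal[OF ii] by simp
    also have "\<dots> = (\<integral>\<^sup>+z. ennreal \<bar>\<omega> (snd z) (fst z)\<bar> * ennreal \<bar>?u z\<bar> \<partial>?K)"
    proof -
      have o: "S \<times> ?I \<inter> space lborel \<in> sets (lborel :: ('a \<times> real) measure)" "S0 \<times> ?I \<inter> space lborel \<in> sets (lborel :: ('a \<times> real) measure)"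
        using S S0 by (simp_all add: open_Times borel_open)
      show ?thesis unfolding nn_integral_restrict_space[OF o(1)] nn_integral_restrict_space[OF o(2)]
        by (rule nn_integral_cong) (use S0(2) in \<open>auto simp: indicator_def abs_mult ennreal_mult\<close>)
    qed
    also have "\<dots> \<le> (\<integral>\<^sup>+z. ?W * ennreal \<bar>?u z\<bar> \<partial>?K)"
      using \<omega>b by (intro nn_integral_mono_AE) (auto elim!: eventually_mono intro!: mult_right_mono)
    also have "\<dots> = ?W * (\<integral>\<^sup>+z. ennreal \<bar>?u z\<bar> \<partial>?K)"
    proof (rule nn_integral_cmult)
      have sub: "S0 \<times> ?I \<subseteq> S \<times> ?I" using S0(2) by auto
      have "(\<lambda>z. u1 (snd z) (fst z)) \<in> borel_measurable ?K" "(\<lambda>z. u2 (snd z) (fst z)) \<in> borel_measurable ?K"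
        using id1(4) id2(4) sub by (auto intro: measurable_restrict_mono)
      then show "(\<lambda>z. ennreal \<bar>?u z\<bar>) \<in> borel_measurable ?K" by measurable
    qed
    finally show ?thesis unfolding L1 by (rule divide_le_posI_ennreal[OF pos])
  qed
qed

theorem theorem5:
  fixes \<Omega> \<Omega>0 :: "'a::euclidean_space set" and T :: real and \<alpha> \<beta> :: "real \<Rightarrow> real"
  assumes "1 \<le> DIM('a)" and "DIM('a) \<le> 3"
    and "open \<Omega>" and "bounded \<Omega>" and "simply_connected \<Omega>"
    and "piecewise_smooth_convex_corners \<Omega>"
    and "open \<Omega>0" and "\<Omega>0 \<noteq> {}" and "\<Omega>0 \<subseteq> \<Omega>"
    and "0 < T"
    and "hyp_H1 T \<alpha>" and "hyp_H2 T \<alpha>"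
    and "\<beta> \<in> W1_scalar 1 T"
    and "\<not> (AE t in leb {0<..<T}. \<beta> t = 0)"
  shows "\<exists>C>0. \<forall>f1\<in>Lspace 2 (leb \<Omega>). \<forall>f2\<in>Lspace 2 (leb \<Omega>). \<forall>u1 u2.
      direct_solution T \<Omega> \<alpha> \<beta> f1 u1 \<longrightarrow> direct_solution T \<Omega> \<alpha> \<beta> f2 u2 \<longrightarrow>
      B_norm T \<Omega> \<Omega>0 \<alpha> \<beta> (\<lambda>x. f1 x - f2 x)
        \<le> ennreal C * Lnorm 1 (leb (\<Omega>0 \<times> {0<..<T})) (\<lambda>(x, t). u1 t x - u2 t x)"
proof -
  let ?N = "leb {0<..<T}"
  let ?b = "Lnorm \<infinity> ?N \<beta>"
  have \<beta>m: "\<beta> \<in> borel_measurable ?N" using \<open>\<beta> \<in> W1_scalar 1 T\<close> by (simp add: W1_scalar_def Lspace_def)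
  have \<beta>b: "AE t in ?N. ennreal \<bar>\<beta> t\<bar> \<le> ?b" unfolding Lnorm_def by (simp add: esssup_AE)
  show ?thesis
  proof (cases "?b = \<infinity>")
    case True  \<comment> \<open>the factor \<open>1 / \<infinity>\<close> in \<open>B_norm\<close> is \<open>0\<close>\<close>
    then show ?thesis by (intro exI[of _ 1]) (simp add: B_norm_def)
  next
    case False
    then obtain b where b: "?b = ennreal b" "0 \<le> b" by (cases ?b) auto
    \<comment> \<open>For \<open>b = 0\<close> the factor \<open>1 / ?b\<close> would be infinite;
      this is where \<beta> not vanishing identically enters.\<close>
    have "b \<noteq> 0"
    proof
      assume "b = 0"
      then have "AE t in ?N. \<beta> t = 0" using \<beta>b b by (auto elim!: eventually_mono)
      then show False using \<open>\<not> (AE t in ?N. \<beta> t = 0)\<close> by blast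
    qed
    then have b0: "0 < b" using b by simp
    have \<beta>b': "AE t in ?N. \<bar>\<beta> t\<bar> \<le> b" using \<beta>b unfolding b(1) by eventually_elim (use b(2) in simp)
    have inv: "1 / ?b = ennreal (1 / b)" unfolding b(1) using b0 by (simp add: divide_ennreal flip: ennreal_1)
    show ?thesis
    proof (intro exI[of _ "1 / b"] conjI ballI allI impI)
      show "0 < 1 / b" using b0 by simp
      fix f1 f2 u1 u2
      assume f: "f1 \<in> Lspace 2 (leb \<Omega>)" "f2 \<in> Lspace 2 (leb \<Omega>)"
        and u: "direct_solution T \<Omega> \<alpha> \<beta> f1 u1" "direct_solution T \<Omega> \<alpha> \<beta> f2 u2"
      show "B_norm T \<Omega> \<Omega>0 \<alpha> \<beta> (\<lambda>x. f1 x - f2 x)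
          \<le> ennreal (1 / b) * Lnorm 1 (leb (\<Omega>0 \<times> {0<..<T})) (\<lambda>(x, t). u1 t x - u2 t x)"
        unfolding B_norm_def inv
      proof (intro mult_left_mono SUP_least)
        fix z assume "z \<in> {(\<omega>, \<phi>). \<omega> \<in> weights T \<Omega>0 \<and> adjoint_solution T \<Omega> \<Omega>0 \<alpha> \<omega> \<phi>}"
        then obtain \<omega> \<phi> where z: "z = (\<omega>, \<phi>)" "\<omega> \<in> weights T \<Omega>0" "adjoint_solution T \<Omega> \<Omega>0 \<alpha> \<omega> \<phi>" by auto
        show "(case z of (\<omega>, \<phi>) \<Rightarrow> ennreal \<bar>B_form T \<Omega> \<beta> (\<lambda>x. f1 x - f2 x) \<phi>\<bar> / Lnorm \<infinity> (leb (\<Omega>0 \<times> {0<..<T})) (\<lambda>(x, t). \<omega> t x))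
          \<le> Lnorm 1 (leb (\<Omega>0 \<times> {0<..<T})) (\<lambda>(x, t). u1 t x - u2 t x)"
          unfolding z(1) prod.case
          by (rule B_form_bound[OF \<open>open \<Omega>\<close> \<open>bounded \<Omega>\<close> \<open>open \<Omega>0\<close> \<open>\<Omega>0 \<subseteq> \<Omega>\<close> \<open>0 < T\<close> \<open>hyp_H1 T \<alpha>\<close> f \<beta>m \<beta>b' z(2) u z(3)])
      qed simp
    qed
  qed
qed

end
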